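(* Let $f\in C^2(\mathbb{R}^n,\mathbb{R})$ and $F_1,F_2\in C^2(\mathbb{R}^n,\mathbb{R}^\kappa)$ be the defining functions of MPCC, and let $\mathcal{S}^=_t$, with feasible set $M^{\mathcal{S}^=}_t$, be its smoothing with parameter $t>0$. Let $\bar x\in M$ be a nondegenerate C-stationary point of MPCC with C-index $c$. Then, for every sufficiently small neighborhood $U$ of $\bar x$ there is $t_0>0$ such that for all $t\in(0,t_0)$: there exists a nondegenerate Karush-Kuhn-Tucker point $x^t\in M^{\mathcal{S}^=}_t$ of $\mathcal{S}^=_t$ within $U$ which has the same quadratic index $c$; moreover, $x^t$ is the unique Karush-Kuhn-Tucker point of $\mathcal{S}^=_t$ in $U$.
   Context: **MPCC.** $\min_x f(x)$ s.t. $x\in M$, where $M=\{x\in\mathbb{R}^n\mid F_{1,j}(x)F_{2,j}(x)=0,\ F_{1,j}(x)\ge 0,\ F_{2,j}(x)\ge 0,\ j=1,\dots,\kappa\}$. $D$ and $D^2$ denote differential and Hessian. For $\bar x\in M$ put $a_{01}(\bar x)=\{j\mid F_{1,j}(\bar x)=0,F_{2,j}(\bar x)>0\}$, $a_{10}(\bar x)=\{j\mid F_{1,j}(\bar x)>0,F_{2,j}(\bar x)=0\}$, $a_{00}(\bar x)=\{j\mid F_{1,j}(\bar x)=0,F_{2,j}(\bar x)=0\}$. **C-stationarity.** $\bar x\in M$ is C-stationary with multipliers $(\bar\sigma,\bar\varrho)$, consisting of $\bar\sigma_{1,j}$ ($j\in a_{01}(\bar x)$), $\bar\sigma_{2,j}$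 ($j\in a_{10}(\bar x)$), $\bar\varrho_{1,j},\bar\varrho_{2,j}$ ($j\in a_{00}(\bar x)$), if $$Df(\bar x)=\sum_{j\in a_{01}(\bar x)}\bar\sigma_{1,j}DF_{1,j}(\bar x)+\sum_{j\in a_{10}(\bar x)}\bar\sigma_{2,j}DF_{2,j}(\bar x)+\sum_{j\in a_{00}(\bar x)}\big(\bar\varrho_{1,j}DF_{1,j}(\bar x)+\bar\varrho_{2,j}DF_{2,j}(\bar x)\big)$$ and $\bar\varrho_{1,j}\bar\varrho_{2,j}\ge 0$ for all $j\in a_{00}(\bar x)$. The Lagrange function is $$L(x)=f(x)-\sum_{j\in a_{01}(\bar x)}\bar\sigma_{1,j}F_{1,j}(x)-\sum_{j\in a_{10}(\bar x)}\bar\sigma_{2,j}F_{2,j}(x)-\sum_{j\in a_{00}(\bar x)}\big(\bar\varrho_{1,j}F_{1,j}(x)+\bar\varrho_{2,j}F_{2,j}(x)\big),$$ and the tangent space is $\mathcal{T}_{\bar x}=\{\xi\in\mathbb{R}^n\mid DF_{1,j}(\bar x)\xi=0,\ j\in a_{01}(\bar x)\cup a_{00}(\bar x);\ DF_{2,j}(\bar x)\xi=0,\ j\in a_{10}(\bar x)\cup a_{00}(\bar x)\}$. A C-stationary point $\bar x$ with multipliers $(\bar\sigma,\bar\varrho)$ is **nondegenerate** if - NDC1: MPCC-LICQ holds, i.e. the vectors $DF_{1,j}(\bar x)$, $j\in a_{01}(\bar x)\cup a_{00}(\bar x)$, $DF_{2,j}(\bar x)$, $j\in a_{10}(\bar x)\cup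 a_{00}(\bar x)$, are linearly independent (so the multipliers are unique); - NDC2: $\bar\varrho_{1,j}\bar\varrho_{2,j}>0$ for all $j\in a_{00}(\bar x)$; - NDC3: the restricted Hessian $D^2L(\bar x)\restriction_{\mathcal{T}_{\bar x}}$ is nonsingular. **C-index** of a nondegenerate C-stationary point: $CI=QI+BI$, where $QI$ is the number of negative eigenvalues of $D^2L(\bar x)\restriction_{\mathcal{T}_{\bar x}}$ and $BI$ is the number of $j\in a_{00}(\bar x)$ with $\bar\varrho_{1,j},\bar\varrho_{2,j}<0$. **Smoothing** $\mathcal{S}^=_t$, $t>0$: $\min_x f(x)$ s.t. $x\in M^{\mathcal{S}^=}_t=\{x\in\mathbb{R}^n\mid F_{1,j}(x)F_{2,j}(x)=t,\ F_{1,j}(x)\ge0,\ F_{2,j}(x)\ge0,\ j=1,\dots,\kappa\}$. Since $t>0$, the inequality constraints are never active at feasible points, so the standard nonlinear programming notions read as follows. A point $x\in M^{\mathcal{S}^=}_t$ is a **Karush-Kuhn-Tucker point** if there are multipliers $\eta_j\in\mathbb{R}$ (of arbitrary sign), $j=1,\dots,\kappa$, with $$Df(x)=-\sum_{j=1}^\kappa\eta_j\big(F_{2,j}(x)DF_{1,j}(x)+F_{1,j}(x)DF_{2,j}(x)\big).$$ It is **nondegenerate** if the vectors $F_{2,j}(x)DF_{1,j}(x)+F_{1,j}(x)DF_{2,j}(x)$, $j=1,\dots,\kappa$, are linearly independent (LICQ) and the Hessian at $x$ of $L^{\mathcal{S}^=}(\cdot)=f(\cdot)-\sum_{j=1}^\kappa\eta_j\,(t-F_{1,j}(\cdot)F_{2,j}(\cdot))$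 (multipliers fixed), restricted to the tangent space $\{\xi\in\mathbb{R}^n\mid(F_{2,j}(x)DF_{1,j}(x)+F_{1,j}(x)DF_{2,j}(x))\xi=0,\ j=1,\dots,\kappa\}$, is nonsingular. (Strict complementarity of active inequality multipliers is vacuous here.) Its **quadratic index** is the number of negative eigenvalues of this restricted Hessian. *)

theory Defs
  imports "HOL-Analysis.Analysis"
begin

text \<open>The differential of a scalar function is represented by the vector of its partial derivatives,
  so that the number \<open>Df(x) \<xi>\<close> is \<open>grad f x \<bullet> \<xi>\<close>.\<close>

definition grad :: "(real^'n \<Rightarrow> real) \<Rightarrow> real^'n \<Rightarrow> real^'n" where
  "grad f x = (\<chi> i. frechet_derivative f (at x) (axis i 1))"

definition hessian :: "(real^'n \<Rightarrow> real) \<Rightarrow> real^'n \<Rightarrow> real^'n^'n" where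
  "hessian f x = jacobian (grad f) (at x)"

definition C2 :: "(real^'n \<Rightarrow> real) \<Rightarrow> bool" where
  "C2 f \<longleftrightarrow> (\<forall>x. f differentiable at x) \<and> (\<forall>x. grad f differentiable at x)
      \<and> continuous_on UNIV (hessian f)"

definition C2_vec :: "(real^'n \<Rightarrow> real^'k) \<Rightarrow> bool" where
  "C2_vec F \<longleftrightarrow> (\<forall>j. C2 (\<lambda>x. F x $ j))"

text \<open>Independence of an indexed family: a repeated vector makes the family dependent.\<close>

definition independent_family :: "('i \<Rightarrow> 'a::real_vector) \<Rightarrow> 'i set \<Rightarrow> bool" where
  "independent_family v I \<longleftrightarrow> inj_on v I \<and> independent (v ` I)"

text \<open>The restriction of a symmetric matrix (as a quadratic form) to a linear subspace \<open>T\<close>,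
  viewed as an operator on \<open>T\<close>: apply the matrix, then project orthogonally onto \<open>T\<close>
  (for a subspace, the closest point is the orthogonal projection). In an orthonormal basis of \<open>T\<close>,
  collected as the columns of \<open>V\<close>, this operator has the matrix \<open>V\<^sup>T A V\<close>.\<close>

definition restrict_matrix :: "real^'n^'n \<Rightarrow> (real^'n) set \<Rightarrow> real^'n \<Rightarrow> real^'n" where
  "restrict_matrix A T \<xi> = closest_point T (A *v \<xi>)"

lemma restrict_matrix_eq_iff:
  assumes T: "subspace T"
  shows "restrict_matrix A T \<xi> = \<zeta> \<longleftrightarrow> \<zeta> \<in> T \<and> (\<forall>\<eta>\<in>T. \<eta> \<bullet> \<zeta> = \<eta> \<bullet> (A *v \<xi>))"
proof -
  define a where "a = A *v \<xi>"
  have cl: "closed T" and cv: "convex T" and ne: "T \<noteq> {}"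
    using T by (auto simp: closed_subspace subspace_imp_convex dest: subspace_0)
  define p where "p = closest_point T a"
  have p: "p \<in> T"
    unfolding p_def using cl ne by (rule closest_point_in_set)
  have le: "(a - p) \<bullet> (y - p) \<le> 0" if "y \<in> T" for y
    unfolding p_def using closest_point_dot[OF cv cl that] .
  have ort: "\<eta> \<bullet> p = \<eta> \<bullet> a" if "\<eta> \<in> T" for \<eta>
    using le[of "p + \<eta>"] le[of "p - \<eta>"] p that T
    by (simp add: subspace_add subspace_diff inner_diff_left inner_diff_right inner_commute)
  have uniq: "\<zeta> = p" if z: "\<zeta> \<in> T" and e: "\<forall>\<eta>\<in>T. \<eta> \<bullet> \<zeta> = \<eta> \<bullet> a" for \<zeta>
  proof -
    have "p - \<zeta> \<in> T" using T p z by (simp add: subspace_diff)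
    then have "(p - \<zeta>) \<bullet> (p - \<zeta>) = 0"
      using e ort[of "p - \<zeta>"] by (simp add: inner_diff_right)
    then show ?thesis by simp
  qed
  show ?thesis
    using p ort uniq unfolding restrict_matrix_def a_def[symmetric] p_def[symmetric] by blast
qed

definition restricted_nonsingular :: "real^'n^'n \<Rightarrow> (real^'n) set \<Rightarrow> bool" where
  "restricted_nonsingular A T \<longleftrightarrow> bij_betw (restrict_matrix A T) T T"

definition restricted_eigenspace :: "real^'n^'n \<Rightarrow> (real^'n) set \<Rightarrow> real \<Rightarrow> (real^'n) set" where
  "restricted_eigenspace A T \<mu> = {\<xi> \<in> T. restrict_matrix A T \<xi> = \<mu> *\<^sub>R \<xi>}"

definition restricted_eigenvalues :: "real^'n^'n \<Rightarrow> (real^'n) set \<Rightarrow> real set" where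
  "restricted_eigenvalues A T = {\<mu>. \<exists>\<xi>. \<xi> \<noteq> 0 \<and> \<xi> \<in> restricted_eigenspace A T \<mu>}"

text \<open>Eigenvalues are counted with multiplicity. Hessians of \<open>C\<^sup>2\<close> functions are symmetric, so
  geometric and algebraic multiplicities agree, and there are only finitely many eigenvalues.\<close>

definition num_negative_eigenvalues :: "real^'n^'n \<Rightarrow> (real^'n) set \<Rightarrow> nat" where
  "num_negative_eigenvalues A T =
     (\<Sum>\<mu> | \<mu> \<in> restricted_eigenvalues A T \<and> \<mu> < 0. dim (restricted_eigenspace A T \<mu>))"

definition mpcc_feasible :: "(real^'n \<Rightarrow> real^'k) \<Rightarrow> (real^'n \<Rightarrow> real^'k) \<Rightarrow> (real^'n) set" where
  "mpcc_feasible F1 F2 = {x. \<forall>j. F1 x $ j * F2 x $ j = 0 \<and> F1 x $ j \<ge> 0 \<and> F2 x $ j \<ge> 0}"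

definition a01 :: "(real^'n \<Rightarrow> real^'k) \<Rightarrow> (real^'n \<Rightarrow> real^'k) \<Rightarrow> real^'n \<Rightarrow> 'k set" where
  "a01 F1 F2 x = {j. F1 x $ j = 0 \<and> F2 x $ j > 0}"

definition a10 :: "(real^'n \<Rightarrow> real^'k) \<Rightarrow> (real^'n \<Rightarrow> real^'k) \<Rightarrow> real^'n \<Rightarrow> 'k set" where
  "a10 F1 F2 x = {j. F1 x $ j > 0 \<and> F2 x $ j = 0}"

definition a00 :: "(real^'n \<Rightarrow> real^'k) \<Rightarrow> (real^'n \<Rightarrow> real^'k) \<Rightarrow> real^'n \<Rightarrow> 'k set" where
  "a00 F1 F2 x = {j. F1 x $ j = 0 \<and> F2 x $ j = 0}"

text \<open>The multipliers \<open>\<sigma>\<^sub>1\<close>, \<open>\<sigma>\<^sub>2\<close>, \<open>\<rho>\<^sub>1\<close>, \<open>\<rho>\<^sub>2\<close> are total functions of the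
  constraint index; only their values on \<open>a01\<close>, \<open>a10\<close>, \<open>a00\<close>, \<open>a00\<close>, respectively, are used.\<close>

definition C_stationary ::
  "(real^'n \<Rightarrow> real) \<Rightarrow> (real^'n \<Rightarrow> real^'k) \<Rightarrow> (real^'n \<Rightarrow> real^'k) \<Rightarrow> real^'n \<Rightarrow>
   ('k \<Rightarrow> real) \<Rightarrow> ('k \<Rightarrow> real) \<Rightarrow> ('k \<Rightarrow> real) \<Rightarrow> ('k \<Rightarrow> real) \<Rightarrow> bool" where
  "C_stationary f F1 F2 xb \<sigma>1 \<sigma>2 \<rho>1 \<rho>2 \<longleftrightarrow>
     xb \<in> mpcc_feasible F1 F2 \<and>
     grad f xb =
       (\<Sum>j\<in>a01 F1 F2 xb. \<sigma>1 j *\<^sub>R grad (\<lambda>x. F1 x $ j) xb)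
     + (\<Sum>j\<in>a10 F1 F2 xb. \<sigma>2 j *\<^sub>R grad (\<lambda>x. F2 x $ j) xb)
     + (\<Sum>j\<in>a00 F1 F2 xb. \<rho>1 j *\<^sub>R grad (\<lambda>x. F1 x $ j) xb + \<rho>2 j *\<^sub>R grad (\<lambda>x. F2 x $ j) xb) \<and>
     (\<forall>j\<in>a00 F1 F2 xb. \<rho>1 j * \<rho>2 j \<ge> 0)"

definition mpcc_lagrangian ::
  "(real^'n \<Rightarrow> real) \<Rightarrow> (real^'n \<Rightarrow> real^'k) \<Rightarrow> (real^'n \<Rightarrow> real^'k) \<Rightarrow> real^'n \<Rightarrow>
   ('k \<Rightarrow> real) \<Rightarrow> ('k \<Rightarrow> real) \<Rightarrow> ('k \<Rightarrow> real) \<Rightarrow> ('k \<Rightarrow> real) \<Rightarrow> real^'n \<Rightarrow> real" where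
  "mpcc_lagrangian f F1 F2 xb \<sigma>1 \<sigma>2 \<rho>1 \<rho>2 x =
     f x - (\<Sum>j\<in>a01 F1 F2 xb. \<sigma>1 j * F1 x $ j)
         - (\<Sum>j\<in>a10 F1 F2 xb. \<sigma>2 j * F2 x $ j)
         - (\<Sum>j\<in>a00 F1 F2 xb. \<rho>1 j * F1 x $ j + \<rho>2 j * F2 x $ j)"

definition mpcc_tangent :: "(real^'n \<Rightarrow> real^'k) \<Rightarrow> (real^'n \<Rightarrow> real^'k) \<Rightarrow> real^'n \<Rightarrow> (real^'n) set" where
  "mpcc_tangent F1 F2 xb =
     {\<xi>. (\<forall>j \<in> a01 F1 F2 xb \<union> a00 F1 F2 xb. grad (\<lambda>x. F1 x $ j) xb \<bullet> \<xi> = 0)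
       \<and> (\<forall>j \<in> a10 F1 F2 xb \<union> a00 F1 F2 xb. grad (\<lambda>x. F2 x $ j) xb \<bullet> \<xi> = 0)}"

definition mpcc_licq :: "(real^'n \<Rightarrow> real^'k) \<Rightarrow> (real^'n \<Rightarrow> real^'k) \<Rightarrow> real^'n \<Rightarrow> bool" where
  "mpcc_licq F1 F2 xb \<longleftrightarrow>
     independent_family
       (case_sum (\<lambda>j. grad (\<lambda>x. F1 x $ j) xb) (\<lambda>j. grad (\<lambda>x. F2 x $ j) xb))
       ((a01 F1 F2 xb \<union> a00 F1 F2 xb) <+> (a10 F1 F2 xb \<union> a00 F1 F2 xb))"

definition nondegenerate_C_stationary ::
  "(real^'n \<Rightarrow> real) \<Rightarrow> (real^'n \<Rightarrow> real^'k) \<Rightarrow> (real^'n \<Rightarrow> real^'k) \<Rightarrow> real^'n \<Rightarrow>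
   ('k \<Rightarrow> real) \<Rightarrow> ('k \<Rightarrow> real) \<Rightarrow> ('k \<Rightarrow> real) \<Rightarrow> ('k \<Rightarrow> real) \<Rightarrow> bool" where
  "nondegenerate_C_stationary f F1 F2 xb \<sigma>1 \<sigma>2 \<rho>1 \<rho>2 \<longleftrightarrow>
     C_stationary f F1 F2 xb \<sigma>1 \<sigma>2 \<rho>1 \<rho>2 \<and>
     mpcc_licq F1 F2 xb \<and>
     (\<forall>j\<in>a00 F1 F2 xb. \<rho>1 j * \<rho>2 j > 0) \<and>
     restricted_nonsingular (hessian (mpcc_lagrangian f F1 F2 xb \<sigma>1 \<sigma>2 \<rho>1 \<rho>2) xb)
       (mpcc_tangent F1 F2 xb)"

definition C_index ::
  "(real^'n \<Rightarrow> real) \<Rightarrow> (real^'n \<Rightarrow> real^'k) \<Rightarrow> (real^'n \<Rightarrow> real^'k) \<Rightarrow> real^'n \<Rightarrow>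
   ('k \<Rightarrow> real) \<Rightarrow> ('k \<Rightarrow> real) \<Rightarrow> ('k \<Rightarrow> real) \<Rightarrow> ('k \<Rightarrow> real) \<Rightarrow> nat" where
  "C_index f F1 F2 xb \<sigma>1 \<sigma>2 \<rho>1 \<rho>2 =
     num_negative_eigenvalues (hessian (mpcc_lagrangian f F1 F2 xb \<sigma>1 \<sigma>2 \<rho>1 \<rho>2) xb)
       (mpcc_tangent F1 F2 xb)
     + card {j \<in> a00 F1 F2 xb. \<rho>1 j < 0 \<and> \<rho>2 j < 0}"

definition smoothing_feasible ::
  "(real^'n \<Rightarrow> real^'k) \<Rightarrow> (real^'n \<Rightarrow> real^'k) \<Rightarrow> real \<Rightarrow> (real^'n) set" where
  "smoothing_feasible F1 F2 t = {x. \<forall>j. F1 x $ j * F2 x $ j = t \<and> F1 x $ j \<ge> 0 \<and> F2 x $ j \<ge> 0}"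

definition smoothing_grad ::
  "(real^'n \<Rightarrow> real^'k) \<Rightarrow> (real^'n \<Rightarrow> real^'k) \<Rightarrow> real^'n \<Rightarrow> 'k \<Rightarrow> real^'n" where
  "smoothing_grad F1 F2 x j =
     F2 x $ j *\<^sub>R grad (\<lambda>y. F1 y $ j) x + F1 x $ j *\<^sub>R grad (\<lambda>y. F2 y $ j) x"

definition smoothing_KKT_with ::
  "(real^'n \<Rightarrow> real) \<Rightarrow> (real^'n \<Rightarrow> real^'k) \<Rightarrow> (real^'n \<Rightarrow> real^'k) \<Rightarrow> real \<Rightarrow> real^'n \<Rightarrow>
   ('k \<Rightarrow> real) \<Rightarrow> bool" where
  "smoothing_KKT_with f F1 F2 t x \<eta> \<longleftrightarrow>
     x \<in> smoothing_feasible F1 F2 t \<and>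
     grad f x = - (\<Sum>j\<in>UNIV. \<eta> j *\<^sub>R smoothing_grad F1 F2 x j)"

definition smoothing_KKT ::
  "(real^'n \<Rightarrow> real) \<Rightarrow> (real^'n \<Rightarrow> real^'k) \<Rightarrow> (real^'n \<Rightarrow> real^'k) \<Rightarrow> real \<Rightarrow> real^'n \<Rightarrow> bool" where
  "smoothing_KKT f F1 F2 t x \<longleftrightarrow> (\<exists>\<eta>. smoothing_KKT_with f F1 F2 t x \<eta>)"

definition smoothing_lagrangian ::
  "(real^'n \<Rightarrow> real) \<Rightarrow> (real^'n \<Rightarrow> real^'k) \<Rightarrow> (real^'n \<Rightarrow> real^'k) \<Rightarrow> real \<Rightarrow>
   ('k \<Rightarrow> real) \<Rightarrow> real^'n \<Rightarrow> real" where
  "smoothing_lagrangian f F1 F2 t \<eta> x = f x - (\<Sum>j\<in>UNIV. \<eta> j * (t - F1 x $ j * F2 x $ j))"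

definition smoothing_tangent ::
  "(real^'n \<Rightarrow> real^'k) \<Rightarrow> (real^'n \<Rightarrow> real^'k) \<Rightarrow> real^'n \<Rightarrow> (real^'n) set" where
  "smoothing_tangent F1 F2 x = {\<xi>. \<forall>j. smoothing_grad F1 F2 x j \<bullet> \<xi> = 0}"

definition nondegenerate_smoothing_KKT_with ::
  "(real^'n \<Rightarrow> real) \<Rightarrow> (real^'n \<Rightarrow> real^'k) \<Rightarrow> (real^'n \<Rightarrow> real^'k) \<Rightarrow> real \<Rightarrow> real^'n \<Rightarrow>
   ('k \<Rightarrow> real) \<Rightarrow> bool" where
  "nondegenerate_smoothing_KKT_with f F1 F2 t x \<eta> \<longleftrightarrow>
     smoothing_KKT_with f F1 F2 t x \<eta> \<and>
     independent_family (smoothing_grad F1 F2 x) UNIV \<and>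
     restricted_nonsingular (hessian (smoothing_lagrangian f F1 F2 t \<eta>) x)
       (smoothing_tangent F1 F2 x)"

definition smoothing_quadratic_index ::
  "(real^'n \<Rightarrow> real) \<Rightarrow> (real^'n \<Rightarrow> real^'k) \<Rightarrow> (real^'n \<Rightarrow> real^'k) \<Rightarrow> real \<Rightarrow> real^'n \<Rightarrow>
   ('k \<Rightarrow> real) \<Rightarrow> nat" where
  "smoothing_quadratic_index f F1 F2 t x \<eta> =
     num_negative_eigenvalues (hessian (smoothing_lagrangian f F1 F2 t \<eta>) x)
       (smoothing_tangent F1 F2 x)"

end

theory Submission
  imports Defs
begin

text \<open>As \<open>t\<close> tends to \<open>0\<close> the Karush-Kuhn-Tucker system of the smoothed problem degenerates at the
  biactive indices \<open>j \<in> a00\<close>: the gradient of \<open>F1 j * F2 j\<close> vanishes at the limit point and the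
  multiplier \<open>\<eta> j\<close> blows up. What stays bounded are the products of \<open>- \<eta> j\<close> with \<open>F2 j\<close> and
  \<open>F1 j\<close>, which tend to \<open>\<rho>1 j\<close> and \<open>\<rho>2 j\<close>. By NDC2 these two numbers have a common sign
  \<open>s = \<plusminus>1\<close>, so one may write the products as \<open>s * p\<^sup>2\<close> and \<open>s * q\<^sup>2\<close> with \<open>p, q > 0\<close>. With
  \<open>t = \<epsilon>\<^sup>2\<close>, the constraint together with these two relations is equivalent to
  \<open>p * F1 = \<epsilon> * q\<close>, \<open>q * F2 = \<epsilon> * p\<close>, and the resulting system in \<open>(x, p, q, \<epsilon>)\<close> is regular even
  at \<open>\<epsilon> = 0\<close>: there the derivative is injective by NDC1, NDC2 and NDC3. The inverse function
  theorem yields one solution near the base point for each small \<open>\<epsilon>\<close> (\<open>sys_branch\<close>). For \<open>\<epsilon> > 0\<close>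
  the solutions are the Karush-Kuhn-Tucker points (\<open>kkt_of_sys\<close>, \<open>sys_of_kkt\<close>), and a
  Karush-Kuhn-Tucker point close to \<open>xb\<close> has \<open>p\<close> and \<open>q\<close> close to their limits, because under LICQ
  the coefficients in the stationarity equation depend continuously on the point (\<open>kkt_near_base\<close>).
  This gives existence and uniqueness. The indices in \<open>a01\<close> and \<open>a10\<close> cause no trouble, since there
  \<open>F1 j * F2 j = t\<close> is a regular equality constraint.

  For the index, note that the tangent space of the smoothed problem has \<open>card a00\<close> more dimensions
  than that of the MPCC. In the additional direction belonging to \<open>j\<close>, where \<open>F1 j\<close> is traded for
  \<open>F2 j\<close>, the Hessian has a term of order \<open>1/\<epsilon>\<close>. Writing the derivative of \<open>F1 j\<close> along a tangent
  vector as \<open>\<surd>\<epsilon> * q\<^sup>2 * \<phi> j\<close> introduces a rescaled coordinate \<open>\<phi> j\<close> for this direction. It embeds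
  the tangent space into \<open>\<real>\<^sup>n \<times> \<real>\<^sup>\<kappa>\<close> and turns the restricted Hessian into a form that is
  continuous up to \<open>\<epsilon> = 0\<close> (\<open>hessian_eq_lifted_form\<close>). In the limit this form lives on the product of the MPCC tangent space
  and \<open>\<real>\<close> to the power \<open>a00\<close>, and it is the sum of the Hessian of the MPCC Lagrangian and the squares
  \<open>2 * s * (p * q)\<^sup>3 * (\<phi> j)\<^sup>2\<close>. It has exactly \<open>QI + BI\<close> negative directions.
  By compactness, a small perturbation cannot raise the maximal dimension of a subspace on
  which a form is nonpositive beyond the limit value
  (\<open>nonpositive_subspace_dim_semicontinuous\<close>). Applied to the form and to its negative, this bounds
  both the nonpositive and the nonnegative part, and since the two bounds add up to the dimension of the
  tangent space, the restricted Hessian is nonsingular with index \<open>QI + BI\<close>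
  (\<open>index_near_base\<close>).\<close>

section \<open>Symmetric forms on a subspace\<close>

text \<open>The first-order condition at a maximum: a linear term that is dominated by a quadratic one
  vanishes.\<close>
lemma zero_if_linear_le_quadratic:
  fixes a c :: real
  assumes "\<And>s. s * a \<le> s\<^sup>2 * c"
  shows "a = 0"
proof (rule ccontr)
  assume "a \<noteq> 0"
  define d where "d = \<bar>c\<bar> + 1"
  have d: "d > 0" "c < d" by (auto simp: d_def)
  have "a / d * a \<le> (a / d)\<^sup>2 * c" using assms .
  then have "a\<^sup>2 * d \<le> a\<^sup>2 * c"
    using d by (simp add: power2_eq_square field_simps)
  then show False using d \<open>a \<noteq> 0\<close> by simp
qed

text \<open>A maximiser of the quadratic form on the unit sphere of \<open>T\<close> is an eigenvector of the form
  restricted to \<open>T\<close>.\<close>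
lemma symmetric_form_attains_eigenvector:
  fixes A :: "real^'n^'n"
  assumes sym: "\<And>x y. x \<bullet> (A *v y) = y \<bullet> (A *v x)"
    and T: "subspace T" and ne: "T \<noteq> {0}"
  obtains b m where "b \<in> T" "b \<noteq> 0" "\<And>y. y \<in> T \<Longrightarrow> y \<bullet> (A *v b) = m * (y \<bullet> b)"
proof -
  define S where "S = T \<inter> sphere 0 1"
  have "compact S"
    unfolding S_def using T by (intro closed_Int_compact closed_subspace) auto
  obtain w where w: "w \<in> T" "w \<noteq> 0" using ne subspace_0[OF T] by blast
  then have "w /\<^sub>R norm w \<in> S" using T by (auto simp: S_def subspace_scale)
  then have "S \<noteq> {}" by auto
  moreover have "continuous_on S (\<lambda>x. x \<bullet> (A *v x))"
    by (intro continuous_intros linear_continuous_on_compose matrix_vector_mul_linear)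
  ultimately obtain b where b: "b \<in> S" and max: "\<And>y. y \<in> S \<Longrightarrow> y \<bullet> (A *v y) \<le> b \<bullet> (A *v b)"
    using continuous_attains_sup[OF \<open>compact S\<close>] by blast
  define m where "m = b \<bullet> (A *v b)"
  have bb: "b \<in> T" "b \<bullet> b = 1" using b by (auto simp: S_def norm_eq_1)
  have le: "y \<bullet> (A *v y) \<le> m * (y \<bullet> y)" if "y \<in> T" for y
  proof (cases "y = 0")
    case False
    then have "y /\<^sub>R norm y \<in> S" using T that by (auto simp: S_def subspace_scale)
    from max[OF this] have "(y \<bullet> (A *v y)) / (norm y)\<^sup>2 \<le> m"
      by (simp add: m_def linear_scale[OF matrix_vector_mul_linear] power2_eq_square divide_inverse mult_ac)
    then show ?thesis using False by (simp add: divide_le_eq power2_norm_eq_inner)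
  qed simp
  have "y \<bullet> (A *v b) = m * (y \<bullet> b)" if y: "y \<in> T" for y
  proof -
    have "s * (2 * (y \<bullet> (A *v b) - m * (y \<bullet> b))) \<le> s\<^sup>2 * (m * (y \<bullet> y) - y \<bullet> (A *v y))" for s
    proof -
      have "b + s *\<^sub>R y \<in> T" using T y bb by (simp add: subspace_add subspace_scale)
      from le[OF this] show ?thesis
        using bb sym[of b y]
        by (simp add: linear_add[OF matrix_vector_mul_linear] linear_scale[OF matrix_vector_mul_linear]
            inner_add inner_commute m_def[symmetric] power2_eq_square algebra_simps)
    qed
    from zero_if_linear_le_quadratic[OF this] show ?thesis by simp
  qed
  moreover have "b \<noteq> 0" using bb by auto
  ultimately show thesis using that bb by blast
qed

text \<open>The eigenvalue equation is tested only against \<open>T\<close>: it says that \<open>b\<close> is an eigenvector of the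
  compression of \<open>A\<close> to \<open>T\<close>, not of \<open>A\<close>. The basis vectors need not have norm one.\<close>
definition eigenbasis :: "real^'n^'n \<Rightarrow> (real^'n) set \<Rightarrow> (real^'n) set \<Rightarrow> (real^'n \<Rightarrow> real) \<Rightarrow> bool" where
  "eigenbasis A T B \<mu> \<longleftrightarrow> pairwise orthogonal B \<and> 0 \<notin> B \<and> span B = T \<and>
     (\<forall>b\<in>B. \<forall>y\<in>T. y \<bullet> (A *v b) = \<mu> b * (y \<bullet> b))"

text \<open>The spectral theorem for the restriction of a symmetric matrix to a subspace. Split off one
  eigenvector \<open>b\<close> and continue on its orthogonal complement in \<open>T\<close>: eigenvectors of the complement
  are eigenvectors of \<open>T\<close>, because \<open>b\<close> pairs to \<open>0\<close> with their images by symmetry.\<close>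
lemma eigenbasis_exists:
  fixes A :: "real^'n^'n"
  assumes sym: "\<And>x y. x \<bullet> (A *v y) = y \<bullet> (A *v x)" and "subspace T"
  shows "\<exists>B \<mu>. eigenbasis A T B \<mu>"
  using assms(2)
proof (induction "dim T" arbitrary: T)
  case 0
  then have "T = {0}" using dim_eq_0 subspace_0 by fastforce
  then have "eigenbasis A T {} (\<lambda>_. 0)" by (simp add: eigenbasis_def pairwise_def)
  then show ?case by blast
next
  case (Suc d)
  then have "T \<noteq> {0}" by auto
  then obtain b m where b: "b \<in> T" "b \<noteq> 0" and eig: "\<And>y. y \<in> T \<Longrightarrow> y \<bullet> (A *v b) = m * (y \<bullet> b)"
    using symmetric_form_attains_eigenvector[OF sym Suc.prems] by blast
  define T' where "T' = {y \<in> T. \<forall>x\<in>span {b}. orthogonal x y}"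
  have subT': "T' \<subseteq> T" by (auto simp: T'_def)
  have orth: "b \<bullet> y = 0" if "y \<in> T'" for y
    using that by (auto simp: T'_def orthogonal_def span_base)
  have T'I: "y \<in> T'" if "y \<in> T" "b \<bullet> y = 0" for y
    using that by (auto simp: T'_def orthogonal_def span_singleton)
  have sT': "subspace T'"
    using Suc.prems orth subT'
    by (auto intro!: subspaceI T'I simp: inner_add_right subspace_0 subspace_add subspace_scale subset_iff)
  have "dim T' + dim (span {b}) = dim T"
    unfolding T'_def using b Suc.prems
    by (intro dim_subspace_orthogonal_to_vectors) (auto simp: span_minimal)
  then have "d = dim T'" using Suc.hyps(2) b by simp
  from Suc.hyps(1)[OF this sT'] obtain B \<mu> where B: "eigenbasis A T' B \<mu>" by blast
  then have BT': "B \<subseteq> T'" by (metis eigenbasis_def span_superset)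
  define \<nu> where "\<nu> = \<mu>(b := m)"
  have bB: "b \<notin> B" using BT' orth b by (metis inner_eq_zero_iff subsetD)
  have span: "span (insert b B) = T"
  proof
    show "span (insert b B) \<subseteq> T"
      using BT' subT' b Suc.prems by (intro span_minimal) auto
    show "T \<subseteq> span (insert b B)"
    proof
      fix y assume y: "y \<in> T"
      define k where "k = (b \<bullet> y) / (b \<bullet> b)"
      have "y - k *\<^sub>R b \<in> T'"
        using y b Suc.prems
        by (intro T'I) (auto simp: subspace_diff subspace_scale inner_diff_right k_def)
      then have "y - k *\<^sub>R b \<in> span B" using B by (simp add: eigenbasis_def)
      then show "y \<in> span (insert b B)" by (auto simp: span_insert)
    qed
  qed
  have "y \<bullet> (A *v x) = \<nu> x * (y \<bullet> x)" if "x \<in> insert b B" "y \<in> T" for x y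
  proof (cases "x = b")
    case True then show ?thesis using eig that by (simp add: \<nu>_def)
  next
    case False
    then have x: "x \<in> B" using that by simp
    then have xT: "x \<in> T'" using BT' by auto
    define k where "k = (b \<bullet> y) / (b \<bullet> b)"
    have "y - k *\<^sub>R b \<in> T'"
      using that b Suc.prems
      by (intro T'I) (auto simp: subspace_diff subspace_scale inner_diff_right k_def)
    then have "(y - k *\<^sub>R b) \<bullet> (A *v x) = \<mu> x * ((y - k *\<^sub>R b) \<bullet> x)"
      using B x by (simp add: eigenbasis_def)
    moreover have "b \<bullet> (A *v x) = 0"
      using sym[of b x] eig[of x] xT subT' orth[OF xT] by (auto simp: inner_commute)
    ultimately show ?thesis using False orth[OF xT] by (simp add: \<nu>_def inner_diff_left)
  qed
  then have "eigenbasis A T (insert b B) \<nu>"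
    using B BT' orth b span
    by (auto simp: eigenbasis_def pairwise_insert orthogonal_def inner_commute)
  then show ?case by blast
qed

context
  fixes A :: "real^'n^'n" and T B \<mu>
  assumes eb: "eigenbasis A T B \<mu>"
begin

lemma eigenbasis_simps:
  shows "independent B" "finite B" "subspace T" "B \<subseteq> T" "span B = T" "dim T = card B"
proof -
  show i: "independent B" using eb pairwise_orthogonal_independent by (auto simp: eigenbasis_def)
  then show "finite B" by (rule independent_imp_finite)
  show s: "span B = T" using eb by (simp add: eigenbasis_def)
  then show "subspace T" "B \<subseteq> T" using span_superset subspace_span by blast+
  show "dim T = card B" using i s dim_span_eq_card_independent by blast
qed

lemma eigenbasis_orthogonal: "b \<in> B \<Longrightarrow> b' \<in> B \<Longrightarrow> b \<noteq> b' \<Longrightarrow> b \<bullet> b' = 0"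
  using eb by (auto simp: eigenbasis_def pairwise_def orthogonal_def)

lemma eigenbasis_coefficients: "x \<in> span C \<Longrightarrow> C \<subseteq> B \<Longrightarrow> \<exists>u. x = (\<Sum>b\<in>C. u b *\<^sub>R b)"
  using span_finite[of C] finite_subset[OF _ eigenbasis_simps(2)] by auto

lemma inner_sum_eigenbasis: "C \<subseteq> B \<Longrightarrow> b \<in> C \<Longrightarrow> b \<bullet> (\<Sum>b\<in>C. u b *\<^sub>R b) = u b * (b \<bullet> b)"
proof -
  assume C: "C \<subseteq> B" "b \<in> C"
  then have "finite C" using eigenbasis_simps(2) finite_subset by blast
  have "b \<bullet> (\<Sum>b\<in>C. u b *\<^sub>R b) = (\<Sum>c\<in>C. u c * (b \<bullet> c))"
    by (simp add: inner_sum_right)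
  also have "\<dots> = (\<Sum>c\<in>C. if c = b then u b * (b \<bullet> b) else 0)"
    using C by (intro sum.cong) (auto simp: eigenbasis_orthogonal subset_iff)
  finally show ?thesis using C \<open>finite C\<close> by simp
qed

lemma eigenbasis_form:
  assumes "C \<subseteq> B" and x: "x = (\<Sum>b\<in>C. u b *\<^sub>R b)"
  shows "x \<bullet> (A *v x) = (\<Sum>b\<in>C. \<mu> b * (u b)\<^sup>2 * (b \<bullet> b))"
proof -
  have C: "finite C" "C \<subseteq> T" using assms eigenbasis_simps finite_subset by blast+
  then have xT: "x \<in> T" unfolding x using eigenbasis_simps(3)
    by (intro subspace_sum subspace_scale) auto
  have "x \<bullet> (A *v x) = (\<Sum>b\<in>C. u b * (x \<bullet> (A *v b)))"
    by (subst (2) x) (simp add: linear_sum[OF matrix_vector_mul_linear]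
        linear_scale[OF matrix_vector_mul_linear] inner_sum_right)
  also have "\<dots> = (\<Sum>b\<in>C. \<mu> b * (u b)\<^sup>2 * (b \<bullet> b))"
  proof (rule sum.cong)
    fix b assume b: "b \<in> C"
    have "x \<bullet> (A *v b) = \<mu> b * (x \<bullet> b)"
      using b assms(1) eb xT by (auto simp: eigenbasis_def)
    moreover have "b \<bullet> x = u b * (b \<bullet> b)"
      unfolding x using inner_sum_eigenbasis[OF assms(1) b] .
    ultimately show "u b * (x \<bullet> (A *v b)) = \<mu> b * (u b)\<^sup>2 * (b \<bullet> b)"
      by (simp add: inner_commute power2_eq_square)
  qed simp
  finally show ?thesis .
qed

lemma restrict_matrix_eq_scale_iff:
  "x \<in> T \<Longrightarrow> restrict_matrix A T x = m *\<^sub>R x \<longleftrightarrow> (\<forall>y\<in>T. y \<bullet> (A *v x) = m * (y \<bullet> x))"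
  using restrict_matrix_eq_iff[OF eigenbasis_simps(3), of A x "m *\<^sub>R x"]
    subspace_scale[OF eigenbasis_simps(3)] by auto

lemma restricted_eigenspace_eq: "restricted_eigenspace A T m = span {b \<in> B. \<mu> b = m}"
proof
  have sub: "subspace (restricted_eigenspace A T m)"
  proof -
    have e: "restricted_eigenspace A T m = {x\<in>T. \<forall>y\<in>T. y \<bullet> (A *v x) = m * (y \<bullet> x)}"
      using restrict_matrix_eq_scale_iff by (auto simp: restricted_eigenspace_def)
    show ?thesis using eigenbasis_simps(3) unfolding e
      by (auto simp: subspace_def linear_add[OF matrix_vector_mul_linear]
          linear_scale[OF matrix_vector_mul_linear] linear_0[OF matrix_vector_mul_linear]
          inner_add_right algebra_simps)
  qed
  have "{b \<in> B. \<mu> b = m} \<subseteq> restricted_eigenspace A T m"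
    using eigenbasis_simps(4) eb restrict_matrix_eq_scale_iff
    by (auto simp: restricted_eigenspace_def eigenbasis_def)
  then show "span {b \<in> B. \<mu> b = m} \<subseteq> restricted_eigenspace A T m"
    using sub span_minimal by blast
  show "restricted_eigenspace A T m \<subseteq> span {b \<in> B. \<mu> b = m}"
  proof
    fix x assume "x \<in> restricted_eigenspace A T m"
    then have xT: "x \<in> T" and e: "\<And>y. y \<in> T \<Longrightarrow> y \<bullet> (A *v x) = m * (y \<bullet> x)"
      using restrict_matrix_eq_scale_iff by (auto simp: restricted_eigenspace_def)
    obtain u where x: "x = (\<Sum>b\<in>B. u b *\<^sub>R b)"
      using eigenbasis_coefficients[of x B] xT eigenbasis_simps(5) by auto
    have "u b = 0" if b: "b \<in> B" "\<mu> b \<noteq> m" for b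
    proof -
      have bx: "b \<bullet> x = u b * (b \<bullet> b)" unfolding x using inner_sum_eigenbasis b by simp
      have "b \<bullet> (A *v x) = (\<Sum>c\<in>B. u c * (b \<bullet> (A *v c)))"
        by (subst x) (simp add: linear_sum[OF matrix_vector_mul_linear]
            linear_scale[OF matrix_vector_mul_linear] inner_sum_right)
      also have "\<dots> = (\<Sum>c\<in>B. if c = b then u b * \<mu> b * (b \<bullet> b) else 0)"
        using eb b eigenbasis_simps(4) eigenbasis_orthogonal
        by (intro sum.cong) (auto simp: eigenbasis_def subset_iff)
      also have "\<dots> = u b * \<mu> b * (b \<bullet> b)" using b eigenbasis_simps(2) by simp
      finally have "u b * \<mu> b * (b \<bullet> b) = m * (u b * (b \<bullet> b))"
        using e[of b] b eigenbasis_simps(4) bx by auto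
      moreover have "b \<bullet> b \<noteq> 0" using b eb by (auto simp: eigenbasis_def)
      ultimately show "u b = 0" using b by auto
    qed
    then have "x = (\<Sum>b\<in>{b \<in> B. \<mu> b = m}. u b *\<^sub>R b)"
      unfolding x using eigenbasis_simps(2) by (intro sum.mono_neutral_right) auto
    also have "\<dots> \<in> span {b \<in> B. \<mu> b = m}"
      by (intro span_sum span_scale span_base)
    finally show "x \<in> span {b \<in> B. \<mu> b = m}" .
  qed
qed

lemma dim_span_eigenbasis: "C \<subseteq> B \<Longrightarrow> dim (span C) = card C"
  using eigenbasis_simps(1) independent_mono dim_span_eq_card_independent by blast

text \<open>Each eigenspace is spanned by the basis vectors of its eigenvalue, so counting eigenvalues with
  multiplicity is counting basis vectors.\<close>
lemma num_negative_eigenvalues_eq: "num_negative_eigenvalues A T = card {b \<in> B. \<mu> b < 0}"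
proof -
  have ev: "restricted_eigenvalues A T = \<mu> ` B"
  proof -
    have "(\<exists>x. x \<noteq> 0 \<and> x \<in> span {b \<in> B. \<mu> b = m}) \<longleftrightarrow> m \<in> \<mu> ` B" for m
    proof
      assume "\<exists>x. x \<noteq> 0 \<and> x \<in> span {b \<in> B. \<mu> b = m}"
      then have "{b \<in> B. \<mu> b = m} \<noteq> {}" by (metis empty_iff insertE span_empty)
      then show "m \<in> \<mu> ` B" by auto
    next
      assume "m \<in> \<mu> ` B"
      then obtain b where "b \<in> B" "\<mu> b = m" by auto
      then have "b \<noteq> 0" "b \<in> span {b \<in> B. \<mu> b = m}"
        using eb by (auto simp: eigenbasis_def intro: span_base)
      then show "\<exists>x. x \<noteq> 0 \<and> x \<in> span {b \<in> B. \<mu> b = m}" by blast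
    qed
    then show ?thesis by (auto simp: restricted_eigenvalues_def restricted_eigenspace_eq)
  qed
  have "num_negative_eigenvalues A T = (\<Sum>m\<in>{m \<in> \<mu> ` B. m < 0}. card {b \<in> B. \<mu> b = m})"
    unfolding num_negative_eigenvalues_def ev restricted_eigenspace_eq
    by (intro sum.cong dim_span_eigenbasis) auto
  also have "\<dots> = (\<Sum>m\<in>\<mu> ` {b \<in> B. \<mu> b < 0}. card {b \<in> {b \<in> B. \<mu> b < 0}. \<mu> b = m})"
    by (intro sum.cong arg_cong[where f=card]) auto
  also have "\<dots> = card {b \<in> B. \<mu> b < 0}"
    using eigenbasis_simps(2) sum.image_gen[of "{b \<in> B. \<mu> b < 0}" "\<lambda>_. 1::nat" \<mu>] by simp
  finally show ?thesis .
qed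

lemma restricted_nonsingular_iff: "restricted_nonsingular A T \<longleftrightarrow> (\<forall>b\<in>B. \<mu> b \<noteq> 0)"
proof -
  define R where "R = restrict_matrix A T"
  have R: "R x \<in> T" "\<And>y. y \<in> T \<Longrightarrow> y \<bullet> R x = y \<bullet> (A *v x)" for x
    using restrict_matrix_eq_iff[OF eigenbasis_simps(3), of A x "R x"] unfolding R_def by blast+
  have Req: "R x = z" if "z \<in> T" "\<And>y. y \<in> T \<Longrightarrow> y \<bullet> z = y \<bullet> (A *v x)" for x z
    using restrict_matrix_eq_iff[OF eigenbasis_simps(3), of A x z] that unfolding R_def by blast
  have lin: "linear R"
  proof (rule linearI)
    show "R (x + y) = R x + R y" for x y
      using R eigenbasis_simps(3) by (intro Req) (auto simp: subspace_add inner_add_right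
          linear_add[OF matrix_vector_mul_linear])
    show "R (k *\<^sub>R x) = k *\<^sub>R R x" for k x
      using R eigenbasis_simps(3) by (intro Req) (auto simp: subspace_scale linear_scale[OF matrix_vector_mul_linear])
  qed
  have "bij_betw R T T \<longleftrightarrow> inj_on R T"
  proof
    assume i: "inj_on R T"
    have "span T = T" using eigenbasis_simps(3) span_eq_iff by blast
    then have "inj_on R (span T)" using i by argo
    then have "dim (R ` T) = dim T" by (rule dim_image_eq[OF lin])
    moreover have "R ` T \<subseteq> T" using R(1) by blast
    moreover have "subspace (R ` T)" using linear_subspace_image[OF lin eigenbasis_simps(3)] .
    ultimately have "R ` T = T" using eigenbasis_simps(3) by (intro subspace_dim_equal) simp_all
    then show "bij_betw R T T" using i by (simp only: bij_betw_def)
  qed (simp only: bij_betw_def)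
  also have "\<dots> \<longleftrightarrow> (\<forall>x\<in>T. R x = 0 \<longrightarrow> x = 0)"
    using linear_inj_on_iff_eq_0[OF lin eigenbasis_simps(3)] by blast
  also have "\<dots> \<longleftrightarrow> restricted_eigenspace A T 0 \<subseteq> {0}"
    unfolding restricted_eigenspace_def R_def scale_zero_left by blast
  also have "\<dots> \<longleftrightarrow> (\<forall>b\<in>B. \<mu> b \<noteq> 0)"
  proof -
    have "{b \<in> B. \<mu> b = 0} = {}" if "span {b \<in> B. \<mu> b = 0} \<subseteq> {0::real^'n}"
    proof -
      have "{b \<in> B. \<mu> b = 0} \<subseteq> {0}"
        using that span_superset[of "{b \<in> B. \<mu> b = 0}"] by (rule order_trans[rotated])
      then show ?thesis using eb by (auto simp: eigenbasis_def)
    qed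
    moreover have "span {b \<in> B. \<mu> b = 0} \<subseteq> {0}" if "{b \<in> B. \<mu> b = 0} = {}"
      by (simp only: that span_empty order_refl)
    ultimately show ?thesis unfolding restricted_eigenspace_eq by blast
  qed
  finally show ?thesis unfolding restricted_nonsingular_def R_def .
qed

lemma eigenbasis_form_signs:
  "x \<in> span {b \<in> B. \<mu> b < 0} \<Longrightarrow> x \<noteq> 0 \<Longrightarrow> x \<bullet> (A *v x) < 0"
  "x \<in> span {b \<in> B. \<mu> b > 0} \<Longrightarrow> x \<noteq> 0 \<Longrightarrow> x \<bullet> (A *v x) > 0"
  "x \<in> span {b \<in> B. \<mu> b \<le> 0} \<Longrightarrow> x \<bullet> (A *v x) \<le> 0"
  "x \<in> span {b \<in> B. \<mu> b \<ge> 0} \<Longrightarrow> x \<bullet> (A *v x) \<ge> 0"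
proof -
  have nz: "\<exists>b\<in>C. u b \<noteq> 0" if "(\<Sum>b\<in>C. u b *\<^sub>R b) \<noteq> 0" for C :: "(real^'n) set" and u
    using that by (metis (mono_tags, lifting) scale_zero_left sum.neutral)
  have bb: "b \<bullet> b > 0" if "b \<in> B" for b using that eb by (auto simp: eigenbasis_def)
  have fin: "finite {b \<in> B. P b}" for P using eigenbasis_simps(2) by simp
  show "x \<in> span {b \<in> B. \<mu> b < 0} \<Longrightarrow> x \<noteq> 0 \<Longrightarrow> x \<bullet> (A *v x) < 0"
  proof -
    assume "x \<in> span {b \<in> B. \<mu> b < 0}" "x \<noteq> 0"
    then obtain u where x: "x = (\<Sum>b\<in>{b \<in> B. \<mu> b < 0}. u b *\<^sub>R b)"
      using eigenbasis_coefficients[of x] by blast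
    from nz[of u] x \<open>x \<noteq> 0\<close> obtain c where c: "c \<in> {b \<in> B. \<mu> b < 0}" "u c \<noteq> 0" by blast
    have "(\<Sum>b\<in>{b \<in> B. \<mu> b < 0}. - (\<mu> b * (u b)\<^sup>2 * (b \<bullet> b))) > 0"
      using c bb fin by (intro sum_pos2[of _ c]) (auto simp: mult_neg_pos mult_nonpos_nonneg)
    then show ?thesis using eigenbasis_form[OF _ x] by (auto simp: sum_negf)
  qed
  show "x \<in> span {b \<in> B. \<mu> b > 0} \<Longrightarrow> x \<noteq> 0 \<Longrightarrow> x \<bullet> (A *v x) > 0"
  proof -
    assume "x \<in> span {b \<in> B. \<mu> b > 0}" "x \<noteq> 0"
    then obtain u where x: "x = (\<Sum>b\<in>{b \<in> B. \<mu> b > 0}. u b *\<^sub>R b)"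
      using eigenbasis_coefficients[of x] by blast
    from nz[of u] x \<open>x \<noteq> 0\<close> obtain c where c: "c \<in> {b \<in> B. \<mu> b > 0}" "u c \<noteq> 0" by blast
    have "(\<Sum>b\<in>{b \<in> B. \<mu> b > 0}. \<mu> b * (u b)\<^sup>2 * (b \<bullet> b)) > 0"
      using c bb fin by (intro sum_pos2[of _ c]) auto
    then show ?thesis using eigenbasis_form[OF _ x] by auto
  qed
  show "x \<in> span {b \<in> B. \<mu> b \<le> 0} \<Longrightarrow> x \<bullet> (A *v x) \<le> 0"
  proof -
    assume "x \<in> span {b \<in> B. \<mu> b \<le> 0}"
    then obtain u where x: "x = (\<Sum>b\<in>{b \<in> B. \<mu> b \<le> 0}. u b *\<^sub>R b)"
      using eigenbasis_coefficients[of x] by blast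
    have "x \<bullet> (A *v x) = (\<Sum>b\<in>{b \<in> B. \<mu> b \<le> 0}. \<mu> b * (u b)\<^sup>2 * (b \<bullet> b))"
      using x by (intro eigenbasis_form) auto
    also have "\<dots> \<le> 0" by (intro sum_nonpos) (auto simp: mult_nonpos_nonneg)
    finally show ?thesis .
  qed
  show "x \<in> span {b \<in> B. \<mu> b \<ge> 0} \<Longrightarrow> x \<bullet> (A *v x) \<ge> 0"
  proof -
    assume "x \<in> span {b \<in> B. \<mu> b \<ge> 0}"
    then obtain u where x: "x = (\<Sum>b\<in>{b \<in> B. \<mu> b \<ge> 0}. u b *\<^sub>R b)"
      using eigenbasis_coefficients[of x] by blast
    have "x \<bullet> (A *v x) = (\<Sum>b\<in>{b \<in> B. \<mu> b \<ge> 0}. \<mu> b * (u b)\<^sup>2 * (b \<bullet> b))"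
      using x by (intro eigenbasis_form) auto
    also have "\<dots> \<ge> 0" by (intro sum_nonneg) auto
    finally show ?thesis .
  qed
qed

end

text \<open>The easy half of Sylvester's law, in the form in which the index of the limit problem is
  used: definite subspaces, unlike eigenspaces, are stable under perturbation.\<close>
lemma definite_subspaces_of_nonsingular:
  fixes A :: "real^'n^'n"
  assumes sym: "\<And>x y. x \<bullet> (A *v y) = y \<bullet> (A *v x)" and T: "subspace T"
    and ns: "restricted_nonsingular A T"
  shows "\<exists>N P. subspace N \<and> subspace P \<and> N \<subseteq> T \<and> P \<subseteq> T \<and>
    dim N = num_negative_eigenvalues A T \<and> dim N + dim P = dim T \<and>
    (\<forall>x\<in>N - {0}. x \<bullet> (A *v x) < 0) \<and> (\<forall>x\<in>P - {0}. x \<bullet> (A *v x) > 0)"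
proof -
  obtain B \<mu> where eb: "eigenbasis A T B \<mu>" using eigenbasis_exists[OF sym T] by blast
  define N P where "N = {b \<in> B. \<mu> b < 0}" and "P = {b \<in> B. \<mu> b > 0}"
  have "B = N \<union> P" using ns restricted_nonsingular_iff[OF eb] by (force simp: N_def P_def)
  moreover have "N \<inter> P = {}" by (auto simp: N_def P_def)
  moreover have "finite B" using eigenbasis_simps(2)[OF eb] .
  ultimately have "card N + card P = card B" by (metis card_Un_disjoint finite_Un)
  moreover have "dim (span N) = card N" "dim (span P) = card P"
    by (intro dim_span_eigenbasis[OF eb], simp add: N_def P_def)+
  moreover have "span N \<subseteq> T" "span P \<subseteq> T"
    using span_mono[of N B] span_mono[of P B] eigenbasis_simps(5)[OF eb]
    by (simp_all add: N_def P_def Collect_mono_iff subset_iff)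
  ultimately show ?thesis
    using eigenbasis_form_signs(1,2)[OF eb] eigenbasis_simps(6)[OF eb] num_negative_eigenvalues_eq[OF eb]
    by (intro exI[of _ "span N"] exI[of _ "span P"]) (auto simp: N_def P_def)
qed

text \<open>The converse half, in the form in which the index of the perturbed problem is computed. If \<open>z\<close>
  is the dimension of the kernel, the eigenvectors with eigenvalue \<open>\<le> 0\<close> and those with eigenvalue
  \<open>\<ge> 0\<close> number \<open>dim T + z\<close> together. The bounds therefore force \<open>z = 0\<close> and are attained.\<close>
lemma nonsingular_and_index_of_dim_bounds:
  fixes A :: "real^'n^'n"
  assumes sym: "\<And>x y. x \<bullet> (A *v y) = y \<bullet> (A *v x)" and T: "subspace T"
    and neg: "\<And>W. subspace W \<Longrightarrow> W \<subseteq> T \<Longrightarrow> (\<And>x. x \<in> W \<Longrightarrow> x \<bullet> (A *v x) \<le> 0) \<Longrightarrow> dim W \<le> c"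
    and pos: "\<And>W. subspace W \<Longrightarrow> W \<subseteq> T \<Longrightarrow> (\<And>x. x \<in> W \<Longrightarrow> x \<bullet> (A *v x) \<ge> 0) \<Longrightarrow> dim W \<le> d"
    and cd: "c + d \<le> dim T"
  shows "restricted_nonsingular A T \<and> num_negative_eigenvalues A T = c"
proof -
  obtain B \<mu> where eb: "eigenbasis A T B \<mu>" using eigenbasis_exists[OF sym T] by blast
  define N Z P where "N = {b \<in> B. \<mu> b < 0}" and "Z = {b \<in> B. \<mu> b = 0}" and "P = {b \<in> B. \<mu> b > 0}"
  have fin: "finite B" "finite N" "finite Z" "finite P"
    using eigenbasis_simps(2)[OF eb] by (auto simp: N_def Z_def P_def)
  have sub: "span C \<subseteq> T" if "C \<subseteq> B" for C
    using span_mono[OF that] eigenbasis_simps(5)[OF eb] by simp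
  have NZ: "{b \<in> B. \<mu> b \<le> 0} = N \<union> Z" and ZP: "{b \<in> B. \<mu> b \<ge> 0} = Z \<union> P" and all: "B = N \<union> Z \<union> P"
    by (auto simp: N_def Z_def P_def)
  have disj: "N \<inter> Z = {}" "Z \<inter> P = {}" "(N \<union> Z) \<inter> P = {}" by (auto simp: N_def Z_def P_def)
  have "dim (span {b \<in> B. \<mu> b \<le> 0}) \<le> c" "dim (span {b \<in> B. \<mu> b \<ge> 0}) \<le> d"
    using eigenbasis_form_signs(3,4)[OF eb] by (intro neg pos sub; auto)+
  moreover have "dim (span {b \<in> B. \<mu> b \<le> 0}) = card (N \<union> Z)" "dim (span {b \<in> B. \<mu> b \<ge> 0}) = card (Z \<union> P)"
    unfolding NZ ZP by (intro dim_span_eigenbasis[OF eb]; use all in blast)+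
  ultimately have "card N + card Z \<le> c" "card Z + card P \<le> d"
    using fin disj by (simp_all add: card_Un_disjoint)
  moreover have "card N + card Z + card P = dim T"
    using eigenbasis_simps(6)[OF eb] fin disj by (simp add: all card_Un_disjoint)
  ultimately have "card Z = 0" "card N = c" using cd by linarith+
  then show ?thesis
    using fin restricted_nonsingular_iff[OF eb] num_negative_eigenvalues_eq[OF eb]
    by (auto simp: Z_def N_def)
qed

text \<open>Index and nonsingularity see only the values of the form on \<open>T\<close>. This allows to replace one
  Lagrangian by another whose Hessian differs off the tangent space.\<close>
lemma restricted_form_cong:
  assumes T: "subspace T" and eq: "\<And>x y. x \<in> T \<Longrightarrow> y \<in> T \<Longrightarrow> y \<bullet> (A *v x) = y \<bullet> (B *v x)"
  shows "restricted_nonsingular A T = restricted_nonsingular B T"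
    and "num_negative_eigenvalues A T = num_negative_eigenvalues B T"
proof -
  have R: "restrict_matrix A T x = restrict_matrix B T x" if "x \<in> T" for x
  proof -
    have "restrict_matrix B T x \<in> T \<and> (\<forall>y\<in>T. y \<bullet> restrict_matrix B T x = y \<bullet> (B *v x))"
      using restrict_matrix_eq_iff[OF T, of B x "restrict_matrix B T x"] by blast
    then show ?thesis using restrict_matrix_eq_iff[OF T, of A x "restrict_matrix B T x"] eq[OF that] by simp
  qed
  show "restricted_nonsingular A T = restricted_nonsingular B T"
    unfolding restricted_nonsingular_def by (rule bij_betw_cong) (rule R)
  have "restricted_eigenspace A T m = restricted_eigenspace B T m" for m
    unfolding restricted_eigenspace_def using R by auto
  then show "num_negative_eigenvalues A T = num_negative_eigenvalues B T"
    by (simp add: num_negative_eigenvalues_def restricted_eigenvalues_def)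
qed

section \<open>Calculus of twice continuously differentiable functions\<close>

lemma inner_eq_sum_axis: "(x::real^'n) \<bullet> h = (\<Sum>i\<in>UNIV. x $ i * h $ i)"
  by (simp add: inner_vec_def)

lemma grad_eqI:
  assumes "(f has_derivative (\<lambda>h. g \<bullet> h)) (at x)"
  shows "grad f x = g"
proof -
  have "frechet_derivative f (at x) (axis i 1) = g $ i" for i
    using frechet_derivative_at[OF assms] by (metis cart_eq_inner_axis)
  then show ?thesis by (simp add: grad_def vec_eq_iff)
qed

lemma has_derivative_grad:
  assumes "f differentiable at x"
  shows "(f has_derivative (\<lambda>h. grad f x \<bullet> h)) (at x)"
proof -
  define D where "D = frechet_derivative f (at x)"
  have D: "(f has_derivative D) (at x)" using assms by (simp add: D_def frechet_derivative_works)
  then have lin: "linear D" by (rule has_derivative_linear)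
  have "D h = grad f x \<bullet> h" for h
  proof -
    have "D h = D (\<Sum>i\<in>UNIV. h $ i *\<^sub>R axis i 1)"
      using basis_expansion[of h] by (simp add: scalar_mult_eq_scaleR)
    also have "\<dots> = grad f x \<bullet> h"
      by (simp add: linear_sum[OF lin] linear_scale[OF lin] grad_def inner_eq_sum_axis D_def[symmetric] mult.commute)
    finally show ?thesis .
  qed
  then have "D = (\<lambda>h. grad f x \<bullet> h)" by blast
  then show ?thesis using D by simp
qed

lemma C2_has_derivative: "C2 f \<Longrightarrow> (f has_derivative (\<lambda>h. grad f x \<bullet> h)) (at x)"
  by (simp add: C2_def has_derivative_grad)

lemma C2_grad_has_derivative: "C2 f \<Longrightarrow> (grad f has_derivative (\<lambda>h. hessian f x *v h)) (at x)"
  unfolding C2_def hessian_def using jacobian_works by blast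

text \<open>How the class \<open>C2\<close> is entered: a candidate for the gradient and one for its derivative, both
  given as maps, suffice. The Hessian is only ever accessed through its action on vectors.\<close>
lemma C2_I:
  assumes g: "\<And>x. (f has_derivative (\<lambda>h. g x \<bullet> h)) (at x)"
    and D: "\<And>x. (g has_derivative D x) (at x)"
    and c: "\<And>h. continuous_on UNIV (\<lambda>x. D x h)"
  shows "C2 f" "grad f x = g x" "hessian f x *v h = D x h"
proof -
  have gr: "grad f = g" using g grad_eqI by blast
  then show "grad f x = g x" by simp
  have d: "grad f differentiable at x" for x using D gr by (auto simp: differentiable_def)
  have H: "hessian f x *v h = D x h" for x h
  proof -
    have "(grad f has_derivative (\<lambda>h. hessian f x *v h)) (at x)"
      using d[of x] jacobian_works unfolding hessian_def by blast
    then show ?thesis using D[of x] gr has_derivative_unique by metis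
  qed
  then show "hessian f x *v h = D x h" .
  have "hessian f x = (\<chi> i j. D x (axis j 1) $ i)" for x
    by (simp add: vec_eq_iff flip: H) (simp add: matrix_vector_mult_basis column_def)
  moreover have "continuous_on UNIV (\<lambda>x. (\<chi> i j. D x (axis j 1) $ i))"
    by (intro continuous_intros c)
  ultimately have "continuous_on UNIV (hessian f)" by (simp add: fun_eq_iff[symmetric] cong: continuous_on_cong)
  then show "C2 f" using g d by (auto simp: C2_def differentiable_def)
qed

lemma C2_continuous_on:
  assumes "C2 f" "continuous_on S u"
  shows "continuous_on S (\<lambda>z. f (u z))"
  using assms(2) by (rule continuous_on_compose2[of UNIV, rotated])
    (auto intro!: continuous_at_imp_continuous_on has_derivative_continuous[OF C2_has_derivative[OF assms(1)]])

lemma C2_continuous_on_grad [continuous_intros]: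
  assumes "C2 f" "continuous_on S u"
  shows "continuous_on S (\<lambda>z. grad f (u z))"
  using assms(2) by (rule continuous_on_compose2[of UNIV, rotated])
    (auto intro!: continuous_at_imp_continuous_on has_derivative_continuous[OF C2_grad_has_derivative[OF assms(1)]])

lemma C2_continuous_on_hessian [continuous_intros]:
  assumes "C2 f" "continuous_on S u" "continuous_on S v"
  shows "continuous_on S (\<lambda>z. hessian f (u z) *v v z)"
proof -
  have "continuous_on S (\<lambda>z. hessian f (u z))"
    using assms(2) by (rule continuous_on_compose2[of UNIV, rotated]) (use assms(1) in \<open>auto simp: C2_def\<close>)
  then show ?thesis unfolding matrix_vector_mult_def
    by (intro continuous_intros assms)
qed

text \<open>The second difference of \<open>f\<close> along \<open>u\<close> and \<open>v\<close> is symmetric in \<open>u\<close> and \<open>v\<close>. Two applications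
  of the mean value theorem express it by the Hessian at a nearby point, in either order.\<close>
lemma C2_hessian_symmetric:
  assumes f: "C2 f"
  shows "u \<bullet> (hessian f x *v v) = v \<bullet> (hessian f x *v u)"
proof -
  define \<Delta> where "\<Delta> u v s = f (x + s *\<^sub>R u + s *\<^sub>R v) - f (x + s *\<^sub>R u) - f (x + s *\<^sub>R v) + f x"
    for u v :: "real^'a" and s :: real
  have mv: "\<exists>a b. 0 < a \<and> a < s \<and> 0 < b \<and> b < s \<and>
      \<Delta> u v s = s\<^sup>2 * (u \<bullet> (hessian f (x + a *\<^sub>R u + b *\<^sub>R v) *v v))" if s: "s > 0" for u v s
  proof -
    have df: "((\<lambda>r. f (y + r *\<^sub>R w)) has_real_derivative (grad f (y + r *\<^sub>R w) \<bullet> w)) (at r)" for y w r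
      unfolding has_field_derivative_def
      by (rule has_derivative_eq_rhs, rule has_derivative_compose[OF _ C2_has_derivative[OF f]])
        (auto intro!: derivative_eq_intros)
    have dg: "((\<lambda>r. grad f (y + r *\<^sub>R w) \<bullet> u) has_real_derivative (u \<bullet> (hessian f (y + r *\<^sub>R w) *v w))) (at r)" for y w r
    proof -
      have "((\<lambda>r. grad f (y + r *\<^sub>R w)) has_derivative (\<lambda>h. hessian f (y + r *\<^sub>R w) *v (h *\<^sub>R w))) (at r)"
        by (rule has_derivative_compose[OF _ C2_grad_has_derivative[OF f]])
          (auto intro!: derivative_eq_intros)
      then show ?thesis unfolding has_field_derivative_def
        by (auto intro!: derivative_eq_intros simp: inner_commute linear_scale[OF matrix_vector_mul_linear])
    qed
    have "((\<lambda>r. f (x + s *\<^sub>R v + r *\<^sub>R u) - f (x + r *\<^sub>R u)) has_real_derivative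
        (grad f (x + s *\<^sub>R v + r *\<^sub>R u) \<bullet> u - grad f (x + r *\<^sub>R u) \<bullet> u)) (at r)" for r
      by (intro derivative_intros df)
    from MVT2[OF s this] obtain a where a: "0 < a" "a < s"
      and 1: "\<Delta> u v s = s * (grad f (x + s *\<^sub>R v + a *\<^sub>R u) \<bullet> u - grad f (x + a *\<^sub>R u) \<bullet> u)"
      by (auto simp: \<Delta>_def algebra_simps)
    from MVT2[OF s dg[of "x + a *\<^sub>R u" v]] obtain b where b: "0 < b" "b < s"
      and 2: "grad f (x + a *\<^sub>R u + s *\<^sub>R v) \<bullet> u - grad f (x + a *\<^sub>R u) \<bullet> u
        = s * (u \<bullet> (hessian f (x + a *\<^sub>R u + b *\<^sub>R v) *v v))"
      by auto
    have "\<Delta> u v s = s\<^sup>2 * (u \<bullet> (hessian f (x + a *\<^sub>R u + b *\<^sub>R v) *v v))"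
      using 1 2 by (simp add: power2_eq_square add_ac)
    then show ?thesis using a b by blast
  qed
  have close: "\<exists>d>0. \<forall>s. 0 < s \<and> s < d \<longrightarrow> \<bar>\<Delta> u v s / s\<^sup>2 - u \<bullet> (hessian f x *v v)\<bar> < e" if e: "e > 0" for u v e
  proof -
    define k where "k c = u \<bullet> (hessian f (x + fst c *\<^sub>R u + snd c *\<^sub>R v) *v v)" for c :: "real \<times> real"
    have "continuous_on UNIV k" unfolding k_def by (intro continuous_intros f)
    then have "isCont k 0" using continuous_on_eq_continuous_at[OF open_UNIV] by blast
    then obtain d where d: "d > 0" "\<And>c. dist c 0 < d \<Longrightarrow> dist (k c) (k 0) < e"
      using e unfolding continuous_at_eps_delta by blast
    have "\<bar>\<Delta> u v s / s\<^sup>2 - u \<bullet> (hessian f x *v v)\<bar> < e" if s: "0 < s" "s < d / 2" for s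
    proof -
      obtain a b where ab: "0 < a" "a < s" "0 < b" "b < s" and \<Delta>: "\<Delta> u v s = s\<^sup>2 * k (a, b)"
        using mv[OF s(1), of u v] by (auto simp: k_def)
      have "norm (a, b) \<le> norm a + norm b" by (rule norm_Pair_le)
      then have "dist (a, b) 0 < d" using ab s by simp
      from d(2)[OF this] show ?thesis using s \<Delta> by (simp add: dist_real_def k_def)
    qed
    then show ?thesis using d(1) by (intro exI[of _ "d / 2"]) auto
  qed
  show ?thesis
  proof (rule ccontr)
    assume ne: "\<not> ?thesis"
    define e where "e = \<bar>u \<bullet> (hessian f x *v v) - v \<bullet> (hessian f x *v u)\<bar> / 2"
    have e: "e > 0" using ne by (simp add: e_def)
    obtain d1 where d1: "d1 > 0" "\<And>s. 0 < s \<Longrightarrow> s < d1 \<Longrightarrow> \<bar>\<Delta> u v s / s\<^sup>2 - u \<bullet> (hessian f x *v v)\<bar> < e"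
      using close[OF e, of u v] by blast
    obtain d2 where d2: "d2 > 0" "\<And>s. 0 < s \<Longrightarrow> s < d2 \<Longrightarrow> \<bar>\<Delta> v u s / s\<^sup>2 - v \<bullet> (hessian f x *v u)\<bar> < e"
      using close[OF e, of v u] by blast
    define s where "s = min d1 d2 / 2"
    have s: "0 < s" "s < d1" "s < d2" using d1(1) d2(1) by (auto simp: s_def)
    have "\<Delta> u v s = \<Delta> v u s" by (simp add: \<Delta>_def add_ac)
    then have "\<bar>\<Delta> u v s / s\<^sup>2 - v \<bullet> (hessian f x *v u)\<bar> < e" using d2(2)[OF s(1,3)] by simp
    moreover have "\<not> (\<bar>r - q\<bar> < \<bar>p - q\<bar> / 2 \<and> \<bar>r - p\<bar> < \<bar>p - q\<bar> / 2)" for p q r :: real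
      using abs_triangle_ineq[of "p - r" "r - q"] by (simp add: abs_minus_commute)
    ultimately show False using d1(2)[OF s(1,2)] unfolding e_def by blast
  qed
qed

lemma C2_mult:
  assumes f: "C2 f" and g: "C2 g"
  shows "C2 (\<lambda>x. f x * g x)"
    and "grad (\<lambda>x. f x * g x) x = g x *\<^sub>R grad f x + f x *\<^sub>R grad g x"
    and "hessian (\<lambda>x. f x * g x) x *v h = g x *\<^sub>R (hessian f x *v h) + f x *\<^sub>R (hessian g x *v h)
      + (grad g x \<bullet> h) *\<^sub>R grad f x + (grad f x \<bullet> h) *\<^sub>R grad g x"
proof -
  note [derivative_intros] = C2_has_derivative[OF f] C2_has_derivative[OF g]
    C2_grad_has_derivative[OF f] C2_grad_has_derivative[OF g]
  have 1: "((\<lambda>x. f x * g x) has_derivative (\<lambda>h. (g x *\<^sub>R grad f x + f x *\<^sub>R grad g x) \<bullet> h)) (at x)" for x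
    by (auto intro!: derivative_eq_intros simp: inner_add_left)
  have 2: "((\<lambda>x. g x *\<^sub>R grad f x + f x *\<^sub>R grad g x) has_derivative (\<lambda>h. g x *\<^sub>R (hessian f x *v h) + f x *\<^sub>R (hessian g x *v h)
      + (grad g x \<bullet> h) *\<^sub>R grad f x + (grad f x \<bullet> h) *\<^sub>R grad g x)) (at x)" for x
    by (auto intro!: derivative_eq_intros simp: algebra_simps)
  note C2_I[OF 1 2]
  moreover have "continuous_on UNIV (\<lambda>x. g x *\<^sub>R (hessian f x *v h) + f x *\<^sub>R (hessian g x *v h)
      + (grad g x \<bullet> h) *\<^sub>R grad f x + (grad f x \<bullet> h) *\<^sub>R grad g x)" for h
    by (intro continuous_intros C2_continuous_on[OF f] C2_continuous_on[OF g] f g)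
  ultimately show "C2 (\<lambda>x. f x * g x)"
    and "grad (\<lambda>x. f x * g x) x = g x *\<^sub>R grad f x + f x *\<^sub>R grad g x"
    and "hessian (\<lambda>x. f x * g x) x *v h = g x *\<^sub>R (hessian f x *v h) + f x *\<^sub>R (hessian g x *v h)
      + (grad g x \<bullet> h) *\<^sub>R grad f x + (grad f x \<bullet> h) *\<^sub>R grad g x" by blast+
qed

lemma C2_affine_combination:
  assumes f: "C2 f" and G: "\<And>j. j \<in> I \<Longrightarrow> C2 (G j)"
  shows "C2 (\<lambda>x. k + f x - (\<Sum>j\<in>I. c j * G j x))"
    and "grad (\<lambda>x. k + f x - (\<Sum>j\<in>I. c j * G j x)) x = grad f x - (\<Sum>j\<in>I. c j *\<^sub>R grad (G j) x)"
    and "hessian (\<lambda>x. k + f x - (\<Sum>j\<in>I. c j * G j x)) x *v h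
      = hessian f x *v h - (\<Sum>j\<in>I. c j *\<^sub>R (hessian (G j) x *v h))"
proof -
  note [derivative_intros] = C2_has_derivative[OF f] C2_grad_has_derivative[OF f]
    C2_has_derivative[OF G] C2_grad_has_derivative[OF G]
  have 1: "((\<lambda>x. k + f x - (\<Sum>j\<in>I. c j * G j x)) has_derivative
      (\<lambda>h. (grad f x - (\<Sum>j\<in>I. c j *\<^sub>R grad (G j) x)) \<bullet> h)) (at x)" for x
    by (auto intro!: derivative_eq_intros simp: inner_diff_left inner_sum_left)
  have 2: "((\<lambda>x. grad f x - (\<Sum>j\<in>I. c j *\<^sub>R grad (G j) x)) has_derivative
      (\<lambda>h. hessian f x *v h - (\<Sum>j\<in>I. c j *\<^sub>R (hessian (G j) x *v h)))) (at x)" for x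
    by (auto intro!: derivative_eq_intros)
  have 3: "continuous_on UNIV (\<lambda>x. hessian f x *v h - (\<Sum>j\<in>I. c j *\<^sub>R (hessian (G j) x *v h)))" for h
    by (intro continuous_intros f G)
  show "C2 (\<lambda>x. k + f x - (\<Sum>j\<in>I. c j * G j x))"
    and "grad (\<lambda>x. k + f x - (\<Sum>j\<in>I. c j * G j x)) x = grad f x - (\<Sum>j\<in>I. c j *\<^sub>R grad (G j) x)"
    and "hessian (\<lambda>x. k + f x - (\<Sum>j\<in>I. c j * G j x)) x *v h
      = hessian f x *v h - (\<Sum>j\<in>I. c j *\<^sub>R (hessian (G j) x *v h))"
    using C2_I[OF 1 2 3] by blast+
qed

lemma C2_const: "C2 (\<lambda>x::real^'n. k)" and grad_const: "grad (\<lambda>x::real^'n. k) = (\<lambda>x. 0)"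
  and hessian_const: "hessian (\<lambda>x::real^'n. k) x *v h = 0"
proof -
  have 1: "((\<lambda>x. k) has_derivative (\<lambda>h. 0 \<bullet> h)) (at x)" for x :: "real^'n" by simp
  have 2: "((\<lambda>x. 0) has_derivative (\<lambda>h. 0)) (at x)" for x :: "real^'n" by simp
  have 3: "continuous_on UNIV (\<lambda>x::real^'n. 0 :: real^'n)" by simp
  show "C2 (\<lambda>x::real^'n. k)" "hessian (\<lambda>x::real^'n. k) x *v h = 0"
    using C2_I(1,3)[OF 1 2 3] by blast+
  show "grad (\<lambda>x::real^'n. k) = (\<lambda>x. 0)"
    using C2_I(2)[OF 1 2 3] by blast
qed

text \<open>Independence in terms of coefficients, which also excludes repeated vectors.\<close>
lemma independent_family_iff:
  assumes "finite I"
  shows "independent_family v I \<longleftrightarrow> (\<forall>c. (\<Sum>i\<in>I. c i *\<^sub>R v i) = 0 \<longrightarrow> (\<forall>i\<in>I. c i = 0))"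
proof
  assume "independent_family v I"
  then have inj: "inj_on v I" and ind: "independent (v ` I)" by (auto simp: independent_family_def)
  show "\<forall>c. (\<Sum>i\<in>I. c i *\<^sub>R v i) = 0 \<longrightarrow> (\<forall>i\<in>I. c i = 0)"
  proof (intro allI impI ballI)
    fix c i assume s: "(\<Sum>i\<in>I. c i *\<^sub>R v i) = 0" and i: "i \<in> I"
    have "(\<Sum>w\<in>v ` I. c (the_inv_into I v w) *\<^sub>R w) = 0"
      using s by (simp add: sum.reindex[OF inj] the_inv_into_f_f[OF inj] cong: sum.cong)
    then have "c (the_inv_into I v (v i)) = 0"
      using independentD[OF ind, of "v ` I" "\<lambda>w. c (the_inv_into I v w)" "v i"] assms i by simp
    then show "c i = 0" using i by (simp add: the_inv_into_f_f[OF inj])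
  qed
next
  assume *: "\<forall>c. (\<Sum>i\<in>I. c i *\<^sub>R v i) = 0 \<longrightarrow> (\<forall>i\<in>I. c i = 0)"
  have inj: "inj_on v I"
  proof (rule inj_onI, rule ccontr)
    fix a b assume ab: "a \<in> I" "b \<in> I" "v a = v b" "a \<noteq> b"
    define c where "c = (\<lambda>i. if i = a then 1 else if i = b then -1 else (0::real))"
    have "(\<Sum>i\<in>I. c i *\<^sub>R v i) = (\<Sum>i\<in>{a, b}. c i *\<^sub>R v i)"
      using ab assms by (intro sum.mono_neutral_right) (auto simp: c_def)
    also have "\<dots> = 0" using ab by (simp add: c_def)
    finally have "c a = 0" using * ab by blast
    then show False by (simp add: c_def)
  qed
  have "independent (v ` I)"
  proof (rule independent_if_scalars_zero)
    show "finite (v ` I)" using assms by simp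
    fix u x assume s: "(\<Sum>x\<in>v ` I. u x *\<^sub>R x) = 0" and x: "x \<in> v ` I"
    have "(\<Sum>i\<in>I. u (v i) *\<^sub>R v i) = 0" using s by (simp add: sum.reindex[OF inj])
    then show "u x = 0" using * x by (auto dest: spec[of _ "\<lambda>i. u (v i)"])
  qed
  with inj show "independent_family v I" by (simp add: independent_family_def)
qed

section \<open>Inverse functions, perturbed linear maps and perturbed forms\<close>

lemma continuous_on_Blinfun:
  fixes D :: "'z::t2_space \<Rightarrow> 'a::euclidean_space \<Rightarrow> 'b::real_normed_vector"
  assumes lin: "\<And>z. bounded_linear (D z)" and c: "\<And>h. continuous_on S (\<lambda>z. D z h)"
  shows "continuous_on S (\<lambda>z. Blinfun (D z))"
  by (intro continuous_on_blinfun_componentwise) (simp add: bounded_linear_Blinfun_apply[OF lin] c)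

text \<open>The inverse function theorem for a derivative given pointwise. In finite dimension,
  continuity in each direction is continuity in operator norm, and injectivity is invertibility.\<close>
lemma local_homeomorphism_of_injective_derivative:
  fixes F :: "'a::euclidean_space \<Rightarrow> 'a"
  assumes D: "\<And>z. (F has_derivative D z) (at z)" and c: "\<And>h. continuous_on UNIV (\<lambda>z. D z h)"
    and inj: "\<And>h. D z0 h = 0 \<Longrightarrow> h = 0"
  obtains U V g where "open U" "z0 \<in> U" "open V" "F z0 \<in> V" "homeomorphism U V F g"
proof -
  have bl: "bounded_linear (D z)" for z using D by (rule has_derivative_bounded_linear)
  then have lin: "linear (D z0)" using bounded_linear.linear by blast
  then have "inj (D z0)" using inj linear_injective_0 by blast
  then obtain k where k: "linear k" "k \<circ> D z0 = id"
    using linear_injective_left_inverse[OF lin] by blast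
  have blk: "bounded_linear k" using k(1) by (simp add: linear_conv_bounded_linear)
  have 1: "(F has_derivative blinfun_apply (Blinfun (D z))) (at z)" for z
    using D by (simp add: bounded_linear_Blinfun_apply[OF bl])
  have 2: "Blinfun k o\<^sub>L Blinfun (D z0) = id_blinfun"
    using k(2) by (intro blinfun_eqI)
      (simp add: bounded_linear_Blinfun_apply[OF bl] bounded_linear_Blinfun_apply[OF blk] pointfree_idE)
  show thesis
    using inverse_function_theorem[OF open_UNIV 1 continuous_on_Blinfun[OF bl c] UNIV_I 2] that by metis
qed

text \<open>An injective linear map is bounded below, and the bound survives small perturbations. Hence
  solutions of a perturbed overdetermined system, if they exist, are close to the unperturbed
  solution, uniformly in the point. This is the continuity of multipliers under LICQ.\<close>
lemma eventually_injective_and_solution_close: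
  fixes B :: "'x::t2_space \<Rightarrow> 'a::euclidean_space \<Rightarrow> 'b::euclidean_space"
  assumes lin: "\<And>x. linear (B x)" and c: "\<And>u. continuous_on UNIV (\<lambda>x. B x u)"
    and w: "continuous_on UNIV w" and inj: "\<And>u. B x0 u = 0 \<Longrightarrow> u = 0"
    and sol: "B x0 u0 = w x0" and e: "e > 0"
  shows "\<exists>V. open V \<and> x0 \<in> V \<and> (\<forall>x\<in>V. \<forall>u. (B x u = 0 \<longrightarrow> u = 0) \<and> (B x u = w x \<longrightarrow> dist u u0 < e))"
proof -
  have bl: "bounded_linear (B x)" for x using lin by (simp add: linear_conv_bounded_linear)
  define \<beta> where "\<beta> x = Blinfun (B x)" for x
  have \<beta>: "blinfun_apply (\<beta> x) = B x" for x by (simp add: \<beta>_def bounded_linear_Blinfun_apply[OF bl])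
  have c\<beta>: "continuous_on UNIV \<beta>" unfolding \<beta>_def by (rule continuous_on_Blinfun[OF bl c])
  have "inj (B x0)" using inj linear_injective_0[OF lin] by blast
  then obtain m where m: "m > 0" "\<And>u. m * norm u \<le> norm (B x0 u)"
    using linear_inj_bounded_below_pos[OF lin] by blast
  define V where "V = {x. norm (\<beta> x - \<beta> x0) < m / 2} \<inter> {x. norm (w x - B x u0) < m / 2 * e}"
  have V: "open V" "x0 \<in> V"
    using m e sol by (auto simp: V_def intro!: open_Int open_Collect_less continuous_intros c\<beta> w c)
  have below: "m / 2 * norm u \<le> norm (B x u)" if "x \<in> V" for x u
  proof -
    have "norm (B x u - B x0 u) \<le> norm (\<beta> x - \<beta> x0) * norm u"
      using norm_blinfun[of "\<beta> x - \<beta> x0" u] by (simp add: blinfun.diff_left \<beta>)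
    also have "\<dots> \<le> m / 2 * norm u" using that by (intro mult_right_mono) (auto simp: V_def)
    finally have "norm (B x0 u) - norm (B x u) \<le> m / 2 * norm u"
      using norm_triangle_ineq2[of "B x0 u" "B x u"] by (simp add: norm_minus_commute)
    then show ?thesis using m(2)[of u] by simp
  qed
  have inj': "u = 0" if "x \<in> V" "B x u = 0" for x u
    using below[OF that(1), of u] that(2) m(1) by (simp add: mult_le_0_iff)
  have "dist u u0 < e" if "x \<in> V" "B x u = w x" for x u
  proof -
    have "m / 2 * norm (u - u0) \<le> norm (w x - B x u0)"
      using below[OF that(1), of "u - u0"] that(2) by (simp add: linear_diff[OF lin])
    also have "\<dots> < m / 2 * e" using that(1) by (simp add: V_def)
    finally show ?thesis using m(1) by (simp add: dist_norm)
  qed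
  with inj' have "\<forall>x\<in>V. \<forall>u. (B x u = 0 \<longrightarrow> u = 0) \<and> (B x u = w x \<longrightarrow> dist u u0 < e)"
    by (intro ballI allI conjI impI)
  with V show ?thesis by (intro exI conjI)
qed

text \<open>Here \<open>W\<close> lies in the kernel of the constraint map \<open>C z\<close>, which moves with \<open>z\<close>, so \<open>W\<close> cannot
  be compared with \<open>P\<close> inside \<open>E\<close>. The comparison is made in the whole space, with
  \<open>P\<close> enlarged by the orthogonal complement of \<open>E\<close>. No unit vector of the enlarged space
  satisfies both \<open>C z0 u = 0\<close> and \<open>Q z0 u \<le> 0\<close>. By compactness of the sphere this persists for \<open>z\<close> near
  \<open>z0\<close>, so that \<open>W\<close> meets the enlarged space only in \<open>0\<close>.\<close>
lemma nonpositive_subspace_dim_semicontinuous: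
  fixes C :: "'z::euclidean_space \<Rightarrow> 'u::euclidean_space \<Rightarrow> 'v::real_normed_vector" and Q :: "'z \<Rightarrow> 'u \<Rightarrow> real"
  assumes cC: "continuous_on UNIV (\<lambda>y. C (snd y) (fst y))"
    and cQ: "continuous_on UNIV (\<lambda>y. Q (snd y) (fst y))"
    and hom: "\<And>z r u. Q z (r *\<^sub>R u) = r\<^sup>2 * Q z u"
    and E: "subspace E" and CE: "{u. C z0 u = 0} \<subseteq> E"
    and P: "subspace P" "P \<subseteq> E" and pos: "\<forall>u\<in>P - {0}. Q z0 u > 0"
  shows "\<exists>Z. open Z \<and> z0 \<in> Z \<and> (\<forall>z\<in>Z. \<forall>W. subspace W \<longrightarrow> (\<forall>u\<in>W. C z u = 0 \<and> Q z u \<le> 0)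
      \<longrightarrow> dim W + dim P \<le> dim E)"
proof -
  define E' where "E' = {y \<in> UNIV. \<forall>x\<in>E. orthogonal x y}"
  have E': "subspace E'" "dim E' + dim E = DIM('u)"
    using dim_subspace_orthogonal_to_vectors[OF E subspace_UNIV]
    by (auto simp: E'_def subspace_orthogonal_to_vectors)
  \<comment> \<open>The enlargement of \<open>P\<close>; its intersection with \<open>E\<close> is \<open>P\<close> again.\<close>
  define R where "R = {x + y |x y. x \<in> P \<and> y \<in> E'}"
  have R: "subspace R" unfolding R_def using P E' by (intro subspace_sums)
  have "P \<inter> E' \<subseteq> {0}"
    using P(2) by (auto simp: E'_def orthogonal_def dest!: bspec subsetD)
  then have "dim (P \<inter> E') = 0" by simp
  then have dimR: "dim R + dim E = dim P + DIM('u)"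
    using dim_sums_Int[OF P(1) E'(1)] E'(2) unfolding R_def by linarith
  have RE: "u \<in> P" if u: "u \<in> R" "u \<in> E" for u
  proof -
    obtain x y where xy: "u = x + y" "x \<in> P" "y \<in> E'" using u(1) by (auto simp: R_def)
    then have "y \<in> E" using subspace_diff[OF E u(2), of x] P(2) by auto
    then have "y = 0" using xy(3) by (auto simp: E'_def orthogonal_def)
    then show ?thesis using xy by simp
  qed
  define S where "S = R \<inter> sphere 0 1"
  define B where "B = {z. \<exists>u. u \<in> S \<and> (u, z) \<in> {y. C (snd y) (fst y) = 0} \<inter> {y. Q (snd y) (fst y) \<le> 0}}"
  have "compact S" unfolding S_def using R by (intro closed_Int_compact closed_subspace) auto
  then have "closed B" unfolding B_def
    by (intro closed_compact_projection closed_Int closed_Collect_eq closed_Collect_le cC cQ continuous_intros)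
  then have oB: "open (- B)" by (simp add: open_Compl)
  have "z0 \<notin> B"
  proof
    assume "z0 \<in> B"
    then obtain u where u: "u \<in> R" "norm u = 1" "C z0 u = 0" "Q z0 u \<le> 0" by (auto simp: B_def S_def)
    then have "u \<in> P" using RE CE by blast
    moreover have "u \<noteq> 0" using u by auto
    ultimately have "Q z0 u > 0" using pos by blast
    then show False using u(4) by simp
  qed
  then have z0: "z0 \<in> - B" by simp
  have "dim W + dim P \<le> dim E"
    if z: "z \<in> - B" and W: "subspace W" "\<forall>u\<in>W. C z u = 0 \<and> Q z u \<le> 0" for z W
  proof -
    have "W \<inter> R \<subseteq> {0}"
    proof
      fix u assume u: "u \<in> W \<inter> R"
      show "u \<in> {0}"
      proof (rule ccontr)
        assume "u \<notin> {0}"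
        then have "u /\<^sub>R norm u \<in> S" "u /\<^sub>R norm u \<in> W"
          using u R W(1) by (auto simp: S_def subspace_scale)
        then have "z \<in> B" using W(2) by (auto simp: B_def)
        then show False using z by blast
      qed
    qed
    then have "dim (W \<inter> R) = 0" by simp
    then have "dim {x + y |x y. x \<in> W \<and> y \<in> R} = dim W + dim R"
      using dim_sums_Int[OF W(1) R] by linarith
    moreover have "dim {x + y |x y. x \<in> W \<and> y \<in> R} \<le> DIM('u)" by (rule dim_subset_UNIV)
    ultimately show ?thesis using dimR by linarith
  qed
  then have "\<forall>z\<in>- B. \<forall>W. subspace W \<longrightarrow> (\<forall>u\<in>W. C z u = 0 \<and> Q z u \<le> 0) \<longrightarrow> dim W + dim P \<le> dim E"
    by (intro ballI allI impI)
  with oB z0 show ?thesis by (intro exI conjI)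
qed

lemma dim_orthogonal_to_range:
  fixes L :: "'a::euclidean_space \<Rightarrow> 'b::euclidean_space"
  assumes L: "linear L" and S: "subspace S" and inj: "\<And>u. u \<in> S \<Longrightarrow> L u = 0 \<Longrightarrow> u = 0"
  shows "dim {y. \<forall>u\<in>S. L u \<bullet> y = 0} + dim S = DIM('b)"
proof -
  have "inj_on L S" using linear_inj_on_iff_eq_0[OF L S] inj by blast
  moreover have "span S = S" using S span_eq_iff by blast
  ultimately have "dim (L ` S) = dim S" by (intro dim_image_eq[OF L]) argo
  moreover have "subspace (L ` S)" using linear_subspace_image[OF L S] .
  moreover have "{y \<in> UNIV. \<forall>x\<in>L ` S. orthogonal x y} = {y. \<forall>u\<in>S. L u \<bullet> y = 0}"
    by (auto simp: orthogonal_def)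
  ultimately show ?thesis
    using dim_subspace_orthogonal_to_vectors[of "L ` S" UNIV] by simp
qed

lemma dim_coordinate_subspace: "dim {x::real^'k. \<forall>j. j \<notin> D \<longrightarrow> x $ j = 0} = card D"
  using dim_substandard_cart[where 'a=real] unfolding dim_vec_eq .

lemma subspace_coordinate: "subspace {x::real^'k. \<forall>j. j \<notin> D \<longrightarrow> x $ j = 0}"
  by (simp add: subspace_def)

lemma dim_Times_real:
  fixes S :: "'a::euclidean_space set" and T :: "'b::euclidean_space set"
  shows "subspace S \<Longrightarrow> subspace T \<Longrightarrow> dim (S \<times> T) = dim S + dim T"
  by (rule dim_Times)

lemma has_derivative_vec_lambda:
  assumes "\<And>j. ((\<lambda>z. f j z) has_derivative (\<lambda>h. f' j h)) (at z)"
  shows "((\<lambda>z. (\<chi> j. f j z)::real^'k) has_derivative (\<lambda>h. \<chi> j. f' j h)) (at z)"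
  using assms by (subst has_derivative_componentwise_within) (auto simp: Basis_vec_def inner_axis)

lemmas has_derivative_vec_nth = bounded_linear.has_derivative[OF bounded_linear_vec_nth]

section \<open>Smoothing complementarity pairs next to regular equality constraints\<close>

text \<open>The situation after sorting the constraints: \<open>K1 j = t\<close> is a regular equality constraint for
  \<open>j \<notin> J\<close>, while \<open>K1 j\<close> and \<open>K2 j\<close> form a biactive complementarity pair for \<open>j \<in> J\<close>. Setting
  \<open>K2 j\<close> to \<open>0\<close> off \<open>J\<close> lets all sums run over all indices. The multipliers in \<open>m1\<close>, \<open>m2\<close> are those
  of the limit problem. The matrix \<open>A\<close> in the lemmas below is the Hessian of its Lagrangian.\<close>
locale mixed_smoothing =
  fixes f :: "real^'n \<Rightarrow> real" and K1 K2 :: "'k::finite \<Rightarrow> real^'n \<Rightarrow> real" and J :: "'k set"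
    and xb :: "real^'n" and m1 m2 :: "'k \<Rightarrow> real"
  assumes f: "C2 f" and K1: "\<And>j. C2 (K1 j)" and K2: "\<And>j. C2 (K2 j)"
    and K1_xb: "\<And>j. K1 j xb = 0" and K2_xb: "\<And>j. j \<in> J \<Longrightarrow> K2 j xb = 0"
    and K2_off: "\<And>j. j \<notin> J \<Longrightarrow> K2 j = (\<lambda>x. 0)"
    and stationary: "grad f xb = (\<Sum>j\<in>UNIV. m1 j *\<^sub>R grad (K1 j) xb) + (\<Sum>j\<in>UNIV. m2 j *\<^sub>R grad (K2 j) xb)"
    and same_sign: "\<And>j. j \<in> J \<Longrightarrow> m1 j * m2 j > 0"
    and licq: "\<And>(a::real^'k) (b::real^'k). (\<And>j. j \<notin> J \<Longrightarrow> b $ j = 0) \<Longrightarrow>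
      (\<Sum>j\<in>UNIV. a $ j *\<^sub>R grad (K1 j) xb) + (\<Sum>j\<in>UNIV. b $ j *\<^sub>R grad (K2 j) xb) = 0 \<Longrightarrow> a = 0 \<and> b = 0"
begin

lemma grad_K2_off [simp]: "j \<notin> J \<Longrightarrow> grad (K2 j) x = 0"
  by (simp add: K2_off grad_const)

lemma hessian_K2_off [simp]: "j \<notin> J \<Longrightarrow> hessian (K2 j) x *v h = 0"
  by (simp add: K2_off hessian_const)

definition G :: "'k \<Rightarrow> real^'n \<Rightarrow> real" where
  "G j = (if j \<in> J then (\<lambda>x. K1 j x * K2 j x) else K1 j)"

lemma G: "C2 (G j)"
  by (simp add: G_def K1 K2 C2_mult)

lemma grad_G: "grad (G j) x = (if j \<in> J then K2 j x *\<^sub>R grad (K1 j) x + K1 j x *\<^sub>R grad (K2 j) x else grad (K1 j) x)"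
  by (simp add: G_def C2_mult K1 K2)

text \<open>Here \<open>\<omega> j\<close> corresponds to \<open>- \<eta> j\<close> in the Karush-Kuhn-Tucker system of the smoothing.\<close>
definition kkt :: "real \<Rightarrow> real^'n \<Rightarrow> ('k \<Rightarrow> real) \<Rightarrow> bool" where
  "kkt t x \<omega> \<longleftrightarrow> (\<forall>j. G j x = t) \<and> (\<forall>j\<in>J. K1 j x \<ge> 0 \<and> K2 j x \<ge> 0) \<and>
     grad f x = (\<Sum>j\<in>UNIV. \<omega> j *\<^sub>R grad (G j) x)"

definition sg :: "'k \<Rightarrow> real" where "sg j = sgn (m1 j)"

text \<open>The multipliers of \<open>K1 j\<close> and \<open>K2 j\<close> as functions of the unknowns \<open>p\<close> and \<open>q\<close>, their
  derivatives, and the inverse functions, which recover \<open>p\<close> and \<open>q\<close> from multipliers of the right sign. The square, with the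
  sign of the limit multiplier, is used only for the pairs. Off \<open>J\<close> the unknown \<open>q j\<close> is a dummy, kept at \<open>0\<close>.\<close>
definition mult1 :: "'k \<Rightarrow> real \<Rightarrow> real" where "mult1 j p = (if j \<in> J then sg j * p\<^sup>2 else p)"
definition mult2 :: "'k \<Rightarrow> real \<Rightarrow> real" where "mult2 j q = sg j * q\<^sup>2"
definition dmult1 :: "'k \<Rightarrow> real \<Rightarrow> real" where "dmult1 j p = (if j \<in> J then sg j * (2 * p) else 1)"
definition dmult2 :: "'k \<Rightarrow> real \<Rightarrow> real" where "dmult2 j q = sg j * (2 * q)"

definition root1 :: "'k \<Rightarrow> real \<Rightarrow> real" where "root1 j a = (if j \<in> J then sqrt \<bar>a\<bar> else a)"
definition root2 :: "'k \<Rightarrow> real \<Rightarrow> real" where "root2 j b = (if j \<in> J then sqrt \<bar>b\<bar> else 0)"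

definition p0 :: "real^'k" where "p0 = (\<chi> j. root1 j (m1 j))"
definition q0 :: "real^'k" where "q0 = (\<chi> j. root2 j (m2 j))"

lemma sg_J: "j \<in> J \<Longrightarrow> sg j = 1 \<or> sg j = -1" "j \<in> J \<Longrightarrow> sg j * sg j = 1"
    "j \<in> J \<Longrightarrow> sg j * \<bar>m1 j\<bar> = m1 j" "j \<in> J \<Longrightarrow> sg j * \<bar>m2 j\<bar> = m2 j"
  using same_sign[of j] by (auto simp: sg_def sgn_if zero_less_mult_iff)

lemma mult1_p0: "mult1 j (p0 $ j) = m1 j"
  by (simp add: mult1_def p0_def root1_def sg_J)

lemma mult2_q0: "j \<in> J \<Longrightarrow> mult2 j (q0 $ j) = m2 j"
  by (simp add: mult2_def q0_def root2_def sg_J)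

lemma p0_q0_pos: "j \<in> J \<Longrightarrow> p0 $ j > 0" "j \<in> J \<Longrightarrow> q0 $ j > 0"
  using same_sign[of j] by (auto simp: p0_def q0_def root1_def root2_def)

text \<open>The desingularised system. For positive \<open>p j\<close> and \<open>q j\<close>, the equations for \<open>j \<in> J\<close> encode
  both \<open>K1 j * K2 j = \<epsilon>\<^sup>2\<close> and the proportionality of the two multipliers to \<open>K2 j\<close> and \<open>K1 j\<close>.\<close>
definition sys :: "real \<Rightarrow> real^'n \<Rightarrow> real^'k \<Rightarrow> real^'k \<Rightarrow> bool" where
  "sys \<epsilon> x p q \<longleftrightarrow>
     grad f x = (\<Sum>j\<in>UNIV. mult1 j (p $ j) *\<^sub>R grad (K1 j) x) + (\<Sum>j\<in>UNIV. mult2 j (q $ j) *\<^sub>R grad (K2 j) x) \<and>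
     (\<forall>j\<in>J. p $ j * K1 j x = \<epsilon> * q $ j \<and> q $ j * K2 j x = \<epsilon> * p $ j) \<and>
     (\<forall>j. j \<notin> J \<longrightarrow> K1 j x = \<epsilon>\<^sup>2 \<and> q $ j = 0)"

text \<open>The Hessian of the Lagrangian with the multipliers of \<open>K1\<close> and \<open>K2\<close> held fixed.\<close>
definition hess :: "real^'n \<Rightarrow> real^'k \<Rightarrow> real^'k \<Rightarrow> real^'n \<Rightarrow> real^'n" where
  "hess x p q h = hessian f x *v h - (\<Sum>j\<in>UNIV. mult1 j (p $ j) *\<^sub>R (hessian (K1 j) x *v h))
     - (\<Sum>j\<in>UNIV. mult2 j (q $ j) *\<^sub>R (hessian (K2 j) x *v h))"

definition tangent :: "(real^'n) set" where
  "tangent = {\<xi>. \<forall>j. grad (K1 j) xb \<bullet> \<xi> = 0 \<and> grad (K2 j) xb \<bullet> \<xi> = 0}"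

lemma DERIV_mult1: "(mult1 j has_real_derivative dmult1 j p) (at p)"
  unfolding mult1_def[abs_def] dmult1_def by (cases "j \<in> J") (auto intro!: derivative_eq_intros)

lemma DERIV_mult2: "(mult2 j has_real_derivative dmult2 j p) (at p)"
  unfolding mult2_def[abs_def] dmult2_def by (auto intro!: derivative_eq_intros)

lemma continuous_on_mult1 [continuous_intros]: "continuous_on S u \<Longrightarrow> continuous_on S (\<lambda>z. mult1 j (u z))"
  and continuous_on_mult2 [continuous_intros]: "continuous_on S u \<Longrightarrow> continuous_on S (\<lambda>z. mult2 j (u z))"
  and continuous_on_dmult1 [continuous_intros]: "continuous_on S u \<Longrightarrow> continuous_on S (\<lambda>z. dmult1 j (u z))"
  and continuous_on_dmult2 [continuous_intros]: "continuous_on S u \<Longrightarrow> continuous_on S (\<lambda>z. dmult2 j (u z))"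
  unfolding mult1_def mult2_def dmult1_def dmult2_def by (cases "j \<in> J"; simp; intro continuous_intros; assumption)+

lemma continuous_on_root [continuous_intros]: "continuous_on S u \<Longrightarrow> continuous_on S (\<lambda>z. root1 j (u z))"
  "continuous_on S u \<Longrightarrow> continuous_on S (\<lambda>z. root2 j (u z))"
  unfolding root1_def root2_def by (cases "j \<in> J"; simp; intro continuous_intros; assumption)+

lemma continuous_on_hess [continuous_intros]:
  assumes "continuous_on S x" "continuous_on S p" "continuous_on S q" "continuous_on S h"
  shows "continuous_on S (\<lambda>z. hess (x z) (p z) (q z) (h z))"
  unfolding hess_def by (intro continuous_intros f K1 K2 assms)

text \<open>The system as a map of a space into itself. The parameter \<open>\<epsilon>\<close> is carried along as the last
  component, which turns the implicit function problem into one of inverting \<open>\<Phi>\<close>.\<close>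
definition \<Phi> :: "(real^'n) \<times> (real^'k) \<times> (real^'k) \<times> real \<Rightarrow> (real^'n) \<times> (real^'k) \<times> (real^'k) \<times> real" where
  "\<Phi> = (\<lambda>(x, p, q, \<epsilon>).
     (grad f x - (\<Sum>j\<in>UNIV. mult1 j (p $ j) *\<^sub>R grad (K1 j) x) - (\<Sum>j\<in>UNIV. mult2 j (q $ j) *\<^sub>R grad (K2 j) x),
      (\<chi> j. if j \<in> J then p $ j * K1 j x - \<epsilon> * q $ j else K1 j x - \<epsilon>\<^sup>2),
      (\<chi> j. if j \<in> J then q $ j * K2 j x - \<epsilon> * p $ j else q $ j),
      \<epsilon>))"

definition d\<Phi> where
  "d\<Phi> = (\<lambda>(x, p, q, \<epsilon>) (dx, dp, dq, d\<epsilon>).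
     (hess x p q dx - (\<Sum>j\<in>UNIV. (dp $ j * dmult1 j (p $ j)) *\<^sub>R grad (K1 j) x)
        - (\<Sum>j\<in>UNIV. (dq $ j * dmult2 j (q $ j)) *\<^sub>R grad (K2 j) x),
      (\<chi> j. if j \<in> J then dp $ j * K1 j x + p $ j * (grad (K1 j) x \<bullet> dx) - (d\<epsilon> * q $ j + \<epsilon> * dq $ j)
            else grad (K1 j) x \<bullet> dx - 2 * \<epsilon> * d\<epsilon>),
      (\<chi> j. if j \<in> J then dq $ j * K2 j x + q $ j * (grad (K2 j) x \<bullet> dx) - (d\<epsilon> * p $ j + \<epsilon> * dp $ j) else dq $ j),
      d\<epsilon>))"

lemma \<Phi>_zero_iff: "\<Phi> (x, p, q, \<epsilon>) = (0, 0, 0, \<epsilon>') \<longleftrightarrow> sys \<epsilon> x p q \<and> \<epsilon>' = \<epsilon>"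
proof -
  have 1: "(u - v - w = 0) \<longleftrightarrow> u = v + w" for u v w :: "real^'n"
    by (simp add: algebra_simps)
  have 2: "(\<chi> j. if j \<in> J then u j - v j else w j - r) = (0::real^'k)
      \<longleftrightarrow> (\<forall>j\<in>J. u j = v j) \<and> (\<forall>j. j \<notin> J \<longrightarrow> w j = r)" for u v w r
    by (auto simp: vec_eq_iff)
  have 3: "(\<chi> j. if j \<in> J then u j - v j else w j) = (0::real^'k)
      \<longleftrightarrow> (\<forall>j\<in>J. u j = v j) \<and> (\<forall>j. j \<notin> J \<longrightarrow> w j = 0)" for u v w
    by (auto simp: vec_eq_iff)
  show ?thesis unfolding \<Phi>_def sys_def prod.case prod.inject 1 2 3 by blast
qed

lemma \<Phi>_has_derivative: "(\<Phi> has_derivative d\<Phi> z) (at z)"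
proof -
  obtain x p q \<epsilon> where z: "z = (x, p, q, \<epsilon>)" by (metis prod_cases4)
  note [derivative_intros] = has_derivative_compose[OF _ C2_has_derivative[OF K1]]
    has_derivative_compose[OF _ C2_has_derivative[OF K2]]
    has_derivative_compose[OF _ C2_grad_has_derivative[OF f]]
    has_derivative_compose[OF _ C2_grad_has_derivative[OF K1]]
    has_derivative_compose[OF _ C2_grad_has_derivative[OF K2]]
    DERIV_compose_FDERIV[OF DERIV_mult1] DERIV_compose_FDERIV[OF DERIV_mult2] has_derivative_vec_nth
  have 1: "((\<lambda>z. grad f (fst z) - (\<Sum>j\<in>UNIV. mult1 j (fst (snd z) $ j) *\<^sub>R grad (K1 j) (fst z))
      - (\<Sum>j\<in>UNIV. mult2 j (fst (snd (snd z)) $ j) *\<^sub>R grad (K2 j) (fst z)))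
      has_derivative (\<lambda>h. fst (d\<Phi> z h))) (at z)"
    unfolding z by (auto intro!: derivative_eq_intros simp: d\<Phi>_def hess_def split_beta fun_eq_iff
        sum.distrib algebra_simps)
  have 2: "((\<lambda>z. \<chi> j. if j \<in> J then fst (snd z) $ j * K1 j (fst z) - snd (snd (snd z)) * fst (snd (snd z)) $ j
        else K1 j (fst z) - (snd (snd (snd z)))\<^sup>2)
      has_derivative (\<lambda>h. fst (snd (d\<Phi> z h)))) (at z)"
    unfolding z d\<Phi>_def split_beta fst_conv snd_conv
  proof (rule has_derivative_vec_lambda)
    fix j
    show "((\<lambda>z. if j \<in> J then fst (snd z) $ j * K1 j (fst z) - snd (snd (snd z)) * fst (snd (snd z)) $ j
          else K1 j (fst z) - (snd (snd (snd z)))\<^sup>2)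
      has_derivative (\<lambda>h. if j \<in> J then fst (snd h) $ j * K1 j x + p $ j * (grad (K1 j) x \<bullet> fst h)
          - (snd (snd (snd h)) * q $ j + \<epsilon> * fst (snd (snd h)) $ j)
            else grad (K1 j) x \<bullet> fst h - 2 * \<epsilon> * snd (snd (snd h)))) (at (x, p, q, \<epsilon>))"
      by (cases "j \<in> J") (auto intro!: derivative_eq_intros)
  qed
  have 3: "((\<lambda>z. \<chi> j. if j \<in> J then fst (snd (snd z)) $ j * K2 j (fst z) - snd (snd (snd z)) * fst (snd z) $ j
        else fst (snd (snd z)) $ j)
      has_derivative (\<lambda>h. fst (snd (snd (d\<Phi> z h))))) (at z)"
    unfolding z d\<Phi>_def split_beta fst_conv snd_conv
  proof (rule has_derivative_vec_lambda)
    fix j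
    show "((\<lambda>z. if j \<in> J then fst (snd (snd z)) $ j * K2 j (fst z) - snd (snd (snd z)) * fst (snd z) $ j
        else fst (snd (snd z)) $ j)
      has_derivative (\<lambda>h. if j \<in> J then fst (snd (snd h)) $ j * K2 j x + q $ j * (grad (K2 j) x \<bullet> fst h)
          - (snd (snd (snd h)) * p $ j + \<epsilon> * fst (snd h) $ j)
            else fst (snd (snd h)) $ j)) (at (x, p, q, \<epsilon>))"
      by (cases "j \<in> J") (auto intro!: derivative_eq_intros)
  qed
  have 4: "((\<lambda>z. snd (snd (snd z))) has_derivative (\<lambda>h. snd (snd (snd (d\<Phi> z h))))) (at z)"
    unfolding z d\<Phi>_def by (auto intro!: derivative_eq_intros simp: split_beta)
  have "\<Phi> = (\<lambda>z. (grad f (fst z) - (\<Sum>j\<in>UNIV. mult1 j (fst (snd z) $ j) *\<^sub>R grad (K1 j) (fst z))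
      - (\<Sum>j\<in>UNIV. mult2 j (fst (snd (snd z)) $ j) *\<^sub>R grad (K2 j) (fst z)),
      (\<chi> j. if j \<in> J then fst (snd z) $ j * K1 j (fst z) - snd (snd (snd z)) * fst (snd (snd z)) $ j
        else K1 j (fst z) - (snd (snd (snd z)))\<^sup>2),
      (\<chi> j. if j \<in> J then fst (snd (snd z)) $ j * K2 j (fst z) - snd (snd (snd z)) * fst (snd z) $ j
        else fst (snd (snd z)) $ j), snd (snd (snd z))))"
    unfolding \<Phi>_def by (rule ext) (simp only: split_beta)
  then show ?thesis
    using has_derivative_Pair[OF 1 has_derivative_Pair[OF 2 has_derivative_Pair[OF 3 4]]]
    by simp
qed

lemma continuous_on_d\<Phi>: "continuous_on UNIV (\<lambda>z. d\<Phi> z h)"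
proof -
  have if_cont: "continuous_on UNIV (\<lambda>z. if j \<in> J then u z else v z)"
    if "continuous_on UNIV u" "continuous_on UNIV v"
    for j and u v :: "(real^'n) \<times> (real^'k) \<times> (real^'k) \<times> real \<Rightarrow> real"
    using that by (cases "j \<in> J") auto
  have "continuous_on UNIV (\<lambda>z. fst (d\<Phi> z h))"
    unfolding d\<Phi>_def split_beta fst_conv by (intro continuous_intros f K1 K2)
  moreover have "continuous_on UNIV (\<lambda>z. fst (snd (d\<Phi> z h)))"
    unfolding d\<Phi>_def split_beta fst_conv snd_conv
    by (intro continuous_on_vec_lambda if_cont) (intro continuous_intros C2_continuous_on[OF K1] K1)+
  moreover have "continuous_on UNIV (\<lambda>z. fst (snd (snd (d\<Phi> z h))))"
    unfolding d\<Phi>_def split_beta fst_conv snd_conv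
    by (intro continuous_on_vec_lambda if_cont) (intro continuous_intros C2_continuous_on[OF K2] K2)+
  moreover have "continuous_on UNIV (\<lambda>z. snd (snd (snd (d\<Phi> z h))))"
    unfolding d\<Phi>_def split_beta snd_conv by (intro continuous_intros)
  ultimately show ?thesis
    using continuous_on_Pair[of UNIV "\<lambda>z. fst (d\<Phi> z h)" "\<lambda>z. snd (d\<Phi> z h)"]
      continuous_on_Pair[of UNIV "\<lambda>z. fst (snd (d\<Phi> z h))" "\<lambda>z. snd (snd (d\<Phi> z h))"]
      continuous_on_Pair[of UNIV "\<lambda>z. fst (snd (snd (d\<Phi> z h)))" "\<lambda>z. snd (snd (snd (d\<Phi> z h)))"]
    by simp
qed

lemma hess_at_base: "hess xb p0 q0 h = hessian f xb *v h - (\<Sum>j\<in>UNIV. m1 j *\<^sub>R (hessian (K1 j) xb *v h))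
     - (\<Sum>j\<in>UNIV. m2 j *\<^sub>R (hessian (K2 j) xb *v h))"
proof -
  have "mult2 j (q0 $ j) *\<^sub>R (hessian (K2 j) xb *v h) = m2 j *\<^sub>R (hessian (K2 j) xb *v h)" for j
    by (cases "j \<in> J") (simp_all add: mult2_q0)
  then show ?thesis unfolding hess_def mult1_p0 by (simp only:)
qed

lemma subspace_tangent: "subspace tangent"
  by (auto simp: tangent_def subspace_def inner_add_right)

text \<open>A kernel vector has \<open>d\<epsilon> = 0\<close>, then \<open>dx\<close> tangent. The first component says that the
  Hessian maps \<open>dx\<close> into the span of the gradients, which is orthogonal to the tangent space, hence \<open>dx = 0\<close>
  by nonsingularity. What remains is a linear relation between the gradients. By LICQ its
  coefficients vanish, and these are nonzero multiples of \<open>dp\<close> and \<open>dq\<close> because \<open>p0\<close> and \<open>q0\<close> are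
  positive on \<open>J\<close>.\<close>
lemma d\<Phi>_injective:
  assumes A: "\<And>h. A *v h = hess xb p0 q0 h" and ns: "restricted_nonsingular A tangent"
    and z: "d\<Phi> (xb, p0, q0, 0) h = 0"
  shows "h = 0"
proof -
  obtain dx dp dq d\<epsilon> where h: "h = (dx, dp, dq, d\<epsilon>)" by (metis prod_cases4)
  have eps: "d\<epsilon> = 0"
    and eq: "hess xb p0 q0 dx = (\<Sum>j\<in>UNIV. (dp $ j * dmult1 j (p0 $ j)) *\<^sub>R grad (K1 j) xb)
        + (\<Sum>j\<in>UNIV. (dq $ j * dmult2 j (q0 $ j)) *\<^sub>R grad (K2 j) xb)"
    using z by (auto simp: d\<Phi>_def h zero_prod_def algebra_simps)
  have a: "(if j \<in> J then p0 $ j * (grad (K1 j) xb \<bullet> dx) else grad (K1 j) xb \<bullet> dx) = 0"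
    and b: "(if j \<in> J then q0 $ j * (grad (K2 j) xb \<bullet> dx) else dq $ j) = 0" for j
    using z eps K1_xb[of j] K2_xb[of j] by (auto simp: d\<Phi>_def h zero_prod_def vec_eq_iff dest!: spec[of _ j])
  have a': "grad (K1 j) xb \<bullet> dx = 0" and b': "grad (K2 j) xb \<bullet> dx = 0" for j
    using a[of j] b[of j] p0_q0_pos[of j] by (auto split: if_splits)
  have off: "j \<notin> J \<Longrightarrow> dq $ j = 0" for j using b[of j] by simp
  have dx: "dx \<in> tangent" using a' b' by (auto simp: tangent_def)
  have "restrict_matrix A tangent dx = 0"
  proof (subst restrict_matrix_eq_iff[OF subspace_tangent], intro conjI ballI)
    fix y assume "y \<in> tangent"
    then show "y \<bullet> 0 = y \<bullet> (A *v dx)"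
      by (auto simp: A eq tangent_def inner_add_right inner_sum_right inner_commute intro!: sum.neutral)
  qed (rule subspace_0[OF subspace_tangent])
  moreover have "restrict_matrix A tangent 0 = 0"
    by (subst restrict_matrix_eq_iff[OF subspace_tangent]) (auto simp: subspace_0[OF subspace_tangent])
  moreover have "inj_on (restrict_matrix A tangent) tangent"
    using ns by (simp add: restricted_nonsingular_def bij_betw_def)
  ultimately have dx0: "dx = 0"
    using dx subspace_0[OF subspace_tangent] by (metis inj_onD)
  then have "hess xb p0 q0 dx = 0" using A[of 0] by simp
  then have *: "(\<chi> j. dp $ j * dmult1 j (p0 $ j)) = (0::real^'k) \<and> (\<chi> j. dq $ j * dmult2 j (q0 $ j)) = (0::real^'k)"
    using eq off by (intro licq) auto
  have "dp $ j = 0 \<and> dq $ j = 0" for j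
    using * off[of j] p0_q0_pos[of j] sg_J(1)[of j]
    by (cases "j \<in> J") (auto simp: vec_eq_iff dmult1_def dmult2_def dest!: spec[of _ j])
  then show ?thesis using eps dx0 by (auto simp: h vec_eq_iff zero_prod_def)
qed

lemma sys_at_base: "sys 0 xb p0 q0"
proof -
  have "mult2 j (q0 $ j) *\<^sub>R grad (K2 j) xb = m2 j *\<^sub>R grad (K2 j) xb" for j
    by (cases "j \<in> J") (simp_all add: mult2_q0)
  then have "grad f xb = (\<Sum>j\<in>UNIV. mult1 j (p0 $ j) *\<^sub>R grad (K1 j) xb) + (\<Sum>j\<in>UNIV. mult2 j (q0 $ j) *\<^sub>R grad (K2 j) xb)"
    unfolding mult1_p0 stationary by (simp only:)
  then show ?thesis using K1_xb K2_xb by (simp add: sys_def q0_def root2_def)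
qed

text \<open>Existence and uniqueness of the solution for small \<open>\<epsilon>\<close>: the local inverse of \<open>\<Phi>\<close> is applied
  along the line \<open>(0, 0, 0, \<epsilon>)\<close>.\<close>
lemma sys_branch:
  assumes A: "\<And>h. A *v h = hess xb p0 q0 h" and ns: "restricted_nonsingular A tangent"
  shows "\<exists>N e. open N \<and> (xb, p0, q0) \<in> N \<and> e > 0 \<and>
    (\<forall>\<epsilon> x p q x' p' q'. \<bar>\<epsilon>\<bar> < e \<longrightarrow> (x, p, q) \<in> N \<longrightarrow> (x', p', q') \<in> N \<longrightarrow>
       sys \<epsilon> x p q \<longrightarrow> sys \<epsilon> x' p' q' \<longrightarrow> x = x') \<and>
    (\<forall>M. open M \<longrightarrow> (xb, p0, q0) \<in> M \<longrightarrow>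
       (\<exists>e'>0. \<forall>\<epsilon>. \<bar>\<epsilon>\<bar> < e' \<longrightarrow> (\<exists>x p q. (x, p, q) \<in> M \<and> sys \<epsilon> x p q)))"
proof -
  have base: "\<Phi> (xb, p0, q0, 0) = (0, 0, 0, 0)" by (simp add: \<Phi>_zero_iff sys_at_base)
  obtain U V g where U: "open U" "(xb, p0, q0, 0) \<in> U" and oV: "open V" "\<Phi> (xb, p0, q0, 0) \<in> V"
    and hom: "homeomorphism U V \<Phi> g"
    by (rule local_homeomorphism_of_injective_derivative[OF \<Phi>_has_derivative continuous_on_d\<Phi> d\<Phi>_injective[OF A ns]])
  then have V: "open V" "(0, 0, 0, 0) \<in> V" unfolding base by (simp_all only:)
  have "continuous_on UNIV (\<lambda>(w::(real^'n) \<times> (real^'k) \<times> (real^'k), \<epsilon>::real). (fst w, fst (snd w), snd (snd w), \<epsilon>))"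
    unfolding split_beta by (intro continuous_intros)
  from open_vimage[OF U(1) this]
  have "open {w. (fst (fst w), fst (snd (fst w)), snd (snd (fst w)), snd w) \<in> U}"
    unfolding vimage_def split_beta .
  moreover have "((xb, p0, q0), 0) \<in> {w. (fst (fst w), fst (snd (fst w)), snd (snd (fst w)), snd w) \<in> U}"
    using U by simp
  ultimately obtain N I where NI: "open N" "open I" "((xb, p0, q0), 0) \<in> N \<times> I"
      "N \<times> I \<subseteq> {w. (fst (fst w), fst (snd (fst w)), snd (snd (fst w)), snd w) \<in> U}"
    by (rule open_prod_elim)
  have "0 \<in> I" using NI(3) by simp
  then obtain e where e: "e > 0" "ball 0 e \<subseteq> I" using NI(2) open_contains_ball by blast
  have inU: "(x, p, q, \<epsilon>) \<in> U" if "(x, p, q) \<in> N" "\<bar>\<epsilon>\<bar> < e" for x p q \<epsilon>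
  proof -
    have "\<epsilon> \<in> I" using e(2) that(2) by (intro subsetD[OF e(2)]) simp
    then have "((x, p, q), \<epsilon>) \<in> N \<times> I" using that(1) by simp
    from subsetD[OF NI(4) this] show ?thesis by simp
  qed
  have uniq: "x = x'" if "\<bar>\<epsilon>\<bar> < e" "(x, p, q) \<in> N" "(x', p', q') \<in> N" "sys \<epsilon> x p q" "sys \<epsilon> x' p' q'"
    for \<epsilon> x p q x' p' q'
  proof -
    have "\<Phi> (x, p, q, \<epsilon>) = (0, 0, 0, \<epsilon>)" "\<Phi> (x', p', q', \<epsilon>) = (0, 0, 0, \<epsilon>)"
      using that by (simp_all add: \<Phi>_zero_iff)
    then have "\<Phi> (x, p, q, \<epsilon>) = \<Phi> (x', p', q', \<epsilon>)" by simp
    then have "(x, p, q, \<epsilon>) = (x', p', q', \<epsilon>)"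
      using homeomorphism_apply1[OF hom inU[OF that(2,1)]] homeomorphism_apply1[OF hom inU[OF that(3,1)]]
      by argo
    then show ?thesis by simp
  qed
  have exist: "\<exists>e'>0. \<forall>\<epsilon>. \<bar>\<epsilon>\<bar> < e' \<longrightarrow> (\<exists>x p q. (x, p, q) \<in> M \<and> sys \<epsilon> x p q)"
    if M: "open M" "(xb, p0, q0) \<in> M" for M
  proof -
    define proj where "proj = (\<lambda>(x, p, q, \<epsilon>). (x, p, q)) \<circ> g"
    have cg: "continuous_on V g" using hom by (simp add: homeomorphism_def)
    have "continuous_on V proj" unfolding proj_def o_def split_beta
      by (intro continuous_intros cg)
    then have oV: "open (V \<inter> proj -` M)"
      using V(1) M(1) continuous_on_open_vimage[OF V(1), of proj] by (metis Int_commute)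
    have g0: "g (0, 0, 0, 0) = (xb, p0, q0, 0)"
      using homeomorphism_apply1[OF hom U(2)] base by simp
    have "continuous_on UNIV (\<lambda>\<epsilon>::real. (0::real^'n, 0::real^'k, 0::real^'k, \<epsilon>))"
      by (intro continuous_intros)
    from open_vimage[OF oV this]
    have "open ((\<lambda>\<epsilon>::real. (0::real^'n, 0::real^'k, 0::real^'k, \<epsilon>)) -` (V \<inter> proj -` M))" .
    moreover have "0 \<in> (\<lambda>\<epsilon>::real. (0::real^'n, 0::real^'k, 0::real^'k, \<epsilon>)) -` (V \<inter> proj -` M)"
      unfolding proj_def using V(2) M(2) g0 by simp
    ultimately obtain e' where e': "e' > 0"
        "ball 0 e' \<subseteq> (\<lambda>\<epsilon>::real. (0::real^'n, 0::real^'k, 0::real^'k, \<epsilon>)) -` (V \<inter> proj -` M)"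
      using open_contains_ball by blast
    have "\<exists>x p q. (x, p, q) \<in> M \<and> sys \<epsilon> x p q" if "\<bar>\<epsilon>\<bar> < e'" for \<epsilon>
    proof -
      have "\<epsilon> \<in> ball 0 e'" using that by simp
      then have *: "(0, 0, 0, \<epsilon>) \<in> V" "proj (0, 0, 0, \<epsilon>) \<in> M" using e'(2) by auto
      obtain x p q \<epsilon>' where g: "g (0, 0, 0, \<epsilon>) = (x, p, q, \<epsilon>')" by (metis prod_cases4)
      then have "\<Phi> (x, p, q, \<epsilon>') = (0, 0, 0, \<epsilon>)" using homeomorphism_apply2[OF hom *(1)] by simp
      then have "sys \<epsilon> x p q" by (simp add: \<Phi>_zero_iff)
      moreover have "(x, p, q) \<in> M" using *(2) g unfolding proj_def by simp
      ultimately show ?thesis by blast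
    qed
    then show ?thesis using e'(1) by blast
  qed
  have "(xb, p0, q0) \<in> N" using NI(3) by simp
  moreover have "\<forall>\<epsilon> x p q x' p' q'. \<bar>\<epsilon>\<bar> < e \<longrightarrow> (x, p, q) \<in> N \<longrightarrow> (x', p', q') \<in> N \<longrightarrow>
       sys \<epsilon> x p q \<longrightarrow> sys \<epsilon> x' p' q' \<longrightarrow> x = x'"
    by (intro allI impI) (rule uniq)
  moreover have "\<forall>M. open M \<longrightarrow> (xb, p0, q0) \<in> M \<longrightarrow>
       (\<exists>e'>0. \<forall>\<epsilon>. \<bar>\<epsilon>\<bar> < e' \<longrightarrow> (\<exists>x p q. (x, p, q) \<in> M \<and> sys \<epsilon> x p q))"
    by (intro allI impI) (rule exist)
  ultimately show ?thesis using NI(1) e(1) by (intro exI[of _ N] exI[of _ e] conjI)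
qed

section \<open>Karush-Kuhn-Tucker points of the smoothed problem\<close>

text \<open>The multiplier of the smoothed constraint \<open>G j = t\<close>. For \<open>j \<in> J\<close> it is unbounded as \<open>\<epsilon>\<close>
  tends to \<open>0\<close>.\<close>
definition \<omega>_of :: "real \<Rightarrow> real^'k \<Rightarrow> real^'k \<Rightarrow> 'k \<Rightarrow> real" where
  "\<omega>_of \<epsilon> p q j = (if j \<in> J then sg j * p $ j * q $ j / \<epsilon> else p $ j)"

context
  fixes \<epsilon> :: real and x :: "real^'n" and p q :: "real^'k"
  assumes sys: "sys \<epsilon> x p q" and \<epsilon>: "\<epsilon> > 0" and pos: "\<forall>j\<in>J. p $ j > 0 \<and> q $ j > 0"
begin

lemma sys_K: "j \<in> J \<Longrightarrow> K1 j x = \<epsilon> * q $ j / p $ j" "j \<in> J \<Longrightarrow> K2 j x = \<epsilon> * p $ j / q $ j"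
  using sys bspec[OF pos, of j] by (simp_all add: sys_def field_simps)

lemma sys_K_pos: "j \<in> J \<Longrightarrow> K1 j x > 0 \<and> K2 j x > 0"
  using sys_K[of j] bspec[OF pos, of j] \<epsilon> by simp

lemma \<omega>_of_K: "j \<in> J \<Longrightarrow> \<omega>_of \<epsilon> p q j * K2 j x = mult1 j (p $ j)" "j \<in> J \<Longrightarrow> \<omega>_of \<epsilon> p q j * K1 j x = mult2 j (q $ j)"
  using sys_K[of j] bspec[OF pos, of j] \<epsilon> by (simp_all add: \<omega>_of_def mult1_def mult2_def power2_eq_square)

lemma kkt_of_sys: "kkt (\<epsilon>\<^sup>2) x (\<omega>_of \<epsilon> p q)"
proof -
  have "G j x = \<epsilon>\<^sup>2" for j
  proof (cases "j \<in> J")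
    case True
    then show ?thesis using sys_K[OF True] bspec[OF pos True] by (simp add: G_def power2_eq_square)
  next
    case False
    then show ?thesis using sys by (simp add: G_def sys_def)
  qed
  moreover have "mult1 j (p $ j) *\<^sub>R grad (K1 j) x + mult2 j (q $ j) *\<^sub>R grad (K2 j) x = \<omega>_of \<epsilon> p q j *\<^sub>R grad (G j) x" for j
  proof (cases "j \<in> J")
    case True
    then show ?thesis using \<omega>_of_K[OF True] by (simp add: grad_G scaleR_right_distrib)
  next
    case False
    then show ?thesis by (simp add: grad_G \<omega>_of_def mult1_def)
  qed
  then have "grad f x = (\<Sum>j\<in>UNIV. \<omega>_of \<epsilon> p q j *\<^sub>R grad (G j) x)"
    using sys unfolding sys_def by (simp add: sum.distrib[symmetric])
  ultimately show ?thesis using sys_K_pos by (auto simp: kkt_def intro: less_imp_le)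
qed

end

text \<open>Conversely, the square roots of the two bounded multipliers solve the system: with
  \<open>p\<^sup>2 = \<bar>\<omega>\<bar> * K2\<close> and \<open>q\<^sup>2 = \<bar>\<omega>\<bar> * K1\<close> both \<open>p * K1\<close> and \<open>\<surd>t * q\<close> are equal to
  \<open>K1 * \<surd>(\<bar>\<omega>\<bar> * K2)\<close>. The sign condition is what holds near the base point.\<close>
lemma sys_of_kkt:
  assumes kkt: "kkt t x \<omega>" and t: "t > 0"
    and sgn: "\<And>j. j \<in> J \<Longrightarrow> sg j * (\<omega> j * K2 j x) > 0"
  shows "sys (sqrt t) x (\<chi> j. root1 j (if j \<in> J then \<omega> j * K2 j x else \<omega> j))
    (\<chi> j. root2 j (if j \<in> J then \<omega> j * K1 j x else 0))"
proof -
  have K: "K1 j x > 0" "K2 j x > 0" "K1 j x * K2 j x = t" "sg j * \<bar>\<omega> j\<bar> = \<omega> j" if j: "j \<in> J" for j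
  proof -
    have *: "K1 j x * K2 j x = t" "K1 j x \<ge> 0" "K2 j x \<ge> 0"
      using kkt j unfolding kkt_def by (auto simp: G_def dest!: spec[of _ j])
    then show 1: "K1 j x > 0" "K2 j x > 0" "K1 j x * K2 j x = t"
      using t by (auto simp: less_le)
    have "sg j * \<omega> j * K2 j x > 0" using sgn[OF j] by (simp add: mult.assoc)
    then have "sg j * \<omega> j > 0" using 1(2) by (rule zero_less_mult_pos2)
    then show "sg j * \<bar>\<omega> j\<bar> = \<omega> j" using sg_J(1)[OF j] by auto
  qed
  let ?p = "\<lambda>j. root1 j (if j \<in> J then \<omega> j * K2 j x else \<omega> j)"
  let ?q = "\<lambda>j. root2 j (if j \<in> J then \<omega> j * K1 j x else 0)"
  have g: "\<omega> j *\<^sub>R grad (G j) x = mult1 j (?p j) *\<^sub>R grad (K1 j) x + mult2 j (?q j) *\<^sub>R grad (K2 j) x" for j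
  proof (cases "j \<in> J")
    case True
    have "mult1 j (?p j) = \<omega> j * K2 j x" "mult2 j (?q j) = \<omega> j * K1 j x"
      using True K[OF True] by (simp_all add: mult1_def mult2_def root1_def root2_def abs_mult mult.assoc[symmetric])
    then show ?thesis using True by (simp add: grad_G scaleR_right_distrib)
  next
    case False
    then show ?thesis by (simp add: grad_G mult1_def root1_def)
  qed
  have eq: "?p j * K1 j x = sqrt t * ?q j \<and> ?q j * K2 j x = sqrt t * ?p j" if j: "j \<in> J" for j
  proof -
    note k = K[OF j]
    have s: "sqrt t = sqrt (K1 j x) * sqrt (K2 j x)" by (simp add: k(3)[symmetric] real_sqrt_mult)
    have r: "K1 j x = sqrt (K1 j x) * sqrt (K1 j x)" "K2 j x = sqrt (K2 j x) * sqrt (K2 j x)"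
      using k by simp_all
    have "?p j = sqrt \<bar>\<omega> j\<bar> * sqrt (K2 j x)" "?q j = sqrt \<bar>\<omega> j\<bar> * sqrt (K1 j x)"
      using j k by (simp_all add: root1_def root2_def abs_mult real_sqrt_mult)
    then show ?thesis using s r by (metis mult.assoc mult.commute)
  qed
  have "grad f x = (\<Sum>j\<in>UNIV. mult1 j (?p j) *\<^sub>R grad (K1 j) x) + (\<Sum>j\<in>UNIV. mult2 j (?q j) *\<^sub>R grad (K2 j) x)"
    using kkt unfolding kkt_def g sum.distrib by blast
  moreover have "K1 j x = (sqrt t)\<^sup>2 \<and> ?q j = 0" if "j \<notin> J" for j
    using that kkt t unfolding kkt_def by (auto simp: G_def root2_def dest!: spec[of _ j])
  ultimately show ?thesis using eq by (simp add: sys_def)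
qed

text \<open>Linear combinations of the gradients. The second component makes the map injective on all
  coefficient vectors, although the gradients of \<open>K2 j\<close> are zero off \<open>J\<close>.\<close>
definition normal :: "real^'n \<Rightarrow> (real^'k) \<times> (real^'k) \<Rightarrow> (real^'n) \<times> (real^'k)" where
  "normal x u = ((\<Sum>j\<in>UNIV. fst u $ j *\<^sub>R grad (K1 j) x) + (\<Sum>j\<in>UNIV. snd u $ j *\<^sub>R grad (K2 j) x),
    (\<chi> j. if j \<in> J then 0 else snd u $ j))"

lemma linear_normal: "linear (normal x)"
  by (rule linearI)
    (auto simp: normal_def vec_eq_iff algebra_simps sum.distrib scaleR_sum_right)

lemma normal_injective_at_base: "normal xb u = 0 \<Longrightarrow> u = 0"
proof -
  assume z: "normal xb u = 0"
  have "fst u = 0 \<and> snd u = 0"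
  proof (rule licq)
    fix j assume j: "j \<notin> J"
    have "snd (normal xb u) $ j = 0" using z by simp
    then show "snd u $ j = 0" using j by (simp add: normal_def)
  next
    have "fst (normal xb u) = 0" using z by simp
    then show "(\<Sum>j\<in>UNIV. fst u $ j *\<^sub>R grad (K1 j) xb) + (\<Sum>j\<in>UNIV. snd u $ j *\<^sub>R grad (K2 j) xb) = 0"
      by (simp add: normal_def)
  qed
  then show "u = 0" by (simp add: prod_eq_iff)
qed

lemma normal_of_G:
  "normal x (\<chi> j. if j \<in> J then \<omega> j * K2 j x else \<omega> j, \<chi> j. if j \<in> J then \<omega> j * K1 j x else 0)
    = (\<Sum>j\<in>UNIV. \<omega> j *\<^sub>R grad (G j) x, 0)"
proof -
  have "(if j \<in> J then \<omega> j * K2 j x else \<omega> j) *\<^sub>R grad (K1 j) x + (if j \<in> J then \<omega> j * K1 j x else 0) *\<^sub>R grad (K2 j) x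
    = \<omega> j *\<^sub>R grad (G j) x" for j
    by (simp add: grad_G scaleR_right_distrib)
  then show ?thesis unfolding normal_def fst_conv snd_conv vec_lambda_beta sum.distrib[symmetric]
    by (simp add: vec_eq_iff)
qed

definition u0 :: "(real^'k) \<times> (real^'k)" where
  "u0 = (\<chi> j. m1 j, \<chi> j. if j \<in> J then m2 j else 0)"

lemma normal_u0: "normal xb u0 = (grad f xb, 0)"
proof -
  have "(if j \<in> J then m2 j else 0) *\<^sub>R grad (K2 j) xb = m2 j *\<^sub>R grad (K2 j) xb" for j by simp
  moreover have "(\<chi> j. if j \<in> J then 0 else if j \<in> J then m2 j else 0) = (0::real^'k)"
    by (simp add: vec_eq_iff)
  ultimately show ?thesis unfolding normal_def u0_def fst_conv snd_conv vec_lambda_beta stationary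
    by (simp only:)
qed

text \<open>Only the position of the point is assumed to be near the base point. That its multipliers are near
  those of the limit follows from LICQ, since the gradient of \<open>f\<close> is continuous. The second claim yields
  LICQ for the smoothed problem.\<close>
lemma kkt_near_base:
  assumes M: "open M" "(xb, p0, q0) \<in> M"
  shows "\<exists>V. open V \<and> xb \<in> V \<and>
    (\<forall>x\<in>V. \<forall>t \<omega>. t > 0 \<longrightarrow> kkt t x \<omega> \<longrightarrow> (\<exists>p q. (x, p, q) \<in> M \<and> sys (sqrt t) x p q)) \<and>
    (\<forall>x\<in>V. \<forall>u. normal x u = 0 \<longrightarrow> u = 0)"
proof -
  define h where "h = (\<lambda>y::(real^'n) \<times> (real^'k) \<times> (real^'k).
     (fst y, (\<chi> j. root1 j (fst (snd y) $ j)) :: real^'k, (\<chi> j. root2 j (snd (snd y) $ j)) :: real^'k))"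
  have "continuous_on UNIV h" unfolding h_def by (intro continuous_intros)
  from open_vimage[OF M(1) this] have "open (h -` M)" .
  moreover have "open {y::(real^'n) \<times> (real^'k) \<times> (real^'k). \<forall>j\<in>J. 0 < sg j * fst (snd y) $ j}"
  proof -
    have "open (\<Inter>j\<in>J. {y::(real^'n) \<times> (real^'k) \<times> (real^'k). 0 < sg j * fst (snd y) $ j})"
      by (intro open_INT finite ballI open_Collect_less continuous_intros)
    also have "(\<Inter>j\<in>J. {y::(real^'n) \<times> (real^'k) \<times> (real^'k). 0 < sg j * fst (snd y) $ j})
        = {y. \<forall>j\<in>J. 0 < sg j * fst (snd y) $ j}" by blast
    finally show ?thesis .
  qed
  ultimately have "open (h -` M \<inter> {y. \<forall>j\<in>J. 0 < sg j * fst (snd y) $ j})" by (rule open_Int)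
  moreover have "(xb, u0) \<in> h -` M \<inter> {y. \<forall>j\<in>J. 0 < sg j * fst (snd y) $ j}"
  proof
    have "(\<chi> j. root2 j (if j \<in> J then m2 j else 0)) = q0" by (simp add: q0_def root2_def vec_eq_iff)
    then show "(xb, u0) \<in> h -` M" using M(2) by (simp add: h_def u0_def p0_def)
    have "sg j * m1 j > 0" if "j \<in> J" for j
      using same_sign[OF that] by (auto simp: sg_def sgn_if zero_less_mult_iff)
    then show "(xb, u0) \<in> {y. \<forall>j\<in>J. 0 < sg j * fst (snd y) $ j}" by (simp add: u0_def)
  qed
  ultimately obtain X Y where XY: "open X" "open Y" "(xb, u0) \<in> X \<times> Y"
      "X \<times> Y \<subseteq> h -` M \<inter> {y. \<forall>j\<in>J. 0 < sg j * fst (snd y) $ j}"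
    by (rule open_prod_elim)
  have "u0 \<in> Y" using XY(3) by simp
  then obtain e where e: "e > 0" "ball u0 e \<subseteq> Y" using XY(2) open_contains_ball by blast
  have c: "continuous_on UNIV (\<lambda>x. normal x u)" for u
    unfolding normal_def by (intro continuous_intros K1 K2)
  have w: "continuous_on UNIV (\<lambda>x. (grad f x, 0::real^'k))" by (intro continuous_intros f)
  have "\<exists>V. open V \<and> xb \<in> V \<and>
      (\<forall>x\<in>V. \<forall>u. (normal x u = 0 \<longrightarrow> u = 0) \<and> (normal x u = (grad f x, 0) \<longrightarrow> dist u u0 < e))"
  proof (rule eventually_injective_and_solution_close[OF linear_normal c w _ normal_u0 e(1)])
    show "u = 0" if "normal xb u = 0" for u using normal_injective_at_base[OF that] .
  qed
  then obtain V where V: "open V" "xb \<in> V"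
    and V': "\<forall>x\<in>V. \<forall>u. (normal x u = 0 \<longrightarrow> u = 0) \<and> (normal x u = (grad f x, 0) \<longrightarrow> dist u u0 < e)"
    by (elim exE conjE)
  show ?thesis
  proof (intro exI[of _ "V \<inter> X"] conjI ballI allI impI)
    show "open (V \<inter> X)" using V(1) XY(1) by (rule open_Int)
    show "xb \<in> V \<inter> X" using V(2) XY(3) by simp
    show "u = 0" if "x \<in> V \<inter> X" "normal x u = 0" for x u using V' that by blast
    show "\<exists>p q. (x, p, q) \<in> M \<and> sys (sqrt t) x p q"
      if x: "x \<in> V \<inter> X" and t: "t > 0" and kkt: "kkt t x \<omega>" for x t \<omega>
    proof -
      define u where "u = ((\<chi> j. if j \<in> J then \<omega> j * K2 j x else \<omega> j) :: real^'k,
        (\<chi> j. if j \<in> J then \<omega> j * K1 j x else 0) :: real^'k)"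
      have "normal x u = (grad f x, 0)" using kkt by (simp add: u_def normal_of_G kkt_def)
      then have "dist u u0 < e" using V' x by blast
      then have "u \<in> ball u0 e" by (simp add: dist_commute)
      then have "(x, u) \<in> X \<times> Y" using subsetD[OF e(2)] x by simp
      then have "(x, u) \<in> h -` M \<inter> {y. \<forall>j\<in>J. 0 < sg j * fst (snd y) $ j}" by (rule subsetD[OF XY(4)])
      then have *: "h (x, u) \<in> M" "\<And>j. j \<in> J \<Longrightarrow> 0 < sg j * fst u $ j" by simp_all
      have "sys (sqrt t) x (\<chi> j. root1 j (if j \<in> J then \<omega> j * K2 j x else \<omega> j))
          (\<chi> j. root2 j (if j \<in> J then \<omega> j * K1 j x else 0))"
        using *(2) by (intro sys_of_kkt[OF kkt t]) (simp add: u_def)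
      moreover have "h (x, u) = (x, (\<chi> j. root1 j (if j \<in> J then \<omega> j * K2 j x else \<omega> j)),
          (\<chi> j. root2 j (if j \<in> J then \<omega> j * K1 j x else 0)))"
        unfolding h_def u_def by simp
      ultimately show ?thesis using *(1) by (simp only:) blast
    qed
  qed
qed

text \<open>The gradient of \<open>K1 j * K2 j\<close> vanishes in the limit, but for \<open>K2 j > 0\<close> its coefficient vector with
  respect to the independent gradients of \<open>K1 j\<close> and \<open>K2 j\<close> is nonzero.\<close>
lemma licq_G:
  assumes inj: "\<And>u. normal x u = 0 \<Longrightarrow> u = 0" and K: "\<And>j. j \<in> J \<Longrightarrow> K2 j x > 0"
    and z: "(\<Sum>j\<in>UNIV. c j *\<^sub>R grad (G j) x) = 0"
  shows "c j = 0"
proof -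
  have "((\<chi> j. if j \<in> J then c j * K2 j x else c j) :: real^'k, (\<chi> j. if j \<in> J then c j * K1 j x else 0) :: real^'k) = 0"
    using normal_of_G[of x c] z by (intro inj) (simp add: zero_prod_def)
  then have "(\<chi> j. if j \<in> J then c j * K2 j x else c j) $ j = (0::real)" by (simp add: zero_prod_def)
  then show ?thesis using K[of j] by (auto split: if_splits)
qed

lemma sum_axis: "(\<Sum>i\<in>UNIV. axis j (1::real) $ i *\<^sub>R (g i :: real^'n)) = g (j::'k)"
proof -
  have "axis j (1::real) $ i *\<^sub>R g i = (if i = j then g i else 0)" for i by (simp add: axis_def)
  then have "(\<Sum>i\<in>UNIV. axis j (1::real) $ i *\<^sub>R g i) = (\<Sum>i\<in>UNIV. if i = j then g i else 0)" by (simp only:)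
  then show ?thesis by simp
qed

definition tangent_at :: "real^'n \<Rightarrow> (real^'n) set" where
  "tangent_at x = {\<xi>. \<forall>j. grad (G j) x \<bullet> \<xi> = 0}"

lemma subspace_tangent_at: "subspace (tangent_at x)"
  by (auto simp: tangent_at_def subspace_def inner_add_right)

lemma dim_tangent_at:
  assumes licq_G: "\<forall>c. (\<Sum>j\<in>UNIV. c j *\<^sub>R grad (G j) x) = 0 \<longrightarrow> (\<forall>j. c j = 0)"
  shows "dim (tangent_at x) + CARD('k) = CARD('n)"
proof -
  define L where "L = (\<lambda>u::real^'k. \<Sum>j\<in>UNIV. u $ j *\<^sub>R grad (G j) x)"
  have lin: "linear L"
    by (rule linearI) (auto simp: L_def algebra_simps sum.distrib scaleR_sum_right)
  have "u = 0" if "L u = 0" for u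
  proof -
    have "\<forall>j. u $ j = 0" using spec[OF licq_G, of "\<lambda>j. u $ j"] that unfolding L_def by blast
    then show ?thesis by (simp add: vec_eq_iff)
  qed
  then have "dim {y. \<forall>u\<in>UNIV. L u \<bullet> y = 0} + dim (UNIV :: (real^'k) set) = DIM(real^'n)"
    by (intro dim_orthogonal_to_range[OF lin subspace_UNIV])
  moreover have "{y. \<forall>u\<in>UNIV. L u \<bullet> y = 0} = tangent_at x"
  proof (intro set_eqI iffI CollectI ballI)
    fix y assume *: "y \<in> {y. \<forall>u\<in>UNIV. L u \<bullet> y = 0}"
    have "L (axis j 1) = grad (G j) x" for j unfolding L_def by (rule sum_axis)
    moreover have "L (axis j 1) \<bullet> y = 0" for j using * by simp
    ultimately show "y \<in> tangent_at x" by (simp add: tangent_at_def)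
  next
    fix y u assume "y \<in> tangent_at x"
    then show "L u \<bullet> y = 0" by (simp add: tangent_at_def L_def inner_sum_left)
  qed
  ultimately show ?thesis by simp
qed

definition coords :: "'k set \<Rightarrow> (real^'k) set" where
  "coords D = {x. \<forall>j. j \<notin> D \<longrightarrow> x $ j = 0}"

lemma coords: "subspace (coords D)" "dim (coords D) = card D"
  unfolding coords_def by (rule subspace_coordinate dim_coordinate_subspace)+

lemma dim_tangent: "dim tangent + CARD('k) + card J = CARD('n)"
proof -
  define L where "L = (\<lambda>u. fst (normal xb u))"
  have lin: "linear L" unfolding L_def using linear_normal linear_compose[OF _ linear_fst] by (auto simp: o_def)
  have S: "subspace ((UNIV :: (real^'k) set) \<times> coords J)" by (intro subspace_Times subspace_UNIV coords)
  have "dim {y. \<forall>u\<in>UNIV \<times> coords J. L u \<bullet> y = 0} + dim ((UNIV :: (real^'k) set) \<times> coords J) = DIM(real^'n)"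
  proof (rule dim_orthogonal_to_range[OF lin S])
    fix u assume u: "u \<in> UNIV \<times> coords J" and z: "L u = 0"
    have "snd (normal xb u) = 0" using u by (auto simp: normal_def coords_def vec_eq_iff)
    then show "u = 0" using z by (intro normal_injective_at_base) (simp add: L_def prod_eq_iff)
  qed
  moreover have "{y. \<forall>u\<in>UNIV \<times> coords J. L u \<bullet> y = 0} = tangent"
  proof (intro set_eqI iffI CollectI ballI)
    fix y assume *: "y \<in> {y. \<forall>u\<in>UNIV \<times> coords J. L u \<bullet> y = 0}"
    have 1: "L (axis j 1, 0) = grad (K1 j) xb" for j
      by (simp add: L_def normal_def sum_axis)
    have 2: "L (0, axis j 1) = grad (K2 j) xb" for j
      by (simp add: L_def normal_def sum_axis)
    have "L (axis j 1, 0) \<bullet> y = 0" for j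
    proof -
      have "(axis j 1, 0) \<in> UNIV \<times> coords J" by (simp add: coords_def)
      then show ?thesis using * by blast
    qed
    moreover have "L (0, axis j 1) \<bullet> y = 0" for j
    proof (cases "j \<in> J")
      case True
      then have "(0, axis j 1) \<in> UNIV \<times> coords J" by (auto simp: coords_def axis_def)
      then show ?thesis using * by blast
    next
      case False
      then show ?thesis unfolding 2 by simp
    qed
    ultimately show "y \<in> tangent" by (simp add: 1 2 tangent_def)
  next
    fix y u assume "y \<in> tangent"
    then show "L u \<bullet> y = 0"
      by (simp add: tangent_def L_def normal_def inner_add_left inner_sum_left)
  qed
  ultimately show ?thesis
    by (simp add: dim_Times_real[OF subspace_UNIV coords(1)] coords(2))
qed

section \<open>Nonsingularity and index of the smoothed problem\<close>

lemma hess_symmetric: "u \<bullet> hess x p q v = v \<bullet> hess x p q u"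
proof -
  have "u \<bullet> (hessian f x *v v) = v \<bullet> (hessian f x *v u)" by (rule C2_hessian_symmetric[OF f])
  moreover have "u \<bullet> (hessian (K1 j) x *v v) = v \<bullet> (hessian (K1 j) x *v u)" for j
    by (rule C2_hessian_symmetric[OF K1])
  moreover have "u \<bullet> (hessian (K2 j) x *v v) = v \<bullet> (hessian (K2 j) x *v u)" for j
    by (rule C2_hessian_symmetric[OF K2])
  ultimately show ?thesis
    unfolding hess_def inner_diff_right inner_sum_right inner_scaleR_right by (simp only:)
qed

lemma hess_scaleR: "hess x p q (r *\<^sub>R h) = r *\<^sub>R hess x p q h"
  by (simp add: hess_def linear_scale[OF matrix_vector_mul_linear] scaleR_diff_right
      scaleR_sum_right mult.commute)

text \<open>Tangent vectors \<open>\<xi>\<close> of the smoothed problem are described by pairs \<open>u = (\<xi>, \<phi>)\<close>. On a tangent vector,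
  \<open>p\<^sup>2 * DK1 \<xi> + q\<^sup>2 * DK2 \<xi> = 0\<close>, so there is a number \<open>\<phi> j\<close> with
  \<open>DK1 \<xi> = \<delta> * q\<^sup>2 * \<phi> j\<close> and \<open>DK2 \<xi> = - \<delta> * p\<^sup>2 * \<phi> j\<close>. The factor \<open>\<delta> = \<surd>\<epsilon>\<close> is the one
  for which the Hessian becomes a form with coefficients that are continuous at \<open>\<epsilon> = 0\<close>. The arguments are
  \<open>z = (x, p, q, \<delta>)\<close>.\<close>
definition lifted_con :: "(real^'n) \<times> (real^'k) \<times> (real^'k) \<times> real \<Rightarrow> (real^'n) \<times> (real^'k) \<Rightarrow> (real^'k) \<times> (real^'k)" where
  "lifted_con z u = ((\<chi> j. if j \<in> J
       then grad (K1 j) (fst z) \<bullet> fst u - snd (snd (snd z)) * (fst (snd (snd z)) $ j)\<^sup>2 * snd u $ j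
       else grad (K1 j) (fst z) \<bullet> fst u),
     (\<chi> j. if j \<in> J
       then grad (K2 j) (fst z) \<bullet> fst u + snd (snd (snd z)) * (fst (snd z) $ j)\<^sup>2 * snd u $ j
       else snd u $ j))"

definition lifted_form :: "(real^'n) \<times> (real^'k) \<times> (real^'k) \<times> real \<Rightarrow> (real^'n) \<times> (real^'k) \<Rightarrow> real" where
  "lifted_form z u = fst u \<bullet> hess (fst z) (fst (snd z)) (fst (snd (snd z))) (fst u)
     + (\<Sum>j\<in>J. 2 * sg j * (fst (snd z) $ j * fst (snd (snd z)) $ j) ^ 3 * (snd u $ j)\<^sup>2)"

lemma continuous_on_lifted_con: "continuous_on UNIV (\<lambda>y. lifted_con (snd y) (fst y))"
proof -
  have if_cont: "continuous_on UNIV (\<lambda>z. if j \<in> J then u z else v z)"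
    if "continuous_on UNIV u" "continuous_on UNIV v"
    for j and u v :: "((real^'n) \<times> (real^'k)) \<times> (real^'n) \<times> (real^'k) \<times> (real^'k) \<times> real \<Rightarrow> real"
    using that by (cases "j \<in> J") auto
  show ?thesis unfolding lifted_con_def
    by (intro continuous_on_Pair continuous_on_vec_lambda if_cont) (intro continuous_intros K1 K2)+
qed

lemma continuous_on_lifted_form: "continuous_on UNIV (\<lambda>y. lifted_form (snd y) (fst y))"
  unfolding lifted_form_def by (intro continuous_intros)

lemma lifted_form_scaleR: "lifted_form z (r *\<^sub>R u) = r\<^sup>2 * lifted_form z u"
  by (simp add: lifted_form_def hess_scaleR distrib_left sum_distrib_left power_mult_distrib power2_eq_square mult_ac)

lemma lifted_con_base: "lifted_con (xb, p0, q0, 0) u = 0 \<Longrightarrow> u \<in> tangent \<times> coords J"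
proof -
  assume "lifted_con (xb, p0, q0, 0) u = 0"
  then have 0: "fst (lifted_con (xb, p0, q0, 0) u) $ j = 0" "snd (lifted_con (xb, p0, q0, 0) u) $ j = 0" for j by simp_all
  have 1: "grad (K1 j) xb \<bullet> fst u = 0" "(if j \<in> J then grad (K2 j) xb \<bullet> fst u else snd u $ j) = 0" for j
    using 0[of j] by (simp_all add: lifted_con_def split: if_splits)
  have "grad (K2 j) xb \<bullet> fst u = 0" for j using 1(2)[of j] by (cases "j \<in> J") simp_all
  moreover have "snd u $ j = 0" if "j \<notin> J" for j using 1(2)[of j] that by simp
  ultimately show ?thesis using 1(1) by (simp add: tangent_def coords_def mem_Times_iff)
qed

text \<open>The Hessian of \<open>K1 * K2\<close> contributes the Hessians of \<open>K1\<close> and \<open>K2\<close> with the multipliers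
  \<open>mult1\<close> and \<open>mult2\<close>, and the mixed term \<open>- 2 * \<omega> * DK1 \<xi> * DK2 \<xi>\<close>. In the latter the factor \<open>1/\<epsilon>\<close> of
  \<open>\<omega>\<close> cancels against \<open>\<delta>\<^sup>2\<close>.\<close>
lemma hessian_eq_lifted_form:
  assumes sys: "sys \<epsilon> x p q" and \<delta>: "\<delta> > 0" "\<delta>\<^sup>2 = \<epsilon>" and pos: "\<forall>j\<in>J. p $ j > 0 \<and> q $ j > 0"
    and A: "\<And>h. A *v h = hessian f x *v h - (\<Sum>j\<in>UNIV. \<omega>_of \<epsilon> p q j *\<^sub>R (hessian (G j) x *v h))"
    and \<xi>: "\<xi> \<in> tangent_at x"
    and u: "u = (\<xi>, \<chi> j. if j \<in> J then (grad (K1 j) x \<bullet> \<xi>) / (\<delta> * (q $ j)\<^sup>2) else 0)"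
  shows "lifted_con (x, p, q, \<delta>) u = 0" and "\<xi> \<bullet> (A *v \<xi>) = lifted_form (x, p, q, \<delta>) u"
proof -
  have \<epsilon>: "\<epsilon> > 0" using \<delta> by (metis zero_less_power)
  have K1\<xi>: "grad (K1 j) x \<bullet> \<xi> = \<delta> * (q $ j)\<^sup>2 * snd u $ j" if "j \<in> J" for j
    using that \<delta>(1) bspec[OF pos that] by (simp add: u)
  have K2\<xi>: "grad (K2 j) x \<bullet> \<xi> = - (\<delta> * (p $ j)\<^sup>2 * snd u $ j)" if j: "j \<in> J" for j
  proof -
    have "grad (G j) x \<bullet> \<xi> = 0" using \<xi> by (simp add: tangent_at_def)
    then have "K2 j x * (grad (K1 j) x \<bullet> \<xi>) + K1 j x * (grad (K2 j) x \<bullet> \<xi>) = 0"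
      using j by (simp add: grad_G inner_add_left)
    then have "p $ j * q $ j * ((\<epsilon> * p $ j / q $ j) * (grad (K1 j) x \<bullet> \<xi>) + (\<epsilon> * q $ j / p $ j) * (grad (K2 j) x \<bullet> \<xi>)) = 0"
      unfolding sys_K[OF sys \<epsilon> pos j] by simp
    moreover have "a * b * ((\<epsilon> * a / b) * v + (\<epsilon> * b / a) * w) = \<epsilon> * (a\<^sup>2 * v + b\<^sup>2 * w)"
      if "a > 0 \<and> b > 0" for a b v w :: real
      using that by (simp add: field_simps power2_eq_square)
    ultimately have "\<epsilon> * ((p $ j)\<^sup>2 * (grad (K1 j) x \<bullet> \<xi>) + (q $ j)\<^sup>2 * (grad (K2 j) x \<bullet> \<xi>)) = 0"
      using bspec[OF pos j] by metis
    then have "(p $ j)\<^sup>2 * (grad (K1 j) x \<bullet> \<xi>) + (q $ j)\<^sup>2 * (grad (K2 j) x \<bullet> \<xi>) = 0"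
      using \<epsilon> by simp
    then have "(q $ j)\<^sup>2 * (grad (K2 j) x \<bullet> \<xi> + \<delta> * (p $ j)\<^sup>2 * snd u $ j) = 0"
      unfolding K1\<xi>[OF j] by (simp add: algebra_simps)
    then have "grad (K2 j) x \<bullet> \<xi> + \<delta> * (p $ j)\<^sup>2 * snd u $ j = 0" using bspec[OF pos j] by simp
    then show ?thesis by linarith
  qed
  have off: "grad (K1 j) x \<bullet> \<xi> = 0" if "j \<notin> J" for j
  proof -
    have "grad (G j) x \<bullet> \<xi> = 0" using \<xi> by (simp add: tangent_at_def)
    then show ?thesis using that by (simp add: grad_G)
  qed
  have su: "snd u $ j = 0" if "j \<notin> J" for j using that by (simp add: u)
  have fu: "fst u = \<xi>" by (simp add: u)
  show "lifted_con (x, p, q, \<delta>) u = 0"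
    using K1\<xi> K2\<xi> off su by (simp add: lifted_con_def fu vec_eq_iff zero_prod_def)
  have GJ: "\<omega>_of \<epsilon> p q j * (\<xi> \<bullet> (hessian (G j) x *v \<xi>))
      = mult1 j (p $ j) * (\<xi> \<bullet> (hessian (K1 j) x *v \<xi>)) + mult2 j (q $ j) * (\<xi> \<bullet> (hessian (K2 j) x *v \<xi>))
        - (if j \<in> J then 2 * sg j * (p $ j * q $ j) ^ 3 * (snd u $ j)\<^sup>2 else 0)" for j
  proof (cases "j \<in> J")
    case False
    then show ?thesis by (simp add: G_def \<omega>_of_def mult1_def)
  next
    case True
    have "\<xi> \<bullet> (hessian (G j) x *v \<xi>) = K2 j x * (\<xi> \<bullet> (hessian (K1 j) x *v \<xi>))
        + K1 j x * (\<xi> \<bullet> (hessian (K2 j) x *v \<xi>)) + 2 * ((grad (K1 j) x \<bullet> \<xi>) * (grad (K2 j) x \<bullet> \<xi>))"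
      using True by (simp add: G_def C2_mult(3)[OF K1 K2] inner_add_right inner_commute mult.commute)
    then have "\<omega>_of \<epsilon> p q j * (\<xi> \<bullet> (hessian (G j) x *v \<xi>))
      = (\<omega>_of \<epsilon> p q j * K2 j x) * (\<xi> \<bullet> (hessian (K1 j) x *v \<xi>))
        + (\<omega>_of \<epsilon> p q j * K1 j x) * (\<xi> \<bullet> (hessian (K2 j) x *v \<xi>))
        + 2 * \<omega>_of \<epsilon> p q j * ((grad (K1 j) x \<bullet> \<xi>) * (grad (K2 j) x \<bullet> \<xi>))"
      by (simp add: algebra_simps)
    moreover have "2 * \<omega>_of \<epsilon> p q j * ((grad (K1 j) x \<bullet> \<xi>) * (grad (K2 j) x \<bullet> \<xi>))
        = - (2 * sg j * (p $ j * q $ j) ^ 3 * (snd u $ j)\<^sup>2)"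
    proof -
      have "(grad (K1 j) x \<bullet> \<xi>) * (grad (K2 j) x \<bullet> \<xi>) = - (\<delta>\<^sup>2 * (p $ j * q $ j)\<^sup>2 * (snd u $ j)\<^sup>2)"
        unfolding K1\<xi>[OF True] K2\<xi>[OF True] by (simp add: power2_eq_square algebra_simps)
      then show ?thesis using True \<epsilon> unfolding \<delta>(2) \<omega>_of_def
        by (simp add: power2_eq_square power3_eq_cube algebra_simps)
    qed
    ultimately show ?thesis using True \<omega>_of_K[OF sys \<epsilon> pos True] by simp
  qed
  have "\<xi> \<bullet> (A *v \<xi>) = \<xi> \<bullet> (hessian f x *v \<xi>) - (\<Sum>j\<in>UNIV. \<omega>_of \<epsilon> p q j * (\<xi> \<bullet> (hessian (G j) x *v \<xi>)))"
    by (simp add: A inner_diff_right inner_sum_right)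
  also have "\<dots> = \<xi> \<bullet> hess x p q \<xi> + (\<Sum>j\<in>UNIV. if j \<in> J then 2 * sg j * (p $ j * q $ j) ^ 3 * (snd u $ j)\<^sup>2 else 0)"
    unfolding GJ hess_def inner_diff_right inner_sum_right inner_scaleR_right sum_subtractf sum.distrib by simp
  also have "\<dots> = lifted_form (x, p, q, \<delta>) u"
    by (simp add: lifted_form_def fu sum.If_cases)
  finally show "\<xi> \<bullet> (A *v \<xi>) = lifted_form (x, p, q, \<delta>) u" .
qed

text \<open>At the base point the form is a direct sum, and \<open>\<phi> j\<close> contributes with the sign of the limit
  multiplier. Both definite parts are treated at once, with \<open>s = \<plusminus>1\<close>.\<close>
lemma lifted_form_base_sign:
  assumes D: "D \<subseteq> J" and s: "\<And>j. j \<in> D \<Longrightarrow> sg j = s"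
    and P: "\<And>\<xi>. \<xi> \<in> P \<Longrightarrow> \<xi> \<noteq> 0 \<Longrightarrow> s * (\<xi> \<bullet> hess xb p0 q0 \<xi>) > 0" and ss: "s * s = 1"
    and u: "u \<in> P \<times> coords D" "u \<noteq> 0"
  shows "s * lifted_form (xb, p0, q0, 0) u > 0"
proof -
  have "s * lifted_form (xb, p0, q0, 0) u = s * (fst u \<bullet> hess xb p0 q0 (fst u))
      + (\<Sum>j\<in>J. s * (2 * sg j * (p0 $ j * q0 $ j) ^ 3 * (snd u $ j)\<^sup>2))"
    by (simp add: lifted_form_def distrib_left sum_distrib_left)
  also have "(\<Sum>j\<in>J. s * (2 * sg j * (p0 $ j * q0 $ j) ^ 3 * (snd u $ j)\<^sup>2))
      = (\<Sum>j\<in>J. 2 * (p0 $ j * q0 $ j) ^ 3 * (snd u $ j)\<^sup>2)"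
  proof (rule sum.cong)
    fix j assume "j \<in> J"
    show "s * (2 * sg j * (p0 $ j * q0 $ j) ^ 3 * (snd u $ j)\<^sup>2) = 2 * (p0 $ j * q0 $ j) ^ 3 * (snd u $ j)\<^sup>2"
    proof (cases "j \<in> D")
      case True
      have "s * (2 * sg j * (p0 $ j * q0 $ j) ^ 3 * (snd u $ j)\<^sup>2) = (s * s) * (2 * (p0 $ j * q0 $ j) ^ 3 * (snd u $ j)\<^sup>2)"
        unfolding s[OF True] by (simp only: mult_ac)
      then show ?thesis using ss by simp
    next
      case False
      then show ?thesis using u by (auto simp: coords_def)
    qed
  qed simp
  finally have eq: "s * lifted_form (xb, p0, q0, 0) u = s * (fst u \<bullet> hess xb p0 q0 (fst u))
      + (\<Sum>j\<in>J. 2 * (p0 $ j * q0 $ j) ^ 3 * (snd u $ j)\<^sup>2)" .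
  have nn: "0 \<le> 2 * (p0 $ j * q0 $ j) ^ 3 * (snd u $ j)\<^sup>2" if "j \<in> J" for j
    using p0_q0_pos[OF that] by simp
  have S: "0 \<le> (\<Sum>j\<in>J. 2 * (p0 $ j * q0 $ j) ^ 3 * (snd u $ j)\<^sup>2)" using nn by (rule sum_nonneg)
  show ?thesis
  proof (cases "fst u = 0")
    case False
    then have "s * (fst u \<bullet> hess xb p0 q0 (fst u)) > 0" using P u(1) by auto
    then show ?thesis using eq S by linarith
  next
    case True
    then have "snd u \<noteq> 0" using u(2) by (simp add: prod_eq_iff)
    then obtain j where j: "snd u $ j \<noteq> 0" by (auto simp: vec_eq_iff)
    then have jJ: "j \<in> J" using u(1) D by (auto simp: coords_def)
    have "0 < 2 * (p0 $ j * q0 $ j) ^ 3 * (snd u $ j)\<^sup>2" using j p0_q0_pos[OF jJ] by simp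
    then have "0 < (\<Sum>j\<in>J. 2 * (p0 $ j * q0 $ j) ^ 3 * (snd u $ j)\<^sup>2)"
      using nn jJ by (intro sum_pos2[of J j]) auto
    then show ?thesis using eq True by simp
  qed
qed

text \<open>The limit form has definite subspaces \<open>N'\<close> and \<open>P'\<close> whose dimensions add up to that of
  the limit space \<open>E\<close>, which is also the dimension of the perturbed tangent space. The lift is linear and
  injective, so semicontinuity bounds the nonpositive and nonnegative subspaces of the
  perturbed Hessian by \<open>dim N'\<close> and \<open>dim P'\<close>.\<close>
lemma index_near_base:
  assumes A: "\<And>h. A *v h = hess xb p0 q0 h" and ns: "restricted_nonsingular A tangent"
  shows "\<exists>Z. open Z \<and> (xb, p0, q0, 0) \<in> Z \<and> (\<forall>x p q \<delta> A'. (x, p, q, \<delta>) \<in> Z \<longrightarrow> \<delta> > 0 \<longrightarrow> sys (\<delta>\<^sup>2) x p q \<longrightarrow>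
      (\<forall>j\<in>J. p $ j > 0 \<and> q $ j > 0) \<longrightarrow>
      (\<forall>c. (\<Sum>j\<in>UNIV. c j *\<^sub>R grad (G j) x) = 0 \<longrightarrow> (\<forall>j. c j = 0)) \<longrightarrow>
      (\<forall>h. A' *v h = hessian f x *v h - (\<Sum>j\<in>UNIV. \<omega>_of (\<delta>\<^sup>2) p q j *\<^sub>R (hessian (G j) x *v h))) \<longrightarrow>
      restricted_nonsingular A' (tangent_at x) \<and>
      num_negative_eigenvalues A' (tangent_at x) = num_negative_eigenvalues A tangent + card {j \<in> J. m1 j < 0})"
proof -
  have "u \<bullet> (A *v v) = v \<bullet> (A *v u)" for u v unfolding A by (rule hess_symmetric)
  from definite_subspaces_of_nonsingular[OF this subspace_tangent ns]
  obtain N P where NP: "subspace N" "subspace P" "N \<subseteq> tangent" "P \<subseteq> tangent"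
      "dim N = num_negative_eigenvalues A tangent" "dim N + dim P = dim tangent"
    and Nneg: "\<forall>x\<in>N - {0}. x \<bullet> (A *v x) < 0" and Ppos: "\<forall>x\<in>P - {0}. x \<bullet> (A *v x) > 0"
    by (elim exE conjE)
  define Jn Jp where "Jn = {j \<in> J. m1 j < 0}" and "Jp = {j \<in> J. m1 j > 0}"
  have Jn: "Jn \<subseteq> J" "\<And>j. j \<in> Jn \<Longrightarrow> sg j = -1" and Jp: "Jp \<subseteq> J" "\<And>j. j \<in> Jp \<Longrightarrow> sg j = 1"
    by (auto simp: Jn_def Jp_def sg_def)
  have "m1 j \<noteq> 0" if "j \<in> J" for j using same_sign[OF that] by auto
  then have "J = Jn \<union> Jp" by (auto simp: Jn_def Jp_def less_le)
  moreover have "Jn \<inter> Jp = {}" by (auto simp: Jn_def Jp_def)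
  ultimately have cardJ: "card J = card Jn + card Jp" by (simp add: card_Un_disjoint)
  define E where "E = tangent \<times> coords J"
  have E: "subspace E" "dim E = dim tangent + card J"
    unfolding E_def by (intro subspace_Times subspace_tangent coords)
      (simp add: dim_Times_real[OF subspace_tangent coords(1)] coords(2))
  have mono: "coords Jn \<subseteq> coords J" "coords Jp \<subseteq> coords J"
    using Jn(1) Jp(1) unfolding coords_def by blast+
  define N' P' where "N' = N \<times> coords Jn" and "P' = P \<times> coords Jp"
  have N': "subspace N'" "N' \<subseteq> E" "dim N' = dim N + card Jn"
    unfolding N'_def E_def coords(2)[symmetric]
    by (intro subspace_Times coords NP, intro Sigma_mono NP mono, intro dim_Times_real NP coords)
  have P': "subspace P'" "P' \<subseteq> E" "dim P' = dim P + card Jp"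
    unfolding P'_def E_def coords(2)[symmetric]
    by (intro subspace_Times coords NP, intro Sigma_mono NP mono, intro dim_Times_real NP coords)
  let ?b = "(xb, p0, q0, 0)"
  have conE: "{u. lifted_con ?b u = 0} \<subseteq> E" unfolding E_def using lifted_con_base by blast
  have posP: "\<forall>u\<in>P' - {0}. lifted_form ?b u > 0"
    using lifted_form_base_sign[of Jp 1 P] Jp Ppos by (simp add: P'_def A)
  have posN: "\<forall>u\<in>N' - {0}. - lifted_form ?b u > 0"
    using lifted_form_base_sign[of Jn "-1" N] Jn Nneg by (simp add: N'_def A)
  from nonpositive_subspace_dim_semicontinuous[OF continuous_on_lifted_con continuous_on_lifted_form lifted_form_scaleR E(1) conE P'(1,2) posP]
  obtain Z1 where Z1: "open Z1" "?b \<in> Z1"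
    and Z1': "\<forall>z\<in>Z1. \<forall>W. subspace W \<longrightarrow> (\<forall>u\<in>W. lifted_con z u = 0 \<and> lifted_form z u \<le> 0) \<longrightarrow> dim W + dim P' \<le> dim E"
    by (elim exE conjE)
  have cN: "continuous_on UNIV (\<lambda>y. - lifted_form (snd y) (fst y))" by (intro continuous_intros continuous_on_lifted_form)
  have sN: "- lifted_form z (r *\<^sub>R u) = r\<^sup>2 * (- lifted_form z u)" for z r u by (simp add: lifted_form_scaleR)
  from nonpositive_subspace_dim_semicontinuous[OF continuous_on_lifted_con cN sN E(1) conE N'(1,2) posN]
  obtain Z2 where Z2: "open Z2" "?b \<in> Z2"
    and Z2': "\<forall>z\<in>Z2. \<forall>W. subspace W \<longrightarrow> (\<forall>u\<in>W. lifted_con z u = 0 \<and> - lifted_form z u \<le> 0) \<longrightarrow> dim W + dim N' \<le> dim E"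
    by (elim exE conjE)
  show ?thesis
  proof (intro exI[of _ "Z1 \<inter> Z2"] conjI allI impI)
    show "open (Z1 \<inter> Z2)" using Z1(1) Z2(1) by (rule open_Int)
    show "?b \<in> Z1 \<inter> Z2" using Z1(2) Z2(2) by (rule IntI)
    fix x p q \<delta> A'
    assume z: "(x, p, q, \<delta>) \<in> Z1 \<inter> Z2" and \<delta>: "\<delta> > 0" and sys: "sys (\<delta>\<^sup>2) x p q"
      and pos: "\<forall>j\<in>J. p $ j > 0 \<and> q $ j > 0"
      and licq_G: "\<forall>c. (\<Sum>j\<in>UNIV. c j *\<^sub>R grad (G j) x) = 0 \<longrightarrow> (\<forall>j. c j = 0)"
      and A'0: "\<forall>h. A' *v h = hessian f x *v h - (\<Sum>j\<in>UNIV. \<omega>_of (\<delta>\<^sup>2) p q j *\<^sub>R (hessian (G j) x *v h))"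
    note A' = spec[OF A'0]
    define l where "l = (\<lambda>\<xi>. (\<xi>, \<chi> j. if j \<in> J then (grad (K1 j) x \<bullet> \<xi>) / (\<delta> * (q $ j)\<^sup>2) else (0::real)))"
    have l: "lifted_con (x, p, q, \<delta>) (l \<xi>) = 0" "\<xi> \<bullet> (A' *v \<xi>) = lifted_form (x, p, q, \<delta>) (l \<xi>)"
      if \<xi>: "\<xi> \<in> tangent_at x" for \<xi>
      by (rule hessian_eq_lifted_form[OF sys \<delta> refl pos A' \<xi>]; simp add: l_def)+
    have lin: "linear l"
      by (rule linearI) (auto simp: l_def vec_eq_iff inner_add_right add_divide_distrib)
    have dl: "dim (l ` W) = dim W" for W
      by (rule dim_image_eq[OF lin]) (auto simp: inj_on_def l_def)
    have sl: "subspace (l ` W)" if "subspace W" for W using linear_subspace_image[OF lin that] .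
    have dimT: "dim (tangent_at x) + card (UNIV :: 'k set) = CARD('n)" by (rule dim_tangent_at[OF licq_G])
    have dims: "dim N' + dim P' = dim E" "dim E = dim (tangent_at x)"
      using N'(3) P'(3) E(2) cardJ NP(6) dimT dim_tangent by linarith+
    have sym: "u \<bullet> (A' *v v) = v \<bullet> (A' *v u)" for u v
    proof -
      have "u \<bullet> (hessian f x *v v) = v \<bullet> (hessian f x *v u)" by (rule C2_hessian_symmetric[OF f])
      moreover have "u \<bullet> (hessian (G j) x *v v) = v \<bullet> (hessian (G j) x *v u)" for j
        by (rule C2_hessian_symmetric[OF G])
      ultimately show ?thesis
        unfolding A' inner_diff_right inner_sum_right inner_scaleR_right by (simp only:)
    qed
    have "restricted_nonsingular A' (tangent_at x) \<and> num_negative_eigenvalues A' (tangent_at x) = dim N'"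
    proof (rule nonsingular_and_index_of_dim_bounds[OF sym subspace_tangent_at])
      fix W assume W: "subspace W" "W \<subseteq> tangent_at x" and neg: "\<And>y. y \<in> W \<Longrightarrow> y \<bullet> (A' *v y) \<le> 0"
      have "dim (l ` W) + dim P' \<le> dim E"
      proof (rule Z1'[rule_format, OF _ sl[OF W(1)]])
        show "(x, p, q, \<delta>) \<in> Z1" using z by blast
        fix u assume "u \<in> l ` W"
        then obtain \<xi> where \<xi>: "\<xi> \<in> W" "u = l \<xi>" by blast
        then show "lifted_con (x, p, q, \<delta>) u = 0 \<and> lifted_form (x, p, q, \<delta>) u \<le> 0"
          using l[of \<xi>] neg[of \<xi>] W(2) by auto
      qed
      then show "dim W \<le> dim N'" using dl dims by simp
    next
      fix W assume W: "subspace W" "W \<subseteq> tangent_at x" and ge: "\<And>y. y \<in> W \<Longrightarrow> y \<bullet> (A' *v y) \<ge> 0"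
      have "dim (l ` W) + dim N' \<le> dim E"
      proof (rule Z2'[rule_format, OF _ sl[OF W(1)]])
        show "(x, p, q, \<delta>) \<in> Z2" using z by blast
        fix u assume "u \<in> l ` W"
        then obtain \<xi> where \<xi>: "\<xi> \<in> W" "u = l \<xi>" by blast
        then show "lifted_con (x, p, q, \<delta>) u = 0 \<and> - lifted_form (x, p, q, \<delta>) u \<le> 0"
          using l[of \<xi>] ge[of \<xi>] W(2) by auto
      qed
      then show "dim W \<le> dim P'" using dl dims by simp
    qed (use dims in simp)
    then show "restricted_nonsingular A' (tangent_at x)"
      "num_negative_eigenvalues A' (tangent_at x) = num_negative_eigenvalues A tangent + card {j \<in> J. m1 j < 0}"
      using N'(3) NP(5) unfolding Jn_def by simp_all
  qed
qed

text \<open>The neighbourhood \<open>V\<close> on which uniqueness holds is fixed before \<open>U\<close> and \<open>t\<close>, whereas the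
  solution for the parameter \<open>t\<close> is found in an arbitrarily small \<open>U\<close>.\<close>
lemma unique_nondegenerate_kkt_near_base:
  assumes A: "\<And>h. A *v h = hess xb p0 q0 h" and ns: "restricted_nonsingular A tangent"
  shows "\<exists>V. open V \<and> xb \<in> V \<and> (\<forall>U. open U \<longrightarrow> xb \<in> U \<longrightarrow> (\<exists>t0>0. \<forall>t. 0 < t \<and> t < t0 \<longrightarrow>
    (\<exists>x\<in>U. \<exists>\<omega>. kkt t x \<omega> \<and>
      (\<forall>c. (\<Sum>j\<in>UNIV. c j *\<^sub>R grad (G j) x) = 0 \<longrightarrow> (\<forall>j. c j = 0)) \<and>
      (\<forall>A'. (\<forall>h. A' *v h = hessian f x *v h - (\<Sum>j\<in>UNIV. \<omega> j *\<^sub>R (hessian (G j) x *v h))) \<longrightarrow>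
        restricted_nonsingular A' (tangent_at x) \<and>
        num_negative_eigenvalues A' (tangent_at x) = num_negative_eigenvalues A tangent + card {j \<in> J. m1 j < 0}) \<and>
      (\<forall>y\<in>V. \<forall>\<omega>'. kkt t y \<omega>' \<longrightarrow> y = x))))"
proof -
  from sys_branch[OF A ns] obtain N e where N: "open N" "(xb, p0, q0) \<in> N" and e: "e > 0"
    and uniq: "\<forall>\<epsilon> x p q x' p' q'. \<bar>\<epsilon>\<bar> < e \<longrightarrow> (x, p, q) \<in> N \<longrightarrow> (x', p', q') \<in> N \<longrightarrow>
       sys \<epsilon> x p q \<longrightarrow> sys \<epsilon> x' p' q' \<longrightarrow> x = x'"
    and exist: "\<forall>M. open M \<longrightarrow> (xb, p0, q0) \<in> M \<longrightarrow>
       (\<exists>e'>0. \<forall>\<epsilon>. \<bar>\<epsilon>\<bar> < e' \<longrightarrow> (\<exists>x p q. (x, p, q) \<in> M \<and> sys \<epsilon> x p q))"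
    by (elim exE conjE)
  from kkt_near_base[OF N] obtain V where V: "open V" "xb \<in> V"
    and near: "\<forall>x\<in>V. \<forall>t \<omega>. t > 0 \<longrightarrow> kkt t x \<omega> \<longrightarrow> (\<exists>p q. (x, p, q) \<in> N \<and> sys (sqrt t) x p q)"
    and inj: "\<forall>x\<in>V. \<forall>u. normal x u = 0 \<longrightarrow> u = 0"
    by (elim exE conjE)
  from index_near_base[OF A ns] obtain Z where Z: "open Z" "(xb, p0, q0, 0) \<in> Z"
    and index: "\<forall>x p q \<delta> A'. (x, p, q, \<delta>) \<in> Z \<longrightarrow> \<delta> > 0 \<longrightarrow> sys (\<delta>\<^sup>2) x p q \<longrightarrow>
      (\<forall>j\<in>J. p $ j > 0 \<and> q $ j > 0) \<longrightarrow>
      (\<forall>c. (\<Sum>j\<in>UNIV. c j *\<^sub>R grad (G j) x) = 0 \<longrightarrow> (\<forall>j. c j = 0)) \<longrightarrow>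
      (\<forall>h. A' *v h = hessian f x *v h - (\<Sum>j\<in>UNIV. \<omega>_of (\<delta>\<^sup>2) p q j *\<^sub>R (hessian (G j) x *v h))) \<longrightarrow>
      restricted_nonsingular A' (tangent_at x) \<and>
      num_negative_eigenvalues A' (tangent_at x) = num_negative_eigenvalues A tangent + card {j \<in> J. m1 j < 0}"
    by (elim exE conjE)
  have "continuous_on UNIV (\<lambda>w::((real^'n) \<times> (real^'k) \<times> (real^'k)) \<times> real. (fst (fst w), fst (snd (fst w)), snd (snd (fst w)), snd w))"
    by (intro continuous_intros)
  from open_vimage[OF Z(1) this]
  have "open {w. (fst (fst w), fst (snd (fst w)), snd (snd (fst w)), snd w) \<in> Z}"
    unfolding vimage_def .
  moreover have "((xb, p0, q0), 0) \<in> {w. (fst (fst w), fst (snd (fst w)), snd (snd (fst w)), snd w) \<in> Z}"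
    using Z by simp
  ultimately obtain M I where MI: "open M" "open I" "((xb, p0, q0), 0) \<in> M \<times> I"
      "M \<times> I \<subseteq> {w. (fst (fst w), fst (snd (fst w)), snd (snd (fst w)), snd w) \<in> Z}"
    by (rule open_prod_elim)
  have "0 \<in> I" using MI(3) by simp
  then obtain d where d: "d > 0" "ball 0 d \<subseteq> I" using MI(2) open_contains_ball by blast
  have inZ: "(x, p, q, \<delta>) \<in> Z" if "(x, p, q) \<in> M" "\<bar>\<delta>\<bar> < d" for x p q \<delta>
  proof -
    have "\<delta> \<in> I" using that(2) by (intro subsetD[OF d(2)]) simp
    then have "((x, p, q), \<delta>) \<in> M \<times> I" using that(1) by simp
    from subsetD[OF MI(4) this] show ?thesis by simp
  qed
  show ?thesis
  proof (intro exI[of _ V] conjI allI impI)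
    show "open V" "xb \<in> V" by (fact V)+
    fix U assume U: "open U" "xb \<in> U"
    \<comment> \<open>A solution in this set lies in \<open>U\<close>, is close enough for uniqueness and for the index, and has
      positive \<open>p\<close> and \<open>q\<close>.\<close>
    define M' where "M' = N \<inter> M \<inter> ((U \<inter> V) \<times> UNIV) \<inter>
      (\<Inter>j\<in>J. {w. 0 < fst (snd w) $ j} \<inter> {w. 0 < snd (snd w) $ j})"
    have "open M'" unfolding M'_def
      by (intro open_Int N MI open_Times U V open_UNIV open_INT finite ballI open_Collect_less continuous_intros)
    moreover have "(xb, p0, q0) \<in> M'" unfolding M'_def using N(2) MI(3) U(2) V(2) p0_q0_pos by simp
    ultimately obtain e' where e': "e' > 0"
      and sol: "\<forall>\<epsilon>. \<bar>\<epsilon>\<bar> < e' \<longrightarrow> (\<exists>x p q. (x, p, q) \<in> M' \<and> sys \<epsilon> x p q)"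
      using spec[OF exist, of M'] by (elim impE exE conjE) 
    \<comment> \<open>The square is there because \<open>\<delta> < d\<close> is needed for \<open>\<delta> = \<surd>\<epsilon>\<close>.\<close>
    define r where "r = min e (min e' (d\<^sup>2))"
    have r: "r > 0" using e e' d(1) by (simp add: r_def)
    show "\<exists>t0>0. \<forall>t. 0 < t \<and> t < t0 \<longrightarrow>
      (\<exists>x\<in>U. \<exists>\<omega>. kkt t x \<omega> \<and>
      (\<forall>c. (\<Sum>j\<in>UNIV. c j *\<^sub>R grad (G j) x) = 0 \<longrightarrow> (\<forall>j. c j = 0)) \<and>
      (\<forall>A'. (\<forall>h. A' *v h = hessian f x *v h - (\<Sum>j\<in>UNIV. \<omega> j *\<^sub>R (hessian (G j) x *v h))) \<longrightarrow>
        restricted_nonsingular A' (tangent_at x) \<and>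
        num_negative_eigenvalues A' (tangent_at x) = num_negative_eigenvalues A tangent + card {j \<in> J. m1 j < 0}) \<and>
      (\<forall>y\<in>V. \<forall>\<omega>'. kkt t y \<omega>' \<longrightarrow> y = x))"
    proof (intro exI[of _ "r\<^sup>2"] conjI allI impI)
      show "0 < r\<^sup>2" using r by simp
      fix t assume t: "0 < t \<and> t < r\<^sup>2"
      define \<epsilon> where "\<epsilon> = sqrt t"
      define \<delta> where "\<delta> = sqrt \<epsilon>"
      have \<epsilon>0: "\<epsilon> > 0" using t by (simp add: \<epsilon>_def)
      have \<delta>0: "\<delta> > 0" using \<epsilon>0 by (simp add: \<delta>_def)
      have sq: "\<epsilon>\<^sup>2 = t" "\<delta>\<^sup>2 = \<epsilon>" using t \<epsilon>0 by (simp_all add: \<epsilon>_def \<delta>_def)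
      have "\<epsilon> < r" using t r unfolding \<epsilon>_def by (metis real_sqrt_less_iff real_sqrt_unique less_imp_le)
      then have \<epsilon>: "\<bar>\<epsilon>\<bar> < e" "\<bar>\<epsilon>\<bar> < e'" "\<epsilon> < d\<^sup>2" using \<epsilon>0 by (simp_all add: r_def)
      have "\<delta> < d" using \<epsilon>(3) d(1) unfolding \<delta>_def by (metis real_sqrt_less_iff real_sqrt_unique less_imp_le)
      then have \<delta>: "\<bar>\<delta>\<bar> < d" using \<delta>0 by simp
      from sol \<epsilon>(2) obtain x p q where xpq: "(x, p, q) \<in> M'" and sys: "sys \<epsilon> x p q" by blast
      have mem: "(x, p, q) \<in> N" "(x, p, q) \<in> M" "x \<in> U" "x \<in> V"
        and pos: "\<forall>j\<in>J. p $ j > 0 \<and> q $ j > 0"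
        using xpq unfolding M'_def by simp_all
      have kkt: "kkt t x (\<omega>_of \<epsilon> p q)" using kkt_of_sys[OF sys \<epsilon>0 pos] sq(1) by simp
      have licq_x: "\<forall>c. (\<Sum>j\<in>UNIV. c j *\<^sub>R grad (G j) x) = 0 \<longrightarrow> (\<forall>j. c j = 0)"
      proof (intro allI impI)
        fix c j assume c: "(\<Sum>j\<in>UNIV. c j *\<^sub>R grad (G j) x) = 0"
        show "c j = 0"
        proof (rule licq_G[OF _ _ c])
          show "u = 0" if "normal x u = 0" for u using inj mem(4) that by blast
          show "K2 j x > 0" if "j \<in> J" for j using sys_K_pos[OF sys \<epsilon>0 pos that] by blast
        qed
      qed
      show "\<exists>x\<in>U. \<exists>\<omega>. kkt t x \<omega> \<and>
        (\<forall>c. (\<Sum>j\<in>UNIV. c j *\<^sub>R grad (G j) x) = 0 \<longrightarrow> (\<forall>j. c j = 0)) \<and>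
        (\<forall>A'. (\<forall>h. A' *v h = hessian f x *v h - (\<Sum>j\<in>UNIV. \<omega> j *\<^sub>R (hessian (G j) x *v h))) \<longrightarrow>
          restricted_nonsingular A' (tangent_at x) \<and>
          num_negative_eigenvalues A' (tangent_at x) = num_negative_eigenvalues A tangent + card {j \<in> J. m1 j < 0}) \<and>
        (\<forall>y\<in>V. \<forall>\<omega>'. kkt t y \<omega>' \<longrightarrow> y = x)"
      proof (rule bexI[OF _ mem(3)], rule exI[of _ "\<omega>_of \<epsilon> p q"], intro conjI)
        show "kkt t x (\<omega>_of \<epsilon> p q)" by (fact kkt)
        show "\<forall>c. (\<Sum>j\<in>UNIV. c j *\<^sub>R grad (G j) x) = 0 \<longrightarrow> (\<forall>j. c j = 0)" by (fact licq_x)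
        show "\<forall>A'. (\<forall>h. A' *v h = hessian f x *v h - (\<Sum>j\<in>UNIV. \<omega>_of \<epsilon> p q j *\<^sub>R (hessian (G j) x *v h))) \<longrightarrow>
          restricted_nonsingular A' (tangent_at x) \<and>
          num_negative_eigenvalues A' (tangent_at x) = num_negative_eigenvalues A tangent + card {j \<in> J. m1 j < 0}"
          using index[rule_format, OF inZ[OF mem(2) \<delta>] \<delta>0, unfolded sq(2), OF sys] pos licq_x by simp
        show "\<forall>y\<in>V. \<forall>\<omega>'. kkt t y \<omega>' \<longrightarrow> y = x"
        proof (intro ballI allI impI)
          fix y \<omega>' assume y: "y \<in> V" "kkt t y \<omega>'"
          then obtain p' q' where y': "(y, p', q') \<in> N" "sys \<epsilon> y p' q'"
            using near t unfolding \<epsilon>_def by blast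
          show "y = x" using uniq[rule_format, OF \<epsilon>(1) y'(1) mem(1) y'(2) sys] .
        qed
      qed
    qed
  qed
qed

end

section \<open>Nondegenerate C-stationary points\<close>

text \<open>For \<open>j\<close> in \<open>a01\<close> or \<open>a10\<close> the product \<open>F1 j * F2 j\<close> is the regular constraint: at \<open>xb\<close> its
  gradient is the gradient of the active factor, scaled by the value of the positive factor. This
  explains the division in the multiplier \<open>\<mu>1\<close> below.\<close>
locale nondegenerate_mpcc_point =
  fixes f :: "real^'n \<Rightarrow> real" and F1 F2 :: "real^'n \<Rightarrow> real^'k"
    and xb :: "real^'n" and \<sigma>1 \<sigma>2 \<rho>1 \<rho>2 :: "'k \<Rightarrow> real"
  assumes C2_f: "C2 f" and C2_F1: "C2_vec F1" and C2_F2: "C2_vec F2"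
    and nondeg: "nondegenerate_C_stationary f F1 F2 xb \<sigma>1 \<sigma>2 \<rho>1 \<rho>2"
begin

abbreviation "I01 \<equiv> a01 F1 F2 xb"
abbreviation "I10 \<equiv> a10 F1 F2 xb"
abbreviation "I00 \<equiv> a00 F1 F2 xb"
abbreviation "g1 j \<equiv> grad (\<lambda>x. F1 x $ j)"
abbreviation "g2 j \<equiv> grad (\<lambda>x. F2 x $ j)"
abbreviation "H1 j \<equiv> hessian (\<lambda>x. F1 x $ j)"
abbreviation "H2 j \<equiv> hessian (\<lambda>x. F2 x $ j)"
abbreviation "prd j \<equiv> \<lambda>x. F1 x $ j * F2 x $ j"

definition "\<kappa>1 j = (if j \<in> I00 then (\<lambda>x. F1 x $ j) else prd j)"
definition "\<kappa>2 j = (if j \<in> I00 then (\<lambda>x. F2 x $ j) else (\<lambda>x. 0))"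
definition "\<mu>1 j = (if j \<in> I00 then \<rho>1 j else if j \<in> I01 then \<sigma>1 j / F2 xb $ j else \<sigma>2 j / F1 xb $ j)"
definition "\<mu>2 j = (if j \<in> I00 then \<rho>2 j else 0)"

lemma C2_comp: "C2 (\<lambda>x. F1 x $ j)" "C2 (\<lambda>x. F2 x $ j)"
  using C2_F1 C2_F2 by (simp_all add: C2_vec_def)

lemma index_cases:
  obtains "j \<in> I00" "F1 xb $ j = 0" "F2 xb $ j = 0" "j \<notin> I01" "j \<notin> I10"
  | "j \<in> I01" "F1 xb $ j = 0" "F2 xb $ j > 0" "j \<notin> I00" "j \<notin> I10"
  | "j \<in> I10" "F1 xb $ j > 0" "F2 xb $ j = 0" "j \<notin> I00" "j \<notin> I01"
proof -
  have "F1 xb $ j * F2 xb $ j = 0 \<and> F1 xb $ j \<ge> 0 \<and> F2 xb $ j \<ge> 0"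
    using nondeg by (auto simp: nondegenerate_C_stationary_def C_stationary_def mpcc_feasible_def)
  then have "(F1 xb $ j = 0 \<and> F2 xb $ j = 0) \<or> (F1 xb $ j = 0 \<and> F2 xb $ j > 0) \<or> (F1 xb $ j > 0 \<and> F2 xb $ j = 0)"
    by (auto simp: less_le)
  then show thesis using that by (auto simp: a00_def a01_def a10_def)
qed

lemma sum_split: "(\<Sum>j\<in>UNIV. h j) = (\<Sum>j\<in>I01. h j) + (\<Sum>j\<in>I10. h j) + (\<Sum>j\<in>I00. h j)"
  for h :: "'k \<Rightarrow> 'b::comm_monoid_add"
proof -
  have U: "UNIV = I01 \<union> I10 \<union> I00"
  proof (intro set_eqI iffI UNIV_I)
    show "j \<in> I01 \<union> I10 \<union> I00" for j by (cases j rule: index_cases) simp_all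
  qed
  have "I01 \<inter> I10 = {}" "(I01 \<union> I10) \<inter> I00 = {}"
    by (auto simp: a00_def a01_def a10_def)
  then show ?thesis
    unfolding U by (simp only: sum.union_disjoint[OF finite finite])
qed

lemma grad_prd: "grad (prd j) x = smoothing_grad F1 F2 x j"
  using C2_mult(2)[OF C2_comp] by (simp add: smoothing_grad_def)

lemma C2_prd: "C2 (prd j)"
  by (rule C2_mult(1)[OF C2_comp])

lemma stationary_xb: "grad f xb = (\<Sum>j\<in>I01. \<sigma>1 j *\<^sub>R g1 j xb) + (\<Sum>j\<in>I10. \<sigma>2 j *\<^sub>R g2 j xb)
     + (\<Sum>j\<in>I00. \<rho>1 j *\<^sub>R g1 j xb + \<rho>2 j *\<^sub>R g2 j xb)"
  using nondeg by (simp add: nondegenerate_C_stationary_def C_stationary_def)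

lemma \<rho>_pos: "j \<in> I00 \<Longrightarrow> \<rho>1 j * \<rho>2 j > 0"
  using nondeg by (simp add: nondegenerate_C_stationary_def)

lemma grad_\<kappa>1: "grad (\<kappa>1 j) xb = (if j \<in> I00 then g1 j xb else F2 xb $ j *\<^sub>R g1 j xb + F1 xb $ j *\<^sub>R g2 j xb)"
  by (simp add: \<kappa>1_def grad_prd smoothing_grad_def)

lemma grad_\<kappa>2: "grad (\<kappa>2 j) xb = (if j \<in> I00 then g2 j xb else 0)"
  by (simp add: \<kappa>2_def grad_const)

lemma licq_coefficients:
  assumes "(\<Sum>j\<in>I01 \<union> I00. a j *\<^sub>R g1 j xb) + (\<Sum>j\<in>I10 \<union> I00. b j *\<^sub>R g2 j xb) = 0"
  shows "j \<in> I01 \<union> I00 \<Longrightarrow> a j = 0" and "j \<in> I10 \<union> I00 \<Longrightarrow> b j = 0"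
proof -
  have "mpcc_licq F1 F2 xb" using nondeg by (simp add: nondegenerate_C_stationary_def)
  then have *: "\<forall>c. (\<Sum>i\<in>(I01 \<union> I00) <+> (I10 \<union> I00). c i *\<^sub>R case_sum (\<lambda>j. g1 j xb) (\<lambda>j. g2 j xb) i) = 0 \<longrightarrow>
      (\<forall>i\<in>(I01 \<union> I00) <+> (I10 \<union> I00). c i = 0)"
    unfolding mpcc_licq_def by (subst (asm) independent_family_iff) simp_all
  have "(\<Sum>i\<in>(I01 \<union> I00) <+> (I10 \<union> I00). case_sum a b i *\<^sub>R case_sum (\<lambda>j. g1 j xb) (\<lambda>j. g2 j xb) i) = 0"
    using assms by (simp add: sum.Plus)
  with * have all: "\<forall>i\<in>(I01 \<union> I00) <+> (I10 \<union> I00). case_sum a b i = 0" by blast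
  show "a j = 0" if "j \<in> I01 \<union> I00" using bspec[OF all InlI[OF that]] by simp
  show "b j = 0" if "j \<in> I10 \<union> I00" using bspec[OF all InrI[OF that]] by simp
qed

sublocale core: mixed_smoothing f \<kappa>1 \<kappa>2 I00 xb \<mu>1 \<mu>2
proof
  show "C2 f" by (fact C2_f)
  show "C2 (\<kappa>1 j)" for j by (simp add: \<kappa>1_def C2_comp C2_prd)
  show "C2 (\<kappa>2 j)" for j by (simp add: \<kappa>2_def C2_comp C2_const)
  show "\<kappa>1 j xb = 0" for j by (cases j rule: index_cases) (simp_all add: \<kappa>1_def)
  show "j \<in> I00 \<Longrightarrow> \<kappa>2 j xb = 0" for j by (simp add: \<kappa>2_def a00_def)
  show "j \<notin> I00 \<Longrightarrow> \<kappa>2 j = (\<lambda>x. 0)" for j by (simp add: \<kappa>2_def)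
  show "j \<in> I00 \<Longrightarrow> 0 < \<mu>1 j * \<mu>2 j" for j by (simp add: \<mu>1_def \<mu>2_def \<rho>_pos)
  have "\<sigma>1 j *\<^sub>R g1 j xb = \<mu>1 j *\<^sub>R grad (\<kappa>1 j) xb + \<mu>2 j *\<^sub>R grad (\<kappa>2 j) xb" if "j \<in> I01" for j
    using that by (cases j rule: index_cases) (simp_all add: grad_\<kappa>1 grad_\<kappa>2 \<mu>1_def \<mu>2_def)
  moreover have "\<sigma>2 j *\<^sub>R g2 j xb = \<mu>1 j *\<^sub>R grad (\<kappa>1 j) xb + \<mu>2 j *\<^sub>R grad (\<kappa>2 j) xb" if "j \<in> I10" for j
    using that by (cases j rule: index_cases) (simp_all add: grad_\<kappa>1 grad_\<kappa>2 \<mu>1_def \<mu>2_def)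
  moreover have "\<rho>1 j *\<^sub>R g1 j xb + \<rho>2 j *\<^sub>R g2 j xb = \<mu>1 j *\<^sub>R grad (\<kappa>1 j) xb + \<mu>2 j *\<^sub>R grad (\<kappa>2 j) xb"
    if "j \<in> I00" for j
    using that by (simp add: grad_\<kappa>1 grad_\<kappa>2 \<mu>1_def \<mu>2_def)
  ultimately have "grad f xb = (\<Sum>j\<in>UNIV. \<mu>1 j *\<^sub>R grad (\<kappa>1 j) xb + \<mu>2 j *\<^sub>R grad (\<kappa>2 j) xb)"
    unfolding stationary_xb sum_split by simp
  then show "grad f xb = (\<Sum>j\<in>UNIV. \<mu>1 j *\<^sub>R grad (\<kappa>1 j) xb) + (\<Sum>j\<in>UNIV. \<mu>2 j *\<^sub>R grad (\<kappa>2 j) xb)"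
    by (simp add: sum.distrib)
  show "a = 0 \<and> b = 0"
    if off: "\<And>j. j \<notin> I00 \<Longrightarrow> b $ j = 0"
      and z: "(\<Sum>j\<in>UNIV. a $ j *\<^sub>R grad (\<kappa>1 j) xb) + (\<Sum>j\<in>UNIV. b $ j *\<^sub>R grad (\<kappa>2 j) xb) = 0"
    for a b :: "real^'k"
  proof -
    define c where "c j = (if j \<in> I00 then a $ j else a $ j * F2 xb $ j)" for j
    define d where "d j = (if j \<in> I00 then b $ j else a $ j * F1 xb $ j)" for j
    have 1: "a $ j *\<^sub>R grad (\<kappa>1 j) xb + b $ j *\<^sub>R grad (\<kappa>2 j) xb = c j *\<^sub>R g1 j xb + d j *\<^sub>R g2 j xb" for j
      by (simp add: c_def d_def grad_\<kappa>1 grad_\<kappa>2 scaleR_right_distrib)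
    have c0: "c j = 0" if "j \<in> I10" for j using that by (cases j rule: index_cases) (simp_all add: c_def)
    have d0: "d j = 0" if "j \<in> I01" for j using that by (cases j rule: index_cases) (simp_all add: d_def)
    have "I01 \<inter> I00 = {}" "I10 \<inter> I00 = {}" by (auto simp: a00_def a01_def a10_def)
    then have "(\<Sum>j\<in>I01 \<union> I00. c j *\<^sub>R g1 j xb) + (\<Sum>j\<in>I10 \<union> I00. d j *\<^sub>R g2 j xb)
        = (\<Sum>j\<in>UNIV. c j *\<^sub>R g1 j xb + d j *\<^sub>R g2 j xb)"
      unfolding sum_split by (simp add: sum.union_disjoint c0 d0 sum.distrib)
    also have "\<dots> = 0" using z unfolding 1[symmetric] by (simp add: sum.distrib)
    finally have cd: "(\<Sum>j\<in>I01 \<union> I00. c j *\<^sub>R g1 j xb) + (\<Sum>j\<in>I10 \<union> I00. d j *\<^sub>R g2 j xb) = 0" .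
    have "a $ j = 0 \<and> b $ j = 0" for j
    proof (cases j rule: index_cases)
      case 1 then show ?thesis using licq_coefficients[OF cd, of j] by (simp add: c_def d_def)
    next
      case 2 then show ?thesis using licq_coefficients(1)[OF cd, of j] off[of j] by (simp add: c_def)
    next
      case 3 then show ?thesis using licq_coefficients(2)[OF cd, of j] off[of j] by (simp add: d_def)
    qed
    then show ?thesis by (simp add: vec_eq_iff)
  qed
qed

lemma tangent_eq: "core.tangent = mpcc_tangent F1 F2 xb"
proof -
  have "(grad (\<kappa>1 j) xb \<bullet> \<xi> = 0 \<and> grad (\<kappa>2 j) xb \<bullet> \<xi> = 0) \<longleftrightarrow>
    (j \<in> I01 \<union> I00 \<longrightarrow> g1 j xb \<bullet> \<xi> = 0) \<and> (j \<in> I10 \<union> I00 \<longrightarrow> g2 j xb \<bullet> \<xi> = 0)" for j \<xi>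
    by (cases j rule: index_cases) (simp_all add: grad_\<kappa>1 grad_\<kappa>2)
  then have "(\<forall>j. grad (\<kappa>1 j) xb \<bullet> \<xi> = 0 \<and> grad (\<kappa>2 j) xb \<bullet> \<xi> = 0) \<longleftrightarrow>
    (\<forall>j\<in>I01 \<union> I00. g1 j xb \<bullet> \<xi> = 0) \<and> (\<forall>j\<in>I10 \<union> I00. g2 j xb \<bullet> \<xi> = 0)" for \<xi>
    unfolding Ball_def by (simp only: all_conj_distrib)
  then show ?thesis unfolding core.tangent_def mpcc_tangent_def by (simp only:)
qed

lemma core_G: "core.G j = prd j"
  by (auto simp: core.G_def \<kappa>1_def \<kappa>2_def)

lemma tangent_at_eq: "core.tangent_at x = smoothing_tangent F1 F2 x"
  by (simp add: core.tangent_at_def smoothing_tangent_def core_G grad_prd)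

text \<open>The two Lagrangians differ, but their Hessians agree on tangent vectors. The additional terms in
  the Hessian of \<open>F1 j * F2 j\<close> for \<open>j\<close> in \<open>a01\<close> or \<open>a10\<close> contain the factor that vanishes at \<open>xb\<close> or its
  derivative along the tangent space.\<close>
lemma hessian_mpcc_lagrangian:
  assumes "x \<in> mpcc_tangent F1 F2 xb" "y \<in> mpcc_tangent F1 F2 xb"
  shows "y \<bullet> (hessian (mpcc_lagrangian f F1 F2 xb \<sigma>1 \<sigma>2 \<rho>1 \<rho>2) xb *v x) = y \<bullet> core.hess xb core.p0 core.q0 x"
proof -
  define l1 where "l1 j = (if j \<in> I01 then \<sigma>1 j else if j \<in> I00 then \<rho>1 j else 0)" for j
  define l2 where "l2 j = (if j \<in> I10 then \<sigma>2 j else if j \<in> I00 then \<rho>2 j else 0)" for j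
  let ?L1 = "\<lambda>x. 0 + f x - (\<Sum>j\<in>UNIV. l1 j * F1 x $ j)"
  let ?L2 = "\<lambda>x. 0 + ?L1 x - (\<Sum>j\<in>UNIV. l2 j * F2 x $ j)"
  have l: "j \<in> I01 \<Longrightarrow> l1 j = \<sigma>1 j" "j \<in> I10 \<Longrightarrow> l1 j = 0" "j \<in> I00 \<Longrightarrow> l1 j = \<rho>1 j"
    "j \<in> I01 \<Longrightarrow> l2 j = 0" "j \<in> I10 \<Longrightarrow> l2 j = \<sigma>2 j" "j \<in> I00 \<Longrightarrow> l2 j = \<rho>2 j" for j
    by (auto simp: l1_def l2_def a00_def a01_def a10_def)
  have "mpcc_lagrangian f F1 F2 xb \<sigma>1 \<sigma>2 \<rho>1 \<rho>2 = ?L2"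
  proof
    fix x
    have "(\<Sum>j\<in>UNIV. l1 j * F1 x $ j) = (\<Sum>j\<in>I01. \<sigma>1 j * F1 x $ j) + (\<Sum>j\<in>I00. \<rho>1 j * F1 x $ j)"
      unfolding sum_split by (simp add: l)
    moreover have "(\<Sum>j\<in>UNIV. l2 j * F2 x $ j) = (\<Sum>j\<in>I10. \<sigma>2 j * F2 x $ j) + (\<Sum>j\<in>I00. \<rho>2 j * F2 x $ j)"
      unfolding sum_split by (simp add: l)
    ultimately show "mpcc_lagrangian f F1 F2 xb \<sigma>1 \<sigma>2 \<rho>1 \<rho>2 x = ?L2 x"
      by (simp add: mpcc_lagrangian_def sum.distrib)
  qed
  moreover have "C2 ?L1" by (rule C2_affine_combination(1)[OF C2_f C2_comp(1)])
  then have "hessian ?L2 xb *v x = hessian ?L1 xb *v x - (\<Sum>j\<in>UNIV. l2 j *\<^sub>R (H2 j xb *v x))"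
    by (rule C2_affine_combination(3)[OF _ C2_comp(2)])
  moreover have "hessian ?L1 xb *v x = hessian f xb *v x - (\<Sum>j\<in>UNIV. l1 j *\<^sub>R (H1 j xb *v x))"
    by (rule C2_affine_combination(3)[OF C2_f C2_comp(1)])
  ultimately have lhs: "y \<bullet> (hessian (mpcc_lagrangian f F1 F2 xb \<sigma>1 \<sigma>2 \<rho>1 \<rho>2) xb *v x)
      = y \<bullet> (hessian f xb *v x) - (\<Sum>j\<in>UNIV. l1 j * (y \<bullet> (H1 j xb *v x)) + l2 j * (y \<bullet> (H2 j xb *v x)))"
    by (simp add: inner_diff_right inner_sum_right sum.distrib)
  have tan: "j \<in> I01 \<union> I00 \<Longrightarrow> g1 j xb \<bullet> x = 0 \<and> g1 j xb \<bullet> y = 0" "j \<in> I10 \<union> I00 \<Longrightarrow> g2 j xb \<bullet> x = 0 \<and> g2 j xb \<bullet> y = 0" for j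
    using assms by (auto simp: mpcc_tangent_def)
  have "l1 j * (y \<bullet> (H1 j xb *v x)) + l2 j * (y \<bullet> (H2 j xb *v x))
      = \<mu>1 j * (y \<bullet> (hessian (\<kappa>1 j) xb *v x)) + \<mu>2 j * (y \<bullet> (hessian (\<kappa>2 j) xb *v x))" for j
    by (cases j rule: index_cases)
      (simp_all add: l \<mu>1_def \<mu>2_def \<kappa>1_def \<kappa>2_def hessian_const C2_mult(3)[OF C2_comp]
        inner_add_right tan inner_commute[of y])
  then show ?thesis unfolding lhs core.hess_at_base
    by (simp add: inner_diff_right inner_sum_right sum.distrib)
qed

text \<open>A matrix for the linear map \<open>core.hess\<close> at the base point, obtained as the Hessian of the
  corresponding Lagrangian. The zeros match the constant in \<open>C2_affine_combination\<close>.\<close>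
definition "base_hessian = hessian (\<lambda>x. 0 + (0 + f x - (\<Sum>j\<in>UNIV. \<mu>1 j * \<kappa>1 j x)) - (\<Sum>j\<in>UNIV. \<mu>2 j * \<kappa>2 j x)) xb"

lemma base_hessian: "base_hessian *v h = core.hess xb core.p0 core.q0 h"
proof -
  let ?L1 = "\<lambda>x. 0 + f x - (\<Sum>j\<in>UNIV. \<mu>1 j * \<kappa>1 j x)"
  have "C2 ?L1" by (rule C2_affine_combination(1)[OF C2_f core.K1])
  then have "base_hessian *v h = hessian ?L1 xb *v h - (\<Sum>j\<in>UNIV. \<mu>2 j *\<^sub>R (hessian (\<kappa>2 j) xb *v h))"
    unfolding base_hessian_def by (rule C2_affine_combination(3)[OF _ core.K2])
  moreover have "hessian ?L1 xb *v h = hessian f xb *v h - (\<Sum>j\<in>UNIV. \<mu>1 j *\<^sub>R (hessian (\<kappa>1 j) xb *v h))"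
    by (rule C2_affine_combination(3)[OF C2_f core.K1])
  ultimately show ?thesis by (simp only: core.hess_at_base)
qed

lemma base_hessian_index:
  "restricted_nonsingular base_hessian core.tangent"
  "num_negative_eigenvalues base_hessian core.tangent + card {j \<in> I00. \<mu>1 j < 0} = C_index f F1 F2 xb \<sigma>1 \<sigma>2 \<rho>1 \<rho>2"
proof -
  let ?H = "hessian (mpcc_lagrangian f F1 F2 xb \<sigma>1 \<sigma>2 \<rho>1 \<rho>2) xb"
  have eq: "y \<bullet> (base_hessian *v x) = y \<bullet> (?H *v x)" if "x \<in> core.tangent" "y \<in> core.tangent" for x y
    using hessian_mpcc_lagrangian[of x y] that unfolding tangent_eq base_hessian by simp
  have ns: "restricted_nonsingular ?H core.tangent"
    using nondeg unfolding tangent_eq by (simp add: nondegenerate_C_stationary_def)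
  note cong = restricted_form_cong[OF core.subspace_tangent eq]
  show "restricted_nonsingular base_hessian core.tangent" using cong(1) ns by blast
  have "\<mu>1 j < 0 \<longleftrightarrow> \<rho>1 j < 0 \<and> \<rho>2 j < 0" if "j \<in> I00" for j
    using \<rho>_pos[OF that] that by (auto simp: \<mu>1_def zero_less_mult_iff)
  then have "{j \<in> I00. \<mu>1 j < 0} = {j \<in> I00. \<rho>1 j < 0 \<and> \<rho>2 j < 0}" by blast
  then show "num_negative_eigenvalues base_hessian core.tangent + card {j \<in> I00. \<mu>1 j < 0} = C_index f F1 F2 xb \<sigma>1 \<sigma>2 \<rho>1 \<rho>2"
    using cong(2) unfolding C_index_def tangent_eq by simp
qed

lemma core_kkt_of_smoothing_KKT: "smoothing_KKT_with f F1 F2 t x \<eta> \<Longrightarrow> core.kkt t x (\<lambda>j. - \<eta> j)"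
  by (simp add: smoothing_KKT_with_def smoothing_feasible_def core.kkt_def core_G grad_prd sum_negf \<kappa>1_def \<kappa>2_def)

text \<open>For \<open>j\<close> in \<open>a01\<close> or \<open>a10\<close>, \<open>F1 j * F2 j = t\<close> alone would allow both factors to be negative. On this
  neighbourhood of \<open>xb\<close> the factor that is positive at \<open>xb\<close> stays so.\<close>
definition positivity_region :: "(real^'n) set" where
  "positivity_region = {x. (\<forall>j\<in>I01. F2 x $ j > 0) \<and> (\<forall>j\<in>I10. F1 x $ j > 0)}"

lemma positivity_region: "open positivity_region" "xb \<in> positivity_region"
proof -
  have c: "continuous_on UNIV (\<lambda>x. F1 x $ j)" "continuous_on UNIV (\<lambda>x. F2 x $ j)" for j
    using C2_continuous_on[OF C2_comp(1) continuous_on_id] C2_continuous_on[OF C2_comp(2) continuous_on_id] by blast+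
  have "open ((\<Inter>j\<in>I01. {x. 0 < F2 x $ j}) \<inter> (\<Inter>j\<in>I10. {x. 0 < F1 x $ j}))"
    by (intro open_Int open_INT finite ballI open_Collect_less c continuous_on_const)
  also have "(\<Inter>j\<in>I01. {x. 0 < F2 x $ j}) \<inter> (\<Inter>j\<in>I10. {x. 0 < F1 x $ j}) = positivity_region"
    by (auto simp: positivity_region_def)
  finally show "open positivity_region" .
  show "xb \<in> positivity_region" by (simp add: positivity_region_def a01_def a10_def)
qed

lemma smoothing_KKT_of_core_kkt:
  assumes kkt: "core.kkt t x \<omega>" and x: "x \<in> positivity_region" and t: "t > 0"
  shows "smoothing_KKT_with f F1 F2 t x (\<lambda>j. - \<omega> j)"
proof -
  have prd: "F1 x $ j * F2 x $ j = t" for j using kkt by (simp add: core.kkt_def core_G)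
  have "F1 x $ j \<ge> 0 \<and> F2 x $ j \<ge> 0" for j
  proof (cases j rule: index_cases)
    case 1
    then show ?thesis using kkt by (auto simp: core.kkt_def \<kappa>1_def \<kappa>2_def)
  next
    case 2
    then have "F2 x $ j > 0" using x by (simp add: positivity_region_def)
    then show ?thesis using prd[of j] t by (metis less_imp_le zero_less_mult_pos2)
  next
    case 3
    then have "F1 x $ j > 0" using x by (simp add: positivity_region_def)
    then show ?thesis using prd[of j] t by (metis less_imp_le zero_less_mult_pos)
  qed
  then have "x \<in> smoothing_feasible F1 F2 t" using prd by (simp add: smoothing_feasible_def)
  moreover have "grad f x = (\<Sum>j\<in>UNIV. \<omega> j *\<^sub>R smoothing_grad F1 F2 x j)"
    using kkt by (simp add: core.kkt_def core_G grad_prd)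
  ultimately show ?thesis by (simp add: smoothing_KKT_with_def sum_negf)
qed

lemma hessian_smoothing_lagrangian:
  "hessian (smoothing_lagrangian f F1 F2 t (\<lambda>j. - \<omega> j)) x *v h
    = hessian f x *v h - (\<Sum>j\<in>UNIV. \<omega> j *\<^sub>R (hessian (core.G j) x *v h))"
proof -
  have "smoothing_lagrangian f F1 F2 t (\<lambda>j. - \<omega> j)
      = (\<lambda>x. (\<Sum>j\<in>UNIV. \<omega> j * t) + f x - (\<Sum>j\<in>UNIV. \<omega> j * core.G j x))"
    by (rule ext) (simp add: smoothing_lagrangian_def core_G right_diff_distrib sum_subtractf sum_negf)
  then show ?thesis
    by (simp only: C2_affine_combination(3)[OF C2_f core.G])
qed

lemma unique_nondegenerate_smoothing_KKT:
  "\<exists>V. open V \<and> xb \<in> V \<and>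
    (\<forall>U. U \<subseteq> V \<and> xb \<in> interior U \<longrightarrow>
      (\<exists>t0>0. \<forall>t. 0 < t \<and> t < t0 \<longrightarrow>
        (\<exists>xt\<in>U.
          (\<exists>\<eta>. nondegenerate_smoothing_KKT_with f F1 F2 t xt \<eta>
               \<and> smoothing_quadratic_index f F1 F2 t xt \<eta> = C_index f F1 F2 xb \<sigma>1 \<sigma>2 \<rho>1 \<rho>2)
          \<and> (\<forall>y\<in>U. smoothing_KKT f F1 F2 t y \<longrightarrow> y = xt))))"
proof -
  from core.unique_nondegenerate_kkt_near_base[OF base_hessian base_hessian_index(1)] obtain V where V: "open V" "xb \<in> V"
    and core: "\<forall>U. open U \<longrightarrow> xb \<in> U \<longrightarrow> (\<exists>t0>0. \<forall>t. 0 < t \<and> t < t0 \<longrightarrow>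
    (\<exists>x\<in>U. \<exists>\<omega>. core.kkt t x \<omega> \<and>
      (\<forall>c. (\<Sum>j\<in>UNIV. c j *\<^sub>R grad (core.G j) x) = 0 \<longrightarrow> (\<forall>j. c j = 0)) \<and>
      (\<forall>A'. (\<forall>h. A' *v h = hessian f x *v h - (\<Sum>j\<in>UNIV. \<omega> j *\<^sub>R (hessian (core.G j) x *v h))) \<longrightarrow>
        restricted_nonsingular A' (core.tangent_at x) \<and>
        num_negative_eigenvalues A' (core.tangent_at x) = num_negative_eigenvalues base_hessian core.tangent + card {j \<in> I00. \<mu>1 j < 0}) \<and>
      (\<forall>y\<in>V. \<forall>\<omega>'. core.kkt t y \<omega>' \<longrightarrow> y = x)))"
    by (elim exE conjE)
  show ?thesis
  proof (intro exI[of _ V] conjI allI impI)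
    show "open V" "xb \<in> V" by (fact V)+
    fix U assume U: "U \<subseteq> V \<and> xb \<in> interior U"
    have "open (interior U \<inter> positivity_region)" "xb \<in> interior U \<inter> positivity_region" using positivity_region U by (auto intro: open_Int)
    then obtain t0 where t0: "t0 > 0" and t0': "\<forall>t. 0 < t \<and> t < t0 \<longrightarrow>
      (\<exists>x\<in>interior U \<inter> positivity_region. \<exists>\<omega>. core.kkt t x \<omega> \<and>
      (\<forall>c. (\<Sum>j\<in>UNIV. c j *\<^sub>R grad (core.G j) x) = 0 \<longrightarrow> (\<forall>j. c j = 0)) \<and>
      (\<forall>A'. (\<forall>h. A' *v h = hessian f x *v h - (\<Sum>j\<in>UNIV. \<omega> j *\<^sub>R (hessian (core.G j) x *v h))) \<longrightarrow>
        restricted_nonsingular A' (core.tangent_at x) \<and>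
        num_negative_eigenvalues A' (core.tangent_at x) = num_negative_eigenvalues base_hessian core.tangent + card {j \<in> I00. \<mu>1 j < 0}) \<and>
      (\<forall>y\<in>V. \<forall>\<omega>'. core.kkt t y \<omega>' \<longrightarrow> y = x))"
      using spec[OF core, of "interior U \<inter> positivity_region"] by (elim impE exE conjE)
    show "\<exists>t0>0. \<forall>t. 0 < t \<and> t < t0 \<longrightarrow>
        (\<exists>xt\<in>U.
          (\<exists>\<eta>. nondegenerate_smoothing_KKT_with f F1 F2 t xt \<eta>
               \<and> smoothing_quadratic_index f F1 F2 t xt \<eta> = C_index f F1 F2 xb \<sigma>1 \<sigma>2 \<rho>1 \<rho>2)
          \<and> (\<forall>y\<in>U. smoothing_KKT f F1 F2 t y \<longrightarrow> y = xt))"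
    proof (intro exI[of _ t0] conjI allI impI)
      show "t0 > 0" by (fact t0)
      fix t assume t: "0 < t \<and> t < t0"
      from spec[OF t0', of t, THEN mp, OF t] obtain x \<omega> where x: "x \<in> interior U \<inter> positivity_region" and kkt: "core.kkt t x \<omega>"
        and licq_x: "\<forall>c. (\<Sum>j\<in>UNIV. c j *\<^sub>R grad (core.G j) x) = 0 \<longrightarrow> (\<forall>j. c j = 0)"
        and ind: "\<forall>A'. (\<forall>h. A' *v h = hessian f x *v h - (\<Sum>j\<in>UNIV. \<omega> j *\<^sub>R (hessian (core.G j) x *v h))) \<longrightarrow>
          restricted_nonsingular A' (core.tangent_at x) \<and>
          num_negative_eigenvalues A' (core.tangent_at x) = num_negative_eigenvalues base_hessian core.tangent + card {j \<in> I00. \<mu>1 j < 0}"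
        and uniq: "\<forall>y\<in>V. \<forall>\<omega>'. core.kkt t y \<omega>' \<longrightarrow> y = x"
        by (elim bexE exE conjE)
      define \<eta> where "\<eta> = (\<lambda>j. - \<omega> j)"
      have xU: "x \<in> U" using x interior_subset by blast
      have 1: "smoothing_KKT_with f F1 F2 t x \<eta>"
        unfolding \<eta>_def using smoothing_KKT_of_core_kkt[OF kkt] x t by blast
      have 2: "independent_family (smoothing_grad F1 F2 x) UNIV"
        using licq_x by (simp add: independent_family_iff core_G grad_prd)
      have "\<forall>h. hessian (smoothing_lagrangian f F1 F2 t \<eta>) x *v h
          = hessian f x *v h - (\<Sum>j\<in>UNIV. \<omega> j *\<^sub>R (hessian (core.G j) x *v h))"
        unfolding \<eta>_def by (intro allI hessian_smoothing_lagrangian)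
      from spec[OF ind, THEN mp, OF this]
      have 3: "restricted_nonsingular (hessian (smoothing_lagrangian f F1 F2 t \<eta>) x) (smoothing_tangent F1 F2 x)"
        "num_negative_eigenvalues (hessian (smoothing_lagrangian f F1 F2 t \<eta>) x) (smoothing_tangent F1 F2 x)
          = C_index f F1 F2 xb \<sigma>1 \<sigma>2 \<rho>1 \<rho>2"
        unfolding tangent_at_eq base_hessian_index(2) by blast+
      have 4: "\<forall>y\<in>U. smoothing_KKT f F1 F2 t y \<longrightarrow> y = x"
      proof (intro ballI impI)
        fix y assume y: "y \<in> U" "smoothing_KKT f F1 F2 t y"
        then obtain \<eta>' where "smoothing_KKT_with f F1 F2 t y \<eta>'" unfolding smoothing_KKT_def by blast
        then have "core.kkt t y (\<lambda>j. - \<eta>' j)" by (rule core_kkt_of_smoothing_KKT)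
        then show "y = x" using uniq y(1) U by blast
      qed
      show "\<exists>xt\<in>U.
          (\<exists>\<eta>. nondegenerate_smoothing_KKT_with f F1 F2 t xt \<eta>
               \<and> smoothing_quadratic_index f F1 F2 t xt \<eta> = C_index f F1 F2 xb \<sigma>1 \<sigma>2 \<rho>1 \<rho>2)
          \<and> (\<forall>y\<in>U. smoothing_KKT f F1 F2 t y \<longrightarrow> y = xt)"
        by (rule bexI[OF _ xU], rule conjI, rule exI[of _ \<eta>])
          (use 1 2 3 4 in \<open>simp_all add: nondegenerate_smoothing_KKT_with_def smoothing_quadratic_index_def\<close>)
    qed
  qed
qed

end

theorem theorem8:
  fixes f :: "real^'n \<Rightarrow> real" and F1 F2 :: "real^'n \<Rightarrow> real^'k"
    and xb :: "real^'n" and \<sigma>1 \<sigma>2 \<rho>1 \<rho>2 :: "'k \<Rightarrow> real" and c :: nat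
  assumes "C2 f" and "C2_vec F1" and "C2_vec F2"
    and "nondegenerate_C_stationary f F1 F2 xb \<sigma>1 \<sigma>2 \<rho>1 \<rho>2"
    and "C_index f F1 F2 xb \<sigma>1 \<sigma>2 \<rho>1 \<rho>2 = c"
  shows "\<exists>V. open V \<and> xb \<in> V \<and>
    (\<forall>U. U \<subseteq> V \<and> xb \<in> interior U \<longrightarrow>
      (\<exists>t0>0. \<forall>t. 0 < t \<and> t < t0 \<longrightarrow>
        (\<exists>xt\<in>U.
          (\<exists>\<eta>. nondegenerate_smoothing_KKT_with f F1 F2 t xt \<eta>
               \<and> smoothing_quadratic_index f F1 F2 t xt \<eta> = c)
          \<and> (\<forall>y\<in>U. smoothing_KKT f F1 F2 t y \<longrightarrow> y = xt))))"
proof -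
  interpret nondegenerate_mpcc_point f F1 F2 xb \<sigma>1 \<sigma>2 \<rho>1 \<rho>2
    using assms(1-4) by unfold_locales
  show ?thesis using unique_nondegenerate_smoothing_KKT unfolding assms(5) .
qed

end
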